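(* Let $\alpha\in(0,1)$, $\beta\ge0$, $q\in L_1(0,1)$, and let $N\in C^\infty(\mathbb R)$ be given by $N(u)=\sum_{p=1}^\infty a_pu^p$ for all $u\in\mathbb R$. For each positive integer $n$ let $\lambda_n^{(j)},u_n^{(j)}$ ($j\ge 0$), $s_n$, $\widetilde c_n$, $M_n$, $R=R(n)$ and $r_n$ be the quantities defined in the context. Then there exists a positive integer $n_0$ such that for all $n\ge n_0$ one has $r_n<1$ and the FD-method converges superexponentially to an exact solution of the problem $$u''(x)-\bigl[\beta\delta(x-\alpha)+q(x)\bigr]u(x)+\lambda u(x)-N(u(x))=0,\quad x\in(0,1)\setminus\{\alpha\},\qquad u(0)=u(1)=0,\quad u'(0)=1,$$ in the following sense. The series $\sum_{j\ge0}\lambda_n^{(j)}$ converges, the series $\sum_{j\ge0}u_n^{(j)}$ converges uniformly on $[0,1]$, their sums $\lambda_n$ and $u_n$ form a solution of this problem, and there are positive constants $c$ and $\varepsilon$ (possibly depending on $n$) such that, with $$\alpha_j=\frac{c}{j^{1+\varepsilon}}\quad(j\ge1),\qquad C_{n,m}=\frac{\alpha_{m+1}M_n}{1-r_n},$$ the partial sums $\lambda_n^{[m]}=\sum_{j=0}^m\lambda_n^{(j)}$ and $u_n^{[m]}=\sum_{j=0}^m u_n^{(j)}$ satisfy, for every integer $m\ge0$, $$\bigl\|u_n-u_n^{[m]}\bigr\|_\infty\le C_{n,m}\min\Bigl\{\frac1{M_n},\ \frac1{s_n},\ \frac1{s_n\sqrt{\widetilde c_n}}\Bigr\}\,r_n^{m+1},$$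 $$\bigl|\lambda_n-\lambda_n^{[m]}\bigr|\le \frac{C_{n,m}}{\Bigl(M_n+\max\bigl\{1,\ \widetilde c_n,\ \sqrt{\widetilde c_n}\,M_n/s_n\bigr\}\Bigr)R}\;r_n^{m}.$$
   Context: Problem. $\delta$ is the Dirac delta function. A pair $(\lambda,u)$ solves the problem if $u\in C[0,1]$, $u'$ is absolutely continuous on each side of $\alpha$ (up to $\alpha$ and the endpoints), $u''-q u+\lambda u-N(u)=0$ holds almost everywhere on $(0,1)\setminus\{\alpha\}$, $u(0)=u(1)=0$, $u'(0)=1$, and $u'(\alpha+0)-u'(\alpha-0)=\beta u(\alpha)$. This jump condition is the meaning of the delta term. Norms. $\|v\|_\infty=\max_{x\in[0,1]}|v(x)|$ and $\|q\|_{0,1}=\int_0^1|q(x)|\,dx$. Adomian polynomials. For a function $G$ given by a power series and $k\ge0$, $$A_k(G;v_0,\dots,v_k)=\frac1{k!}\frac{d^k}{dt^k}G\Bigl(\sum_{p=0}^{k}v_pt^p\Bigr)\Big|_{t=0}.$$ Basic (unperturbed) eigenpair. $\lambda_n^{(0)}$ is the unique root in $[\pi^2n^2,\pi^2(n+1)^2)$ of $$\sqrt{\lambda}\sin(\sqrt{\lambda})=-\beta\sin(\sqrt{\lambda}\,\alpha)\sin(\sqrt{\lambda}(1-\alpha)),$$ and $s_n=\sqrt{\lambda_n^{(0)}}$. Set $$c_n^{(0)}=\frac{\sin(s_n\alpha)}{s_n\sin(s_n(1-\alpha))}\ \text{ if }\sin(s_n(1-\alpha))\ne0,\qquad c_n^{(0)}=-\frac{\cos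 s_n}{s_n}\ \text{ otherwise},$$ $$u_n^{(0)}(x)=\frac{\sin(s_nx)}{s_n}\ (0\le x\le\alpha),\qquad u_n^{(0)}(x)=c_n^{(0)}\sin(s_n(1-x))\ (\alpha<x\le1).$$ Corrections of the FD-method. For $j\ge1$, recursively, writing $A_{j-1}(x)=A_{j-1}\bigl(N;u_n^{(0)}(x),\dots,u_n^{(j-1)}(x)\bigr)$, $$\lambda_n^{(j)}=\frac{\lambda_n^{(0)}}{M_n}\Bigl(-\sum_{p=1}^{j-1}\lambda_n^{(j-p)}\int_0^1u_n^{(0)}u_n^{(p)}\,d\xi+\int_0^1 q\,u_n^{(j-1)}u_n^{(0)}\,d\xi+\int_0^1A_{j-1}(\xi)u_n^{(0)}(\xi)\,d\xi\Bigr),$$ $$F_n^{(j)}(x)=-\sum_{p=0}^{j-1}\lambda_n^{(j-p)}u_n^{(p)}(x)+q(x)u_n^{(j-1)}(x)+A_{j-1}(x),$$ $$u_n^{(j)}(x)=\int_0^x\frac{\sin(s_n(x-\xi))}{s_n}F_n^{(j)}(\xi)\,d\xi\quad(0\le x\le\alpha),$$ $$u_n^{(j)}(x)=c_n^{(j)}\sin(s_n(1-x))-\int_x^1\frac{\sin(s_n(x-\xi))}{s_n}F_n^{(j)}(\xi)\,d\xi\quad(\alpha\le x\le1),$$ where the number $c_n^{(j)}$ is determined by the two (mutually compatible) equations $$c_n^{(j)}\sin(s_n(1-\alpha))=\int_0^1\frac{\sin(s_n(\alpha-\xi))}{s_n}F_n^{(j)}(\xi)\,d\xi,$$ $$c_n^{(j)}\cos(s_n(1-\alpha))=-\int_0^1\frac{\cos(s_n(\alpha-\xi))}{s_n}F_n^{(j)}(\xi)\,d\xi-\beta\int_0^\alpha\frac{\sin(s_n(\alpha-\xi))}{\lambda_n^{(0)}}F_n^{(j)}(\xi)\,d\xi.$$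 Constants. $$\widetilde c_n=\sin^2(s_n\alpha)+\Bigl(\cos(s_n\alpha)+\frac{\beta}{s_n}\sin(s_n\alpha)\Bigr)^2=\lambda_n^{(0)}\bigl(c_n^{(0)}\bigr)^2,$$ $$M_n=\lambda_n^{(0)}\int_0^1\bigl(u_n^{(0)}\bigr)^2d\xi=\frac12\Bigl(1+\Bigl[\frac{\beta\sin(2s_n\alpha)}{s_n}+\frac{\beta^2\sin^2(s_n\alpha)}{\lambda_n^{(0)}}\Bigr](1-\alpha)+\frac{\beta\sin^2(s_n\alpha)}{\lambda_n^{(0)}}\Bigr),$$ $$b_n=\max\Bigl\{1,\frac{s_n}{M_n},\frac{s_n\sqrt{\widetilde c_n}}{M_n}\Bigr\},\qquad \overline v_0=b_n\|u_n^{(0)}\|_\infty,$$ $$\widetilde N(u)=\sum_{p=1}^\infty|a_p|u^p,\qquad \widetilde N_1(v)=\widetilde N\bigl(\|u_n^{(0)}\|_\infty+v\bigr).$$ Radius $R=R(n)$. It is the radius of convergence of the power series $f(z)=\sum_{j\ge1}\overline v_jz^j$ that satisfies $$f(z)=f(z)^2+z(1+\overline v_0)\Bigl[\|q\|_{0,1}\bigl(f(z)+\overline v_0\bigr)+\widetilde N_1(f(z))+\widetilde N_1'(0)\overline v_0-\widetilde N_1(0)\Bigr].$$ Equivalently, $\overline v_1=(1+\overline v_0)\bigl(\|q\|_{0,1}\overline v_0+\widetilde N_1'(0)\overline v_0\bigr)$ and, for $j\ge2$, $$\overline v_j=\sum_{p=1}^{j-1}\overline v_{j-p}\overline v_p+(1+\overline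 v_0)\bigl(\|q\|_{0,1}\overline v_{j-1}+A_{j-1}(\widetilde N_1;0,\overline v_1,\dots,\overline v_{j-1})\bigr).$$ Finally $$r_n=\frac{1+\sqrt{1+(1+\beta/s_n)^2}}{s_nR}.$$ If $R=+\infty$, read $1/R=0$ and $r_n=0$. *)

theory Defs
  imports "HOL-Analysis.Analysis"
begin

(* Sup norm over [0,1]. It is only applied to functions continuous on [0,1], where the
   supremum is the maximum. *)
definition sup_norm :: "(real \<Rightarrow> real) \<Rightarrow> real" where
  "sup_norm v = (SUP x\<in>{0..1}. \<bar>v x\<bar>)"

definition L1_norm :: "(real \<Rightarrow> real) \<Rightarrow> real" where
  "L1_norm q = integral {0..1} (\<lambda>x. \<bar>q x\<bar>)"

(* A finite family of non-overlapping subintervals is given by the set D of its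
   pairs (left endpoint, right endpoint). *)
definition absolutely_continuous_on :: "real \<Rightarrow> real \<Rightarrow> (real \<Rightarrow> real) \<Rightarrow> bool" where
  "absolutely_continuous_on a b f \<longleftrightarrow>
     (\<forall>\<epsilon>>0. \<exists>\<delta>>0. \<forall>D::(real \<times> real) set.
        finite D \<longrightarrow> (\<forall>(x, y)\<in>D. a \<le> x \<and> x \<le> y \<and> y \<le> b) \<longrightarrow>
        disjoint_family_on (\<lambda>(x, y). {x<..<y}) D \<longrightarrow>
        (\<Sum>(x, y)\<in>D. y - x) < \<delta> \<longrightarrow>
        (\<Sum>(x, y)\<in>D. \<bar>f y - f x\<bar>) < \<epsilon>)"

(* dl and dr are u' on [0,\<alpha>] and on [\<alpha>,1], extended by one-sided derivatives, so that
   dl \<alpha> = u'(\<alpha> - 0) and dr \<alpha> = u'(\<alpha> + 0). *)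
definition solves_problem ::
  "real \<Rightarrow> real \<Rightarrow> (real \<Rightarrow> real) \<Rightarrow> (real \<Rightarrow> real) \<Rightarrow> real \<Rightarrow> (real \<Rightarrow> real) \<Rightarrow> bool" where
  "solves_problem \<alpha> \<beta> q N lam u \<longleftrightarrow>
     continuous_on {0..1} u \<and> u 0 = 0 \<and> u 1 = 0 \<and>
     (\<exists>dl dr.
        (\<forall>x\<in>{0..\<alpha>}. (u has_real_derivative dl x) (at x within {0..\<alpha>})) \<and>
        (\<forall>x\<in>{\<alpha>..1}. (u has_real_derivative dr x) (at x within {\<alpha>..1})) \<and>
        absolutely_continuous_on 0 \<alpha> dl \<and> absolutely_continuous_on \<alpha> 1 dr \<and>
        dl 0 = 1 \<and> dr \<alpha> - dl \<alpha> = \<beta> * u \<alpha>) \<and>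
     (AE x in lebesgue. x \<in> {0<..<1} - {\<alpha>} \<longrightarrow>
        deriv u field_differentiable at x \<and>
        deriv (deriv u) x - q x * u x + lam * u x - N (u x) = 0)"

definition adomian :: "(real \<Rightarrow> real) \<Rightarrow> nat \<Rightarrow> (nat \<Rightarrow> real) \<Rightarrow> real" where
  "adomian G k v = (deriv ^^ k) (\<lambda>t. G (\<Sum>p\<le>k. v p * t ^ p)) 0 / fact k"

lemma adomian_cong [fundef_cong]:
  assumes "G = G'" "k = k'" "\<And>p. p \<le> k' \<Longrightarrow> v p = v' p"
  shows "adomian G k v = adomian G' k' v'"
proof -
  have "(\<Sum>p\<le>k'. v p * t ^ p) = (\<Sum>p\<le>k'. v' p * t ^ p)" for t :: real
    by (rule sum.cong) (auto simp: assms(3))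
  then show ?thesis
    by (simp add: adomian_def assms(1,2))
qed

definition eig0 :: "real \<Rightarrow> real \<Rightarrow> nat \<Rightarrow> real" where
  "eig0 \<alpha> \<beta> n = (THE l. l \<in> {pi\<^sup>2 * (real n)\<^sup>2 ..< pi\<^sup>2 * (real n + 1)\<^sup>2} \<and>
     sqrt l * sin (sqrt l) = - \<beta> * sin (sqrt l * \<alpha>) * sin (sqrt l * (1 - \<alpha>)))"

definition freq :: "real \<Rightarrow> real \<Rightarrow> nat \<Rightarrow> real" where
  "freq \<alpha> \<beta> n = sqrt (eig0 \<alpha> \<beta> n)"

definition c0 :: "real \<Rightarrow> real \<Rightarrow> nat \<Rightarrow> real" where
  "c0 \<alpha> \<beta> n = (let s = freq \<alpha> \<beta> n in
     if sin (s * (1 - \<alpha>)) \<noteq> 0 then sin (s * \<alpha>) / (s * sin (s * (1 - \<alpha>)))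
     else - cos s / s)"

definition u0 :: "real \<Rightarrow> real \<Rightarrow> nat \<Rightarrow> real \<Rightarrow> real" where
  "u0 \<alpha> \<beta> n x = (let s = freq \<alpha> \<beta> n in
     if x \<le> \<alpha> then sin (s * x) / s else c0 \<alpha> \<beta> n * sin (s * (1 - x)))"

definition ctilde :: "real \<Rightarrow> real \<Rightarrow> nat \<Rightarrow> real" where
  "ctilde \<alpha> \<beta> n = (let s = freq \<alpha> \<beta> n in
     (sin (s * \<alpha>))\<^sup>2 + (cos (s * \<alpha>) + \<beta> / s * sin (s * \<alpha>))\<^sup>2)"

definition Mconst :: "real \<Rightarrow> real \<Rightarrow> nat \<Rightarrow> real" where
  "Mconst \<alpha> \<beta> n = eig0 \<alpha> \<beta> n * integral {0..1} (\<lambda>x. (u0 \<alpha> \<beta> n x)\<^sup>2)"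

(* The number c^(j) belonging to the right-hand side F = F^(j). *)
definition corr_c :: "real \<Rightarrow> real \<Rightarrow> nat \<Rightarrow> (real \<Rightarrow> real) \<Rightarrow> real" where
  "corr_c \<alpha> \<beta> n F = (let s = freq \<alpha> \<beta> n in THE c.
     c * sin (s * (1 - \<alpha>)) = integral {0..1} (\<lambda>\<xi>. sin (s * (\<alpha> - \<xi>)) / s * F \<xi>) \<and>
     c * cos (s * (1 - \<alpha>)) =
       - integral {0..1} (\<lambda>\<xi>. cos (s * (\<alpha> - \<xi>)) / s * F \<xi>)
       - \<beta> * integral {0..\<alpha>} (\<lambda>\<xi>. sin (s * (\<alpha> - \<xi>)) / eig0 \<alpha> \<beta> n * F \<xi>))"

definition corr_u :: "real \<Rightarrow> real \<Rightarrow> nat \<Rightarrow> (real \<Rightarrow> real) \<Rightarrow> real \<Rightarrow> real" where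
  "corr_u \<alpha> \<beta> n F x = (let s = freq \<alpha> \<beta> n in
     if x \<le> \<alpha> then integral {0..x} (\<lambda>\<xi>. sin (s * (x - \<xi>)) / s * F \<xi>)
     else corr_c \<alpha> \<beta> n F * sin (s * (1 - x))
          - integral {x..1} (\<lambda>\<xi>. sin (s * (x - \<xi>)) / s * F \<xi>))"

(* The corrections; in the equations for Suc k the index j of the method is k + 1, and the
   argument of corr_u is F^(j). *)
function (sequential)
  fd_lam :: "real \<Rightarrow> real \<Rightarrow> (real \<Rightarrow> real) \<Rightarrow> (real \<Rightarrow> real) \<Rightarrow> nat \<Rightarrow> nat \<Rightarrow> real" and
  fd_u :: "real \<Rightarrow> real \<Rightarrow> (real \<Rightarrow> real) \<Rightarrow> (real \<Rightarrow> real) \<Rightarrow> nat \<Rightarrow> nat \<Rightarrow> real \<Rightarrow> real"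
where
  "fd_lam \<alpha> \<beta> q N n 0 = eig0 \<alpha> \<beta> n"
| "fd_lam \<alpha> \<beta> q N n (Suc k) = eig0 \<alpha> \<beta> n / Mconst \<alpha> \<beta> n *
     (- (\<Sum>p\<in>{1..k}. fd_lam \<alpha> \<beta> q N n (Suc k - p) *
            integral {0..1} (\<lambda>\<xi>. u0 \<alpha> \<beta> n \<xi> * fd_u \<alpha> \<beta> q N n p \<xi>))
      + integral {0..1} (\<lambda>\<xi>. q \<xi> * fd_u \<alpha> \<beta> q N n k \<xi> * u0 \<alpha> \<beta> n \<xi>)
      + integral {0..1} (\<lambda>\<xi>. adomian N k (\<lambda>p. fd_u \<alpha> \<beta> q N n p \<xi>) * u0 \<alpha> \<beta> n \<xi>))"
| "fd_u \<alpha> \<beta> q N n 0 = u0 \<alpha> \<beta> n"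
| "fd_u \<alpha> \<beta> q N n (Suc k) = corr_u \<alpha> \<beta> n
     (\<lambda>x. - (\<Sum>p\<in>{0..k}. fd_lam \<alpha> \<beta> q N n (Suc k - p) * fd_u \<alpha> \<beta> q N n p x)
          + q x * fd_u \<alpha> \<beta> q N n k x
          + adomian N k (\<lambda>p. fd_u \<alpha> \<beta> q N n p x))"
  by pat_completeness auto
termination
  by (relation "Wellfounded.measure (case_sum (\<lambda>(_, _, _, _, _, j). 2 * j) (\<lambda>(_, _, _, _, _, j). 2 * j + 1))")
    auto

definition bconst :: "real \<Rightarrow> real \<Rightarrow> nat \<Rightarrow> real" where
  "bconst \<alpha> \<beta> n = (let s = freq \<alpha> \<beta> n; M = Mconst \<alpha> \<beta> n in
     Max {1, s / M, s * sqrt (ctilde \<alpha> \<beta> n) / M})"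

definition vbar0 :: "real \<Rightarrow> real \<Rightarrow> nat \<Rightarrow> real" where
  "vbar0 \<alpha> \<beta> n = bconst \<alpha> \<beta> n * sup_norm (u0 \<alpha> \<beta> n)"

(* a 0 plays no role: the series start at p = 1. *)
definition Ntilde :: "(nat \<Rightarrow> real) \<Rightarrow> real \<Rightarrow> real" where
  "Ntilde a u = (\<Sum>p. \<bar>a (Suc p)\<bar> * u ^ Suc p)"

definition Ntilde1 :: "real \<Rightarrow> real \<Rightarrow> (nat \<Rightarrow> real) \<Rightarrow> nat \<Rightarrow> real \<Rightarrow> real" where
  "Ntilde1 \<alpha> \<beta> a n v = Ntilde a (sup_norm (u0 \<alpha> \<beta> n) + v)"

(* Coefficients of the majorant series f. The value at 0 is the constant coefficient 0 of f,
   not the constant vbar0; so in the last equation the arguments of the Adomian polynomial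
   are 0, vbar 1, ..., vbar (k + 1). *)
fun vbar :: "real \<Rightarrow> real \<Rightarrow> (real \<Rightarrow> real) \<Rightarrow> (nat \<Rightarrow> real) \<Rightarrow> nat \<Rightarrow> nat \<Rightarrow> real" where
  "vbar \<alpha> \<beta> q a n 0 = 0"
| "vbar \<alpha> \<beta> q a n (Suc 0) = (1 + vbar0 \<alpha> \<beta> n) *
     (L1_norm q * vbar0 \<alpha> \<beta> n + deriv (Ntilde1 \<alpha> \<beta> a n) 0 * vbar0 \<alpha> \<beta> n)"
| "vbar \<alpha> \<beta> q a n (Suc (Suc k)) =
     (\<Sum>p\<in>{1..Suc k}. vbar \<alpha> \<beta> q a n (Suc (Suc k) - p) * vbar \<alpha> \<beta> q a n p)
     + (1 + vbar0 \<alpha> \<beta> n) *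
       (L1_norm q * vbar \<alpha> \<beta> q a n (Suc k)
        + adomian (Ntilde1 \<alpha> \<beta> a n) (Suc k) (\<lambda>p. vbar \<alpha> \<beta> q a n p))"

definition Rconv :: "real \<Rightarrow> real \<Rightarrow> (real \<Rightarrow> real) \<Rightarrow> (nat \<Rightarrow> real) \<Rightarrow> nat \<Rightarrow> ereal" where
  "Rconv \<alpha> \<beta> q a n = conv_radius (vbar \<alpha> \<beta> q a n)"

(* Extended-real division gives 0 if the radius is infinite, and infinity if it is 0. *)
definition rconst :: "real \<Rightarrow> real \<Rightarrow> (real \<Rightarrow> real) \<Rightarrow> (nat \<Rightarrow> real) \<Rightarrow> nat \<Rightarrow> ereal" where
  "rconst \<alpha> \<beta> q a n = (let s = freq \<alpha> \<beta> n in
     ereal (1 + sqrt (1 + (1 + \<beta> / s)\<^sup>2)) / (ereal s * Rconv \<alpha> \<beta> q a n))"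

end

theory Submission
  imports Defs
begin

text \<open>
  Each correction solves \<open>y'' + s\<^sup>2 * y = F\<close> with zero initial data at \<open>0\<close> and the jump condition at \<open>\<alpha>\<close>; the
  choice of \<open>\<lambda>\<^sup>(\<^sup>j\<^sup>)\<close> makes \<open>F\<close> orthogonal to \<open>u\<^sup>(\<^sup>0\<^sup>)\<close>, which is what the second boundary condition needs. Started
  from \<open>0\<close>, the solution is at most \<open>(1 + \<beta> / s) / s\<close> times the \<open>L\<^sub>1\<close> norm of \<open>F\<close>. With \<open>\<tau> = (1 + \<beta> / s) / s\<close>, and
  \<open>V\<^sub>j\<close> for the coefficients of \<open>f\<close>, induction on \<open>j \<ge> 1\<close> gives
  \<open>\<bar>u\<^sup>(\<^sup>j\<^sup>)\<bar> \<le> \<tau>\<^sup>j * V\<^sub>j / b\<^sub>n\<close> and \<open>\<bar>\<lambda>\<^sup>(\<^sup>j\<^sup>)\<bar> \<le> \<tau>\<^sup>j\<^sup>-\<^sup>1 * V\<^sub>j / (1 + v\<^sub>0)\<close>.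

  Since \<open>1 + \<beta> / s\<close> is strictly smaller than \<open>1 + sqrt (1 + (1 + \<beta> / s)\<^sup>2)\<close>, the corrections decay geometrically
  with a ratio strictly below \<open>r\<^sub>n\<close>. The factor \<open>c / j\<^sup>2\<close> in the error bounds is therefore available without any
  analysis of the singularity of \<open>f\<close> at \<open>R\<close>. If \<open>R\<close> is infinite, all corrections vanish. The
  quantities entering the recursion for \<open>f\<close> are bounded uniformly in \<open>n\<close>, so \<open>R\<close> is bounded below and \<open>r\<^sub>n < 1\<close>
  for large \<open>n\<close>, as \<open>s \<ge> n\<close>.

  The sum of the corrections satisfies the integral form of the problem. The equation then holds almost
  everywhere by Lebesgue's differentiation theorem.
\<close>

section \<open>Entire power series\<close>

text \<open>The Adomian polynomial with index k is the coefficient of t^k in N applied to the sum of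
  the terms u^(p)(x) t^p. The constant term u^(0)(x) of the inner series is not 0, so N is
  re-expanded about it; what remains is composition with a series without constant term, whose
  coefficients are finite sums. The Taylor coefficients of N at u^(0)(x) are dominated, for all x at
  once, by those of \<open>Ntilde a\<close> at the sup norm of u^(0), which is the origin of
  \<open>Ntilde1\<close>.

  The factor 1 / b_n in the induction survives this composition because it is at most 1, so each of
  its positive powers is at most itself. The constant term of \<open>Ntilde1\<close>, met only at j
  = 1, does not fit this scheme; there h(t) \<le> t h'(t) for h = \<open>Ntilde a\<close> is used,
  whence the exceptional first coefficient of f. The maximum defining b_n bounds s^2 / M times the
  sup norm of u^(0), which is what the formula for \<lambda>^(j) needs, and the factor 1 + v_0 pays
  for the term \<lambda>^(j) u^(0) inside F.

  Since q is only integrable, F is measured in the L_1 norm and the corrections in the sup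
  norm.\<close>

lemma double_series_swap:
  fixes f :: "nat \<Rightarrow> nat \<Rightarrow> real"
  assumes rows: "\<And>i. summable (\<lambda>k. \<bar>f i k\<bar>)"
    and total: "summable (\<lambda>i. \<Sum>k. \<bar>f i k\<bar>)"
  shows "summable (\<lambda>i. \<bar>f i k\<bar>)"
    and "summable (\<lambda>k. \<Sum>i. \<bar>f i k\<bar>)"
    and "(\<lambda>k. \<Sum>i. f i k) sums (\<Sum>i. \<Sum>k. f i k)"
proof -
  have has_sum_rows: "(h has_sum (\<Sum>k. h k)) UNIV"
    if "summable (\<lambda>k. \<bar>h k\<bar>)" for h :: "nat \<Rightarrow> real"
    using norm_summable_imp_has_sum[of h "\<Sum>k. h k"] that summable_rabs_cancel[OF that]
    by (simp add: summable_sums)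
  \<comment> \<open>Unordered summability over the product makes rows and columns symmetric; both
    iterated sums are then the same \<open>infsum\<close>.\<close>
  have abs: "(\<lambda>(i, k). \<bar>f i k\<bar>) summable_on (UNIV \<times> UNIV)"
  proof (rule summable_on_SigmaI)
    show "((\<lambda>k. case (i, k) of (i, k) \<Rightarrow> \<bar>f i k\<bar>) has_sum (\<Sum>k. \<bar>f i k\<bar>)) UNIV" for i
      using has_sum_rows[of "\<lambda>k. \<bar>f i k\<bar>"] rows[of i] by simp
    show "(\<lambda>i. \<Sum>k. \<bar>f i k\<bar>) summable_on UNIV"
      using total rows by (simp add: summable_on_UNIV_nonneg_real_iff suminf_nonneg)
  qed auto
  have all: "(\<lambda>(i, k). f i k) summable_on (UNIV \<times> UNIV)"
    by (rule abs_summable_summable) (use abs in \<open>simp add: case_prod_unfold\<close>)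
  have abs': "(\<lambda>(k, i). \<bar>f i k\<bar>) summable_on (UNIV \<times> UNIV)"
    using summable_on_swap[THEN iffD1, OF abs] by simp
  have cols: "(\<lambda>i. \<bar>f i k\<bar>) summable_on UNIV" for k
    using summable_on_SigmaD1[of "\<lambda>k i. \<bar>f i k\<bar>" UNIV "\<lambda>_. UNIV" k] abs' by simp
  then show cols': "summable (\<lambda>i. \<bar>f i k\<bar>)" for k
    by (simp add: summable_on_UNIV_nonneg_real_iff)
  have "(\<lambda>k. \<Sum>\<^sub>\<infinity>i. \<bar>f i k\<bar>) summable_on UNIV"
    using summable_on_SigmaD[OF abs'] cols by simp
  moreover have "(\<Sum>\<^sub>\<infinity>i. \<bar>f i k\<bar>) = (\<Sum>i. \<bar>f i k\<bar>)" for k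
    using has_sum_rows[of "\<lambda>i. \<bar>f i k\<bar>"] cols'[of k] by (simp add: infsumI)
  ultimately show "summable (\<lambda>k. \<Sum>i. \<bar>f i k\<bar>)"
    by (simp add: summable_on_UNIV_nonneg_real_iff suminf_nonneg cols')
  let ?S = "infsum (\<lambda>(i, k). f i k) (UNIV \<times> UNIV)"
  have S: "((\<lambda>(i, k). f i k) has_sum ?S) (UNIV \<times> UNIV)"
    using all by (rule has_sum_infsum)
  have "((\<lambda>i. \<Sum>k. f i k) has_sum ?S) UNIV"
    by (rule has_sum_SigmaD[OF S]) (use has_sum_rows[OF rows] in simp)
  then have "(\<Sum>i. \<Sum>k. f i k) = ?S"
    by (simp add: has_sum_imp_sums sums_unique[symmetric])
  moreover have "((\<lambda>(k, i). f i k) has_sum ?S) (UNIV \<times> UNIV)"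
    using has_sum_swap[THEN iffD1, OF S] by simp
  then have "((\<lambda>k. \<Sum>i. f i k) has_sum ?S) UNIV"
    by (rule has_sum_SigmaD) (use has_sum_rows[OF cols'] in simp)
  ultimately show "(\<lambda>k. \<Sum>i. f i k) sums (\<Sum>i. \<Sum>k. f i k)"
    by (simp add: has_sum_imp_sums)
qed

text \<open>One differentiation replaces \<open>d\<close> by \<open>diffs d\<close> and leaves a
  series that again converges everywhere, so the induction generalises over \<open>d\<close> and
  \<open>f\<close>. This turns the iterated derivative in \<open>adomian\<close> into a
  coefficient.\<close>

lemma higher_deriv_power_series_at_0:
  fixes d :: "nat \<Rightarrow> real"
  assumes "\<And>t. (\<lambda>k. d k * t ^ k) sums f t"
  shows "(deriv ^^ n) f 0 = fact n * d n"
  using assms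
proof (induction n arbitrary: d f)
  case 0
  have "(\<lambda>k. d k * 0 ^ k) sums d 0"
    by (rule powser_sums_zero)
  with 0[of 0] show ?case
    by (simp add: sums_unique2)
next
  case (Suc n)
  have f: "f = (\<lambda>t. \<Sum>k. d k * t ^ k)"
    using Suc.prems by (simp add: sums_iff fun_eq_iff)
  have summ: "summable (\<lambda>k. d k * t ^ k)" for t
    using Suc.prems sums_summable by blast
  have "deriv f t = (\<Sum>k. diffs d k * t ^ k)" for t
    unfolding f by (rule DERIV_imp_deriv, rule termdiffs_strong_converges_everywhere, rule summ)
  then have "(\<lambda>k. diffs d k * t ^ k) sums deriv f t" for t
    using termdiff_converges_all[of d t] summ by (simp add: summable_sums)
  from Suc.IH[OF this] show ?case
    by (simp add: funpow_swap1 diffs_def)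
qed

text \<open>Stated through the moduli, so that the property passes unchanged between a series and
  its majorant.\<close>

definition entire_coeffs :: "(nat \<Rightarrow> real) \<Rightarrow> bool" where
  "entire_coeffs b \<longleftrightarrow> (\<forall>u. summable (\<lambda>p. \<bar>b p\<bar> * u ^ p))"

definition pow_series :: "(nat \<Rightarrow> real) \<Rightarrow> real \<Rightarrow> real" where
  "pow_series b u = (\<Sum>p. b p * u ^ p)"

lemma entire_coeffsI:
  assumes "\<And>u. summable (\<lambda>p. b p * u ^ p)"
  shows "entire_coeffs b"
proof -
  have "summable (\<lambda>p. norm (\<bar>b p\<bar> * u ^ p))" for u :: real
    using powser_insidea[of b "\<bar>u\<bar> + 1" u] assms by (simp add: norm_mult norm_power abs_mult power_abs)
  from summable_norm_cancel[OF this] show ?thesis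
    by (simp add: entire_coeffs_def)
qed

lemma entire_coeffs_abs [simp]: "entire_coeffs (\<lambda>p. \<bar>b p\<bar>) \<longleftrightarrow> entire_coeffs b"
  by (simp add: entire_coeffs_def)

lemma entire_coeffs_abs_summable:
  assumes "entire_coeffs b"
  shows "summable (\<lambda>p. \<bar>b p * u ^ p\<bar>)"
  using assms[unfolded entire_coeffs_def, rule_format, of "\<bar>u\<bar>"]
  by (simp add: abs_mult power_abs)

lemma entire_coeffs_sums:
  assumes "entire_coeffs b"
  shows "(\<lambda>p. b p * u ^ p) sums pow_series b u"
  unfolding pow_series_def
  by (rule summable_sums[OF summable_rabs_cancel[OF entire_coeffs_abs_summable[OF assms]]])

text \<open>If \<open>b\<close> is entire with sum \<open>f\<close>, this is \<open>f\<^sup>(\<^sup>i\<^sup>)(x) / i!\<close>.\<close>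

definition taylor_coeff :: "(nat \<Rightarrow> real) \<Rightarrow> real \<Rightarrow> nat \<Rightarrow> real" where
  "taylor_coeff b x i = (\<Sum>m. b (m + i) * real ((m + i) choose i) * x ^ m)"

text \<open>The binomial theorem expands \<open>b p * (x + y) ^ p\<close> into a row of a double
  series. The absolute row sums are
  \<open>\<bar>b p\<bar> * (\<bar>x\<bar> + \<bar>y\<bar>) ^ p\<close>, summable since
  \<open>b\<close> is entire, and summing by columns instead gives the expansion about
  \<open>x\<close>.\<close>

lemma taylor_coeff_facts:
  assumes "entire_coeffs b"
  shows taylor_coeff_summable: "summable (\<lambda>m. \<bar>b (m + i) * real ((m + i) choose i) * x ^ m\<bar>)"
    and entire_taylor_coeff: "entire_coeffs (taylor_coeff b x)"
    and pow_series_taylor: "pow_series (taylor_coeff b x) y = pow_series b (x + y)"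
proof -
  define f where "f x y p i =
    (if i \<le> p then b p * real (p choose i) * x ^ (p - i) * y ^ i else 0)" for x y :: real and p i
  have row: "(\<lambda>i. f x y p i) sums (b p * (x + y) ^ p)" for x y p
  proof -
    have "(\<lambda>i. f x y p i) sums (\<Sum>i\<le>p. f x y p i)"
      by (rule sums_finite) (auto simp: f_def)
    also have "(\<Sum>i\<le>p. f x y p i) = b p * (\<Sum>i\<le>p. real (p choose i) * y ^ i * x ^ (p - i))"
      unfolding sum_distrib_left by (rule sum.cong) (auto simp: f_def)
    also have "(\<Sum>i\<le>p. real (p choose i) * y ^ i * x ^ (p - i)) = (x + y) ^ p"
      using binomial_ring[of y x p] by (simp add: add.commute[of y x])
    finally show ?thesis .
  qed
  have row_abs: "(\<lambda>i. \<bar>f x y p i\<bar>) sums (\<bar>b p\<bar> * (\<bar>x\<bar> + \<bar>y\<bar>) ^ p)" for x y p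
  proof -
    have "(\<lambda>i. \<bar>f x y p i\<bar>) sums (\<Sum>i\<le>p. \<bar>f x y p i\<bar>)"
      by (rule sums_finite) (auto simp: f_def)
    also have "(\<Sum>i\<le>p. \<bar>f x y p i\<bar>)
        = \<bar>b p\<bar> * (\<Sum>i\<le>p. real (p choose i) * \<bar>y\<bar> ^ i * \<bar>x\<bar> ^ (p - i))"
      unfolding sum_distrib_left by (rule sum.cong) (auto simp: f_def abs_mult power_abs)
    also have "(\<Sum>i\<le>p. real (p choose i) * \<bar>y\<bar> ^ i * \<bar>x\<bar> ^ (p - i)) = (\<bar>x\<bar> + \<bar>y\<bar>) ^ p"
      using binomial_ring[of "\<bar>y\<bar>" "\<bar>x\<bar>" p] by (simp add: add.commute[of "\<bar>y\<bar>" "\<bar>x\<bar>"])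
    finally show ?thesis .
  qed
  have r: "summable (\<lambda>i. \<bar>f x y p i\<bar>)" for x y p
    by (rule sums_summable[OF row_abs])
  have t: "summable (\<lambda>p. \<Sum>i. \<bar>f x y p i\<bar>)" for x y
    using assms unfolding sums_unique[OF row_abs, symmetric] entire_coeffs_def by simp
  note swap = double_series_swap[of "f x y" for x y, OF r t]
  have shift: "f x y (m + i) i = b (m + i) * real ((m + i) choose i) * x ^ m * y ^ i" for x y m i
    by (simp add: f_def)
  have summ: "summable (\<lambda>m. \<bar>b (m + i) * real ((m + i) choose i) * x ^ m\<bar>)" for x i
  proof -
    \<comment> \<open>With \<open>y = 1\<close> the column consists of exactly the terms of the
      Taylor coefficient.\<close>
    have "summable (\<lambda>m. \<bar>f x 1 (m + i) i\<bar>)"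
      using swap(1)[of x 1 i] by (rule summable_ignore_initial_segment)
    then show ?thesis
      by (simp add: shift)
  qed
  then show "summable (\<lambda>m. \<bar>b (m + i) * real ((m + i) choose i) * x ^ m\<bar>)" .
  have col: "(\<Sum>p. f x y p i) = taylor_coeff b x i * y ^ i" for x y i
  proof -
    have "(\<Sum>p. f x y p i) = (\<Sum>m. f x y (m + i) i) + (\<Sum>p<i. f x y p i)"
      by (rule suminf_split_initial_segment) (rule summable_rabs_cancel[OF swap(1)])
    also have "(\<Sum>p<i. f x y p i) = 0"
      by (rule sum.neutral) (auto simp: f_def)
    also have "(\<Sum>m. f x y (m + i) i) = taylor_coeff b x i * y ^ i"
      unfolding shift taylor_coeff_def
      by (rule suminf_mult2[symmetric]) (rule summable_rabs_cancel[OF summ])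
    finally show ?thesis by simp
  qed
  have sums: "(\<lambda>i. taylor_coeff b x i * y ^ i) sums pow_series b (x + y)" for y
    using swap(3)[of x y] unfolding col sums_unique[OF row, symmetric]
    by (simp add: pow_series_def)
  show "entire_coeffs (taylor_coeff b x)"
    by (rule entire_coeffsI) (rule sums_summable[OF sums])
  show "pow_series (taylor_coeff b x) y = pow_series b (x + y)"
    using sums by (simp add: pow_series_def sums_iff)
qed

lemma taylor_coeff_nonneg:
  assumes "\<And>p. 0 \<le> b p" "0 \<le> x" "entire_coeffs b"
  shows "0 \<le> taylor_coeff b x i"
  unfolding taylor_coeff_def
  by (rule suminf_nonneg[OF summable_rabs_cancel[OF taylor_coeff_summable[OF assms(3)]]])
     (use assms in auto)

text \<open>Termwise comparison. It replaces a centre that varies with the space variable by one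
  fixed centre and the coefficients by their moduli.\<close>

lemma abs_taylor_coeff_le:
  assumes "entire_coeffs b" "\<bar>x\<bar> \<le> r"
  shows "\<bar>taylor_coeff b x i\<bar> \<le> taylor_coeff (\<lambda>p. \<bar>b p\<bar>) r i"
proof -
  have "\<bar>taylor_coeff b x i\<bar> \<le> (\<Sum>m. \<bar>b (m + i) * real ((m + i) choose i) * x ^ m\<bar>)"
    unfolding taylor_coeff_def by (rule summable_rabs[OF taylor_coeff_summable[OF assms(1)]])
  also have "\<dots> \<le> taylor_coeff (\<lambda>p. \<bar>b p\<bar>) r i"
    unfolding taylor_coeff_def
  proof (rule suminf_le[OF _ taylor_coeff_summable[OF assms(1)] summable_rabs_cancel])
    show "\<bar>b (m + i) * real ((m + i) choose i) * x ^ m\<bar>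
        \<le> \<bar>b (m + i)\<bar> * real ((m + i) choose i) * r ^ m" for m
      using assms(2) by (auto simp: abs_mult power_abs intro!: mult_left_mono power_mono)
    show "summable (\<lambda>m. \<bar>\<bar>b (m + i)\<bar> * real ((m + i) choose i) * r ^ m\<bar>)"
      using taylor_coeff_summable[of "\<lambda>p. \<bar>b p\<bar>" i r] assms by simp
  qed
  finally show ?thesis .
qed

lemma continuous_on_taylor_coeff:
  assumes "entire_coeffs b"
  shows "continuous_on S (\<lambda>x. taylor_coeff b x i)"
proof -
  have "summable (\<lambda>m. b (m + i) * real ((m + i) choose i) * x ^ m)" for x
    by (rule summable_rabs_cancel[OF taylor_coeff_summable[OF assms]])
  from termdiffs_strong_converges_everywhere[OF this]
  have "isCont (\<lambda>x. taylor_coeff b x i) x" for x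
    unfolding taylor_coeff_def by (rule DERIV_isCont)
  then show ?thesis
    by (simp add: continuous_at_imp_continuous_on)
qed

lemma taylor_coeff_0 [simp]: "taylor_coeff b x 0 = pow_series b x"
  by (simp add: taylor_coeff_def pow_series_def)

lemma deriv_pow_series_shift:
  assumes "entire_coeffs b"
  shows "deriv (\<lambda>v. pow_series b (x + v)) 0 = taylor_coeff b x 1"
proof -
  have "(\<lambda>k. taylor_coeff b x k * t ^ k) sums pow_series b (x + t)" for t
    using entire_coeffs_sums[OF entire_taylor_coeff[OF assms], of x t]
    by (simp add: pow_series_taylor[OF assms])
  from higher_deriv_power_series_at_0[OF this, of 1] show ?thesis by simp
qed

text \<open>The Taylor coefficient with index 0 is the value of the series, so this is the preceding
  majorisation at index 0.\<close>

lemma pow_series_mono: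
  assumes "entire_coeffs b" "\<And>p. 0 \<le> b p" "0 \<le> x" "x \<le> y"
  shows "pow_series b x \<le> pow_series b y"
  using abs_taylor_coeff_le[OF assms(1), of x y 0] assms by simp

lemma pow_series_nonneg:
  assumes "entire_coeffs b" "\<And>p. 0 \<le> b p" "0 \<le> x"
  shows "0 \<le> pow_series b x"
  using taylor_coeff_nonneg[of b x 0] assms by simp

text \<open>Without constant term, each monomial \<open>b m * x ^ m\<close> is at most
  \<open>m\<close> times itself. Needed for the first correction, where the majorant contains the
  derivative of \<open>Ntilde1\<close> in place of its value.\<close>

lemma pow_series_le_mult_deriv:
  assumes "entire_coeffs b" "\<And>p. 0 \<le> b p" "b 0 = 0" "0 \<le> x"
  shows "pow_series b x \<le> taylor_coeff b x 1 * x"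
proof -
  have summ: "summable (\<lambda>m. b (m + 1) * real ((m + 1) choose 1) * x ^ m)"
    by (rule summable_rabs_cancel[OF taylor_coeff_summable[OF assms(1)]])
  have b: "(\<lambda>p. b p * x ^ p) sums pow_series b x"
    by (rule entire_coeffs_sums[OF assms(1)])
  then have "(\<lambda>m. b (Suc m) * x ^ Suc m) sums pow_series b x"
    using assms(3) by (subst sums_Suc_iff) simp
  moreover have "(\<lambda>m. b (m + 1) * real ((m + 1) choose 1) * x ^ m * x) sums (taylor_coeff b x 1 * x)"
    unfolding taylor_coeff_def by (rule sums_mult2[OF summable_sums[OF summ]])
  ultimately show ?thesis
  proof (rule sums_le[rotated])
    fix m
    have "b (Suc m) * x ^ Suc m * 1 \<le> b (Suc m) * x ^ Suc m * real (Suc m)"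
      by (rule mult_left_mono) (use assms in auto)
    then show "b (Suc m) * x ^ Suc m \<le> b (m + 1) * real ((m + 1) choose 1) * x ^ m * x"
      by (simp add: mult_ac)
  qed
qed

section \<open>Adomian polynomials as composition coefficients\<close>

text \<open>The vanishing constant term gives the \<open>i\<close>-th power order at least
  \<open>i\<close>, which makes the sum in \<open>comp_coeff\<close> finite.\<close>

definition tail_fps :: "(nat \<Rightarrow> real) \<Rightarrow> real fps" where
  "tail_fps w = Abs_fps (\<lambda>p. if p = 0 then 0 else w p)"

text \<open>The coefficient of \<open>t\<^sup>k\<close> in \<open>\<Sum>i. g i * (\<Sum>p\<ge>1. w p * t\<^sup>p)\<^sup>i\<close>; the value \<open>w 0\<close> is ignored,
  it enters only as the centre of the Taylor expansion \<open>g\<close>.\<close>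

definition comp_coeff :: "(nat \<Rightarrow> real) \<Rightarrow> (nat \<Rightarrow> real) \<Rightarrow> nat \<Rightarrow> real" where
  "comp_coeff g w k = (\<Sum>i\<le>k. g i * fps_nth (tail_fps w ^ i) k)"

text \<open>In a Cauchy product the exponent of \<mu> counts factors and that of \<tau> counts the
  degree; both add up under multiplication.\<close>

lemma abs_fps_power_nth_le:
  fixes V W :: "real fps"
  assumes "\<And>p. p \<le> k \<Longrightarrow> \<bar>fps_nth V p\<bar> \<le> \<mu> * \<tau> ^ p * fps_nth W p"
  shows "j \<le> k \<Longrightarrow> \<bar>fps_nth (V ^ i) j\<bar> \<le> \<mu> ^ i * \<tau> ^ j * fps_nth (W ^ i) j"
proof (induction i arbitrary: j)
  case (Suc i)
  have "\<bar>fps_nth (V ^ Suc i) j\<bar> \<le> (\<Sum>l=0..j. \<bar>fps_nth V l\<bar> * \<bar>fps_nth (V ^ i) (j - l)\<bar>)"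
    by (simp add: fps_mult_nth abs_mult[symmetric] sum_abs)
  also have "\<dots> \<le> (\<Sum>l=0..j. (\<mu> * \<tau> ^ l * fps_nth W l) * (\<mu> ^ i * \<tau> ^ (j - l) * fps_nth (W ^ i) (j - l)))"
    by (intro sum_mono mult_mono' assms Suc.IH) (use Suc.prems in auto)
  also have "\<dots> = \<mu> ^ Suc i * \<tau> ^ j * fps_nth (W ^ Suc i) j"
    unfolding power_Suc fps_mult_nth sum_distrib_left
  proof (rule sum.cong[OF refl])
    fix l assume "l \<in> {0..j}"
    then have "\<tau> ^ j = \<tau> ^ l * \<tau> ^ (j - l)"
      by (simp flip: power_add)
    then show "(\<mu> * \<tau> ^ l * fps_nth W l) * (\<mu> ^ i * \<tau> ^ (j - l) * fps_nth (W ^ i) (j - l))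
        = \<mu> * \<mu> ^ i * \<tau> ^ j * (fps_nth W l * fps_nth (W ^ i) (j - l))"
      by (simp only: mult_ac)
  qed
  finally show ?case .
qed simp

lemma fps_power_nth_nonneg:
  fixes W :: "real fps"
  assumes "\<And>p. 0 \<le> fps_nth W p"
  shows "0 \<le> fps_nth (W ^ i) j"
  by (induction i arbitrary: j) (auto simp: fps_mult_nth assms intro!: sum_nonneg)

lemma tail_fps_power_nth_eq_0: "k < i \<Longrightarrow> fps_nth (tail_fps w ^ i) k = 0"
  using startsby_zero_power_prefix[of "tail_fps w" i] by (simp add: tail_fps_def)

lemma fps_power_nth_cong:
  fixes V W :: "real fps"
  assumes "\<And>p. p \<le> k \<Longrightarrow> fps_nth V p = fps_nth W p"
  shows "j \<le> k \<Longrightarrow> fps_nth (V ^ i) j = fps_nth (W ^ i) j"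
proof (induction i arbitrary: j)
  case (Suc i)
  then show ?case
    by (auto simp: fps_mult_nth assms intro!: sum.cong)
qed simp

lemma comp_coeff_cong:
  assumes "\<And>p. 1 \<le> p \<Longrightarrow> p \<le> k \<Longrightarrow> v p = w p"
  shows "comp_coeff g v k = comp_coeff g w k"
  unfolding comp_coeff_def
  by (intro sum.cong refl arg_cong2[of _ _ _ _ "(*)"] fps_power_nth_cong[of k])
     (use assms in \<open>auto simp: tail_fps_def\<close>)

lemma comp_coeff_0 [simp]: "comp_coeff g w 0 = g 0"
  by (simp add: comp_coeff_def)

lemma comp_coeff_nonneg:
  assumes "\<And>i. 0 \<le> g i" "\<And>p. 0 \<le> w p"
  shows "0 \<le> comp_coeff g w k"
  unfolding comp_coeff_def
  by (intro sum_nonneg mult_nonneg_nonneg fps_power_nth_nonneg)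
     (auto simp: assms tail_fps_def)

text \<open>Since \<open>1 \<le> k\<close>, the zeroth power contributes nothing. Every other power
  carries \<open>\<mu> ^ i \<le> \<mu>\<close>, so one factor \<mu> comes out in front.\<close>

lemma abs_comp_coeff_le:
  assumes g: "\<And>i. \<bar>g i\<bar> \<le> h i"
    and w: "\<And>p. 1 \<le> p \<Longrightarrow> p \<le> k \<Longrightarrow> \<bar>w p\<bar> \<le> \<mu> * \<tau> ^ p * W p"
    and "1 \<le> k" "0 \<le> \<mu>" "\<mu> \<le> 1" "0 \<le> \<tau>" "\<And>p. 0 \<le> W p"
  shows "\<bar>comp_coeff g w k\<bar> \<le> \<mu> * \<tau> ^ k * comp_coeff h W k"
proof -
  have h: "0 \<le> h i" for i
    using g[of i] by linarith
  have "\<bar>g i * fps_nth (tail_fps w ^ i) k\<bar> \<le> \<mu> * \<tau> ^ k * (h i * fps_nth (tail_fps W ^ i) k)" for i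
  proof (cases "i = 0")
    case False
    have W: "0 \<le> fps_nth (tail_fps W ^ i) k"
      by (rule fps_power_nth_nonneg) (simp add: tail_fps_def assms)
    have "\<bar>fps_nth (tail_fps w ^ i) k\<bar> \<le> \<mu> ^ i * \<tau> ^ k * fps_nth (tail_fps W ^ i) k"
      by (rule abs_fps_power_nth_le[of k]) (use w in \<open>auto simp: tail_fps_def\<close>)
    also have "\<mu> ^ i \<le> \<mu> ^ 1"
      using False assms by (intro power_decreasing) auto
    then have "\<mu> ^ i * \<tau> ^ k * fps_nth (tail_fps W ^ i) k \<le> \<mu> ^ 1 * \<tau> ^ k * fps_nth (tail_fps W ^ i) k"
      using W assms by (intro mult_right_mono) auto
    finally have "\<bar>g i\<bar> * \<bar>fps_nth (tail_fps w ^ i) k\<bar> \<le> h i * (\<mu> * \<tau> ^ k * fps_nth (tail_fps W ^ i) k)"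
      using g[of i] h[of i] by (intro mult_mono) auto
    then show ?thesis
      by (simp add: abs_mult mult_ac)
  qed (use \<open>1 \<le> k\<close> in simp)
  then have "\<bar>comp_coeff g w k\<bar> \<le> (\<Sum>i\<le>k. \<mu> * \<tau> ^ k * (h i * fps_nth (tail_fps W ^ i) k))"
    unfolding comp_coeff_def by (intro order.trans[OF sum_abs] sum_mono)
  then show ?thesis
    by (simp add: comp_coeff_def sum_distrib_left)
qed

text \<open>The three claims are proved in one induction because the Cauchy product theorem asks for
  absolute summability of both factors, and the bound on the absolute sum is what later makes the
  sum over \<open>i\<close> converge.\<close>

lemma fps_power_abs_summable:
  fixes V :: "real fps"
  assumes V: "summable (\<lambda>p. \<bar>fps_nth V p\<bar>)"
  shows "summable (\<lambda>k. \<bar>fps_nth (V ^ i) k\<bar>) \<and>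
    (\<Sum>k. \<bar>fps_nth (V ^ i) k\<bar>) \<le> (\<Sum>p. \<bar>fps_nth V p\<bar>) ^ i \<and>
    (\<lambda>k. fps_nth (V ^ i) k) sums (\<Sum>p. fps_nth V p) ^ i"
proof (induction i)
  case 0
  have "(\<lambda>k. fps_nth 1 k :: real) sums (\<Sum>k\<in>{0}. fps_nth 1 k)"
    by (rule sums_finite) auto
  then have "(\<lambda>k. fps_nth 1 k :: real) sums 1"
    by simp
  moreover have "\<bar>fps_nth 1 k\<bar> = (fps_nth 1 k :: real)" for k
    by simp
  ultimately show ?case
    by (simp add: sums_iff del: fps_one_nth)
next
  case (Suc i)
  have abs_prod: "(\<lambda>k. \<Sum>l\<le>k. \<bar>fps_nth V l\<bar> * \<bar>fps_nth (V ^ i) (k - l)\<bar>) sums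
      ((\<Sum>p. \<bar>fps_nth V p\<bar>) * (\<Sum>p. \<bar>fps_nth (V ^ i) p\<bar>))"
    by (rule Cauchy_product_sums) (use V Suc in simp_all)
  have le: "\<bar>fps_nth (V ^ Suc i) k\<bar> \<le> (\<Sum>l\<le>k. \<bar>fps_nth V l\<bar> * \<bar>fps_nth (V ^ i) (k - l)\<bar>)" for k
    by (simp add: fps_mult_nth abs_mult[symmetric] sum_abs atLeast0AtMost)
  have summ: "summable (\<lambda>k. \<bar>fps_nth (V ^ Suc i) k\<bar>)"
    by (rule summable_comparison_test[OF _ sums_summable[OF abs_prod]]) (use le in auto)
  have "(\<Sum>k. \<bar>fps_nth (V ^ Suc i) k\<bar>) \<le> (\<Sum>p. \<bar>fps_nth V p\<bar>) * (\<Sum>p. \<bar>fps_nth (V ^ i) p\<bar>)"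
    unfolding sums_unique[OF abs_prod] by (rule suminf_le[OF le summ sums_summable[OF abs_prod]])
  also have "\<dots> \<le> (\<Sum>p. \<bar>fps_nth V p\<bar>) * (\<Sum>p. \<bar>fps_nth V p\<bar>) ^ i"
    using Suc V by (intro mult_left_mono suminf_nonneg) auto
  finally have "(\<Sum>k. \<bar>fps_nth (V ^ Suc i) k\<bar>) \<le> (\<Sum>p. \<bar>fps_nth V p\<bar>) ^ Suc i"
    by simp
  moreover have "(\<lambda>k. \<Sum>l\<le>k. fps_nth V l * fps_nth (V ^ i) (k - l)) sums
      ((\<Sum>p. fps_nth V p) * (\<Sum>p. fps_nth (V ^ i) p))"
    by (rule Cauchy_product_sums) (use V Suc in simp_all)
  then have "(\<lambda>k. fps_nth (V ^ Suc i) k) sums (\<Sum>p. fps_nth V p) ^ Suc i"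
    using Suc by (simp add: fps_mult_nth atLeast0AtMost sums_iff)
  ultimately show ?case
    using summ by blast
qed

text \<open>The double series of \<open>g i\<close> times the coefficients of the
  \<open>i\<close>-th power has absolute row sums at most \<open>\<bar>g i\<bar>\<close> times the
  \<open>i\<close>-th power of the absolute sum of \<open>w\<close>, and \<open>g\<close> is entire;
  hence the order of summation may be exchanged. This is the composition at parameter value
  1.\<close>

lemma comp_coeff_sums:
  assumes g: "entire_coeffs g" and w: "summable (\<lambda>p. \<bar>w (Suc p)\<bar>)"
  shows "summable (\<lambda>k. \<bar>comp_coeff g w k\<bar>)"
    and "comp_coeff g w sums pow_series g (\<Sum>p. w (Suc p))"
proof -
  define V where "V = tail_fps w"
  have V_Suc: "fps_nth V (Suc p) = w (Suc p)" and V_0: "fps_nth V 0 = 0" for p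
    by (simp_all add: V_def tail_fps_def)
  have V: "summable (\<lambda>p. \<bar>fps_nth V p\<bar>)"
    using w by (subst summable_Suc_iff[symmetric]) (simp add: V_Suc)
  have sum_V: "(\<Sum>p. fps_nth V p) = (\<Sum>p. w (Suc p))"
    using suminf_split_head[OF summable_rabs_cancel[OF V]] by (simp add: V_Suc V_0)
  note pow = fps_power_abs_summable[OF V]
  define f where "f i k = g i * fps_nth (V ^ i) k" for i k
  have rows: "summable (\<lambda>k. \<bar>f i k\<bar>)" for i
    using pow[of i] by (auto simp: f_def abs_mult)
  have "(\<Sum>k. \<bar>f i k\<bar>) \<le> \<bar>g i\<bar> * (\<Sum>p. \<bar>fps_nth V p\<bar>) ^ i" for i
    using pow[of i] by (auto simp: f_def abs_mult suminf_mult intro!: mult_left_mono)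
  moreover have "0 \<le> (\<Sum>k. \<bar>f i k\<bar>)" for i
    by (rule suminf_nonneg[OF rows]) auto
  ultimately have total: "summable (\<lambda>i. \<Sum>k. \<bar>f i k\<bar>)"
    by (intro summable_comparison_test[OF _ g[unfolded entire_coeffs_def, rule_format, of "\<Sum>p. \<bar>fps_nth V p\<bar>"]]) auto
  note swap = double_series_swap[of f, OF rows total]
  have col: "(\<Sum>i. f i k) = comp_coeff g w k" for k
    unfolding comp_coeff_def f_def V_def
    by (rule suminf_finite) (auto simp: tail_fps_power_nth_eq_0)
  have row: "(\<Sum>k. f i k) = g i * (\<Sum>p. w (Suc p)) ^ i" for i
    using pow[of i] by (simp add: f_def suminf_mult sums_iff sum_V)
  show "comp_coeff g w sums pow_series g (\<Sum>p. w (Suc p))"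
    using swap(3) unfolding col row by (simp add: pow_series_def)
  have "\<bar>comp_coeff g w k\<bar> \<le> (\<Sum>i. \<bar>f i k\<bar>)" for k
    unfolding col[symmetric] by (rule summable_rabs[OF swap(1)])
  then show "summable (\<lambda>k. \<bar>comp_coeff g w k\<bar>)"
    by (intro summable_comparison_test[OF _ swap(2)]) auto
qed

lemma fps_power_nth_scale:
  "fps_nth (tail_fps (\<lambda>p. w p * t ^ p) ^ i) k = fps_nth (tail_fps w ^ i) k * t ^ k"
proof (induction i arbitrary: k)
  case (Suc i)
  have "fps_nth (tail_fps (\<lambda>p. w p * t ^ p) ^ Suc i) k =
      (\<Sum>l=0..k. fps_nth (tail_fps w) l * t ^ l * (fps_nth (tail_fps w ^ i) (k - l) * t ^ (k - l)))"
    unfolding power_Suc fps_mult_nth Suc by (rule sum.cong) (auto simp: tail_fps_def)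
  also have "\<dots> = (\<Sum>l=0..k. fps_nth (tail_fps w) l * fps_nth (tail_fps w ^ i) (k - l) * t ^ k)"
  proof (rule sum.cong[OF refl])
    fix l assume "l \<in> {0..k}"
    then have "t ^ k = t ^ l * t ^ (k - l)"
      by (simp flip: power_add)
    then show "fps_nth (tail_fps w) l * t ^ l * (fps_nth (tail_fps w ^ i) (k - l) * t ^ (k - l))
        = fps_nth (tail_fps w) l * fps_nth (tail_fps w ^ i) (k - l) * t ^ k"
      by (simp only: mult_ac)
  qed
  finally show ?case
    by (simp add: fps_mult_nth sum_distrib_right)
qed auto

text \<open>Weighted homogeneity: it recovers the composition as a power series in \<open>t\<close>
  from its value at parameter 1.\<close>

lemma comp_coeff_scale: "comp_coeff g (\<lambda>p. w p * t ^ p) k = comp_coeff g w k * t ^ k"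
  by (simp add: comp_coeff_def fps_power_nth_scale sum_distrib_right mult.assoc)

text \<open>Truncation turns the inner series into a polynomial, so nothing about the convergence of
  \<open>w\<close> is required.\<close>

lemma comp_coeff_trunc_sums:
  assumes "entire_coeffs g"
  shows "(\<lambda>j. comp_coeff g (\<lambda>p. if p \<le> k then w p else 0) j * t ^ j)
    sums pow_series g (\<Sum>p=1..k. w p * t ^ p)"
proof -
  define v where "v p = (if p \<le> k then w p else 0) * t ^ p" for p
  have "(\<lambda>p. v (Suc p)) sums (\<Sum>p<k. v (Suc p))"
    by (rule sums_finite) (auto simp: v_def)
  also have "(\<Sum>p<k. v (Suc p)) = (\<Sum>p=1..k. w p * t ^ p)"
    by (rule sum.reindex_bij_witness[of _ "\<lambda>p. p - 1" Suc]) (auto simp: v_def)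
  finally have "(\<Sum>p. v (Suc p)) = (\<Sum>p=1..k. w p * t ^ p)"
    by (simp add: sums_iff)
  moreover have "(\<lambda>p. \<bar>v (Suc p)\<bar>) sums (\<Sum>p<k. \<bar>v (Suc p)\<bar>)"
    by (rule sums_finite) (auto simp: v_def)
  ultimately have "comp_coeff g v sums pow_series g (\<Sum>p=1..k. w p * t ^ p)"
    using comp_coeff_sums(2)[OF assms, of v] by (simp add: sums_iff)
  then show ?thesis
    unfolding v_def comp_coeff_scale .
qed

text \<open>The hypothesis on \<open>G\<close> separates the constant argument \<open>v 0\<close>
  from the centre \<open>x\<close> of the expansion. For \<open>N\<close> the two coincide, both
  being the value of u^(0); for \<open>Ntilde1\<close> the argument is 0 while the centre is the sup
  norm of u^(0).\<close>

lemma adomian_eq_comp_coeff: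
  assumes b: "entire_coeffs b" and G: "\<And>y. G (v 0 + y) = pow_series b (x + y)"
  shows "adomian G k v = comp_coeff (taylor_coeff b x) v k"
proof -
  let ?g = "taylor_coeff b x"
  have "(\<Sum>p\<le>k. v p * t ^ p) = v 0 + (\<Sum>p=1..k. v p * t ^ p)" for t
    by (simp add: sum.atLeast_Suc_atMost flip: atLeast0AtMost)
  then have "(\<lambda>j. comp_coeff ?g (\<lambda>p. if p \<le> k then v p else 0) j * t ^ j)
      sums G (\<Sum>p\<le>k. v p * t ^ p)" for t
    using comp_coeff_trunc_sums[OF entire_taylor_coeff[OF b], where k=k and w=v and t=t]
    by (simp add: G pow_series_taylor[OF b])
  from higher_deriv_power_series_at_0[OF this]
  have "adomian G k v = comp_coeff ?g (\<lambda>p. if p \<le> k then v p else 0) k"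
    by (simp add: adomian_def)
  also have "\<dots> = comp_coeff ?g v k"
    by (rule comp_coeff_cong) auto
  finally show ?thesis .
qed

text \<open>Cutting \<open>w\<close> off after \<open>m\<close> changes no coefficient up to
  \<open>m\<close>, and the remaining coefficients of the truncated composition are
  nonnegative.\<close>

lemma sum_comp_coeff_le:
  assumes "entire_coeffs g" "\<And>i. 0 \<le> g i" "\<And>p. 0 \<le> w p" "0 \<le> z"
  shows "(\<Sum>k\<le>m. comp_coeff g w k * z ^ k) \<le> pow_series g (\<Sum>p=1..m. w p * z ^ p)"
proof -
  let ?w = "\<lambda>p. if p \<le> m then w p else 0"
  have "(\<Sum>k\<le>m. comp_coeff g w k * z ^ k) = (\<Sum>k\<le>m. comp_coeff g ?w k * z ^ k)"
    by (intro sum.cong refl arg_cong2[of _ _ _ _ "(*)"] comp_coeff_cong) auto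
  also have "\<dots> \<le> (\<Sum>k. comp_coeff g ?w k * z ^ k)"
    by (rule sum_le_suminf[OF sums_summable[OF comp_coeff_trunc_sums[OF assms(1)]]])
       (auto intro!: mult_nonneg_nonneg comp_coeff_nonneg zero_le_power assms)
  also have "\<dots> = pow_series g (\<Sum>p=1..m. w p * z ^ p)"
    by (rule sums_unique[OF comp_coeff_trunc_sums[OF assms(1)], symmetric])
  finally show ?thesis .
qed

lemma continuous_on_comp_coeff:
  assumes "\<And>i. i \<le> k \<Longrightarrow> continuous_on S (\<lambda>x. g x i)"
    and "\<And>p. 1 \<le> p \<Longrightarrow> p \<le> k \<Longrightarrow> continuous_on S (\<lambda>x. w x p)"
  shows "continuous_on S (\<lambda>x. comp_coeff (g x) (w x) k)"
proof -
  have "continuous_on S (\<lambda>x. fps_nth (tail_fps (w x) ^ i) j)" if "j \<le> k" for i j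
    using that
  proof (induction i arbitrary: j)
    case (Suc i)
    have "continuous_on S (\<lambda>x. fps_nth (tail_fps (w x)) l)" if "l \<le> k" for l
      using assms(2)[of l] that by (cases "l = 0") (auto simp: tail_fps_def)
    with Suc show ?case
      unfolding power_Suc fps_mult_nth by (intro continuous_on_sum continuous_on_mult) auto
  qed simp
  then show ?thesis
    unfolding comp_coeff_def by (intro continuous_on_sum continuous_on_mult assms) auto
qed

section \<open>Indefinite Lebesgue integrals\<close>

text \<open>\<open>integrable_ccontinuous_explicit\<close> averages over intervals
  \<open>[x, x + h]\<close> with \<open>h > 0\<close>, hence only the right-hand derivative here. It
  asks for integrability on every bounded interval, which the extension of \<open>g\<close> by zero
  provides.\<close>

lemma AE_has_right_derivative_integral:
  fixes g :: "real \<Rightarrow> real"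
  assumes "g absolutely_integrable_on {a..b}"
  obtains N where "negligible N"
    "\<And>x. x \<in> {a<..<b} - N \<Longrightarrow>
      ((\<lambda>y. integral {a..y} g) has_real_derivative g x) (at_right x)"
proof -
  define f where "f x = (if x \<in> {a..b} then g x else 0)" for x
  have "f absolutely_integrable_on UNIV"
    using assms unfolding f_def absolutely_integrable_restrict_UNIV .
  then have "f integrable_on cbox c d" for c d
    using integrable_on_subcbox set_lebesgue_integral_eq_integral(1) by blast
  then obtain N where N: "negligible N"
    "\<And>x e. x \<notin> N \<Longrightarrow> 0 < e \<Longrightarrow> \<exists>d>0. \<forall>h. 0 < h \<and> h < d \<longrightarrow>
        norm (integral (cbox x (x + h *\<^sub>R One)) f /\<^sub>R h ^ DIM(real) - f x) < e"
    by (rule integrable_ccontinuous_explicit) blast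
  have "((\<lambda>y. integral {a..y} g) has_real_derivative g x) (at_right x)"
    if x: "x \<in> {a<..<b} - N" for x
    unfolding has_field_derivative_iff tendsto_iff
  proof (intro allI impI)
    fix e :: real assume "e > 0"
    with N(2)[of x e] x obtain d where d: "d > 0"
      "\<And>h. 0 < h \<Longrightarrow> h < d \<Longrightarrow> \<bar>integral {x..x + h} f / h - g x\<bar> < e"
      by (auto simp: f_def divide_inverse mult.commute)
    have "\<forall>\<^sub>F y in at_right x. y < min b (x + d)"
      using x d by (intro order_tendstoD[OF tendsto_ident_at]) auto
    moreover have "\<forall>\<^sub>F y in at_right x. x < y"
      by (simp add: eventually_at_right_less)
    ultimately show "\<forall>\<^sub>F y in at_right x.
        dist ((integral {a..y} g - integral {a..x} g) / (y - x)) (g x) < e"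
    proof eventually_elim
      case (elim y)
      have "g integrable_on {a..y}"
        using assms elim by (meson atLeastatMost_subset_iff integrable_on_subinterval less_imp_le min_less_iff_conj order_refl set_lebesgue_integral_eq_integral(1))
      then have "integral {a..x} g + integral {x..y} g = integral {a..y} g"
        using x elim by (intro Henstock_Kurzweil_Integration.integral_combine) auto
      moreover have "integral {x..y} g = integral {x..y} f"
        using x elim by (intro integral_cong) (auto simp: f_def)
      ultimately have "integral {a..y} g - integral {a..x} g = integral {x..y} f"
        by linarith
      then show ?case
        using d(2)[of "y - x"] elim by (simp add: dist_real_def)
    qed
  qed
  with N(1) show thesis
    using that by blast
qed

text \<open>The left-hand derivative is the right-hand derivative of the integral of the reflected
  function.\<close>

lemma AE_has_derivative_integral:
  fixes g :: "real \<Rightarrow> real"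
  assumes g: "g absolutely_integrable_on {a..b}"
  obtains N where "negligible N"
    "\<And>x. x \<in> {a<..<b} - N \<Longrightarrow>
      ((\<lambda>y. integral {a..y} g) has_real_derivative g x) (at x)"
proof -
  obtain N where N: "negligible N" "\<And>x. x \<in> {a<..<b} - N \<Longrightarrow>
      ((\<lambda>y. integral {a..y} g) has_real_derivative g x) (at_right x)"
    by (rule AE_has_right_derivative_integral[OF g]) blast
  have "(\<lambda>x. g (- x)) absolutely_integrable_on {-b..-a}"
    using g by (simp add: absolutely_integrable_reflect_real)
  then obtain N' where N': "negligible N'"
    "\<And>x. x \<in> {-b<..<-a} - N' \<Longrightarrow>
      ((\<lambda>y. integral {-b..y} (\<lambda>x. g (- x))) has_real_derivative g (- x)) (at_right x)"
    by (rule AE_has_right_derivative_integral) blast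
  have "((\<lambda>y. integral {a..y} g) has_real_derivative g x) (at x)"
    if x: "x \<in> {a<..<b} - (N \<union> uminus ` N')" for x
  proof -
    let ?h = "\<lambda>y. integral {-b..y} (\<lambda>x. g (- x))"
    have "- x \<in> {-b<..<-a} - N'"
      using x by (auto simp: image_iff)
    then have h: "(?h has_real_derivative g x) (at_right (- x))"
      using N'(2)[of "- x"] by simp
    have "((?h \<circ> uminus) has_real_derivative g x * (- 1)) (at_left x)"
      by (rule DERIV_image_chain) (use h in \<open>auto intro!: derivative_eq_intros\<close>)
    then have "((\<lambda>y. integral {a..b} g - (?h \<circ> uminus) y) has_real_derivative 0 - (g x * (- 1))) (at_left x)"
      by (intro DERIV_diff DERIV_const)
    then have *: "((\<lambda>y. integral {a..b} g - ?h (- y)) has_real_derivative g x) (at_left x)"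
      by simp
    \<comment> \<open>The reflected integral starts at the right end point, so it is the complement
      of the one wanted.\<close>
    have eq: "integral {a..b} g - ?h (- y) = integral {a..y} g" if "y \<in> {a..b}" for y
    proof -
      have "?h (- y) = integral {y..b} g"
        using integral_reflect_real[of b y g] by simp
      moreover have "g integrable_on {a..b}"
        using g set_lebesgue_integral_eq_integral(1) by blast
      then have "integral {a..y} g + integral {y..b} g = integral {a..b} g"
        using that by (intro Henstock_Kurzweil_Integration.integral_combine) auto
      ultimately show ?thesis by simp
    qed
    have "((\<lambda>y. integral {a..y} g) has_real_derivative g x) (at_left x)"
    proof (rule has_field_derivative_cong_eventually[THEN iffD1, OF _ _ *])
      have "\<forall>\<^sub>F y in at_left x. a < y"
        using x by (intro order_tendstoD[OF tendsto_ident_at]) auto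
      moreover have "\<forall>\<^sub>F y in at_left x. y < x"
        by (simp add: eventually_at_filter)
      ultimately show "\<forall>\<^sub>F y in at_left x. integral {a..b} g - ?h (- y) = integral {a..y} g"
        by eventually_elim (rule eq, use x in auto)
    qed (rule eq, use x in auto)
    moreover have "((\<lambda>y. integral {a..y} g) has_real_derivative g x) (at_right x)"
      using N(2) x by auto
    ultimately show ?thesis
      by (simp add: has_field_derivative_iff filterlim_at_split)
  qed
  moreover have "negligible (uminus ` N')"
    using N'(1) by (intro negligible_differentiable_image_negligible) auto
  ultimately show thesis
    using that[of "N \<union> uminus ` N'"] N(1) by (simp add: negligible_Un)
qed


lemma absolutely_integrable_continuous_mult:
  fixes f g :: "real \<Rightarrow> real"
  assumes "continuous_on {a..b} f" "g absolutely_integrable_on {a..b}"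
  shows "(\<lambda>x. f x * g x) absolutely_integrable_on {a..b}"
  using assms
  by (intro absolutely_integrable_bounded_measurable_product_real compact_imp_bounded
        compact_continuous_image continuous_imp_measurable_on_sets_lebesgue) auto

text \<open>Each integral is that of \<open>g\<close> restricted to an open interval, the end points
  being negligible. The open intervals are disjoint, so at most one restriction is nonzero at any
  point.\<close>

lemma sum_integral_nonoverlapping_le:
  fixes g :: "real \<Rightarrow> real"
  assumes "finite D" and D: "\<And>x y. (x, y) \<in> D \<Longrightarrow> a \<le> x \<and> y \<le> b"
    and disj: "disjoint_family_on (\<lambda>(x, y). {x<..<y}) D"
    and g: "g integrable_on {a..b}" "\<And>t. t \<in> {a..b} \<Longrightarrow> 0 \<le> g t"
  shows "(\<Sum>(x, y)\<in>D. integral {x..y} g) \<le> integral {a..b} g"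
proof -
  define I :: "real \<times> real \<Rightarrow> real set" where "I d = {fst d<..<snd d}" for d
  have I: "I d \<subseteq> {a..b}" if "d \<in> D" for d
    using D[of "fst d" "snd d"] that by (auto simp: I_def)
  have part: "integral {fst d..snd d} g = integral {a..b} (\<lambda>t. if t \<in> I d then g t else 0)"
    "(\<lambda>t. if t \<in> I d then g t else 0) integrable_on {a..b}" if "d \<in> D" for d
  proof -
    have "g integrable_on {fst d..snd d}"
    proof (cases "fst d \<le> snd d")
      case True
      then show ?thesis
        using D[of "fst d" "snd d"] that g(1) by (intro integrable_on_subinterval[OF g(1)]) auto
    qed auto
    then show "(\<lambda>t. if t \<in> I d then g t else 0) integrable_on {a..b}"
      using I[OF that] integrable_restrict_Int[of "I d" g "{a..b}"]
      by (simp add: Int_absorb2) (simp add: I_def integrable_on_open_interval_real)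
    show "integral {fst d..snd d} g = integral {a..b} (\<lambda>t. if t \<in> I d then g t else 0)"
      using I[OF that] Henstock_Kurzweil_Integration.integral_restrict_Int[of "{a..b}" "I d" g]
      by (simp add: Int_absorb2) (simp add: I_def integral_open_interval_real)
  qed
  have "(\<Sum>(x, y)\<in>D. integral {x..y} g) = (\<Sum>d\<in>D. integral {a..b} (\<lambda>t. if t \<in> I d then g t else 0))"
    unfolding case_prod_unfold by (rule sum.cong) (simp_all add: part)
  also have "\<dots> = integral {a..b} (\<lambda>t. \<Sum>d\<in>D. if t \<in> I d then g t else 0)"
    using assms(1) part by (intro Henstock_Kurzweil_Integration.integral_sum[symmetric]) auto
  also have "\<dots> \<le> integral {a..b} g"
  proof (rule integral_le[OF integrable_sum[OF assms(1) part(2)] g(1)])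
    fix t assume t: "t \<in> {a..b}"
    show "(\<Sum>d\<in>D. if t \<in> I d then g t else 0) \<le> g t"
    proof (cases "\<exists>d\<in>D. t \<in> I d")
      case True
      then obtain d where d: "d \<in> D" "t \<in> I d" by blast
      have "t \<notin> I d'" if "d' \<in> D - {d}" for d'
        using disj d that unfolding disjoint_family_on_def I_def case_prod_unfold by blast
      then have "(\<Sum>d'\<in>D - {d}. if t \<in> I d' then g t else 0) = 0"
        by (intro sum.neutral) auto
      then show ?thesis
        using sum.remove[OF assms(1) d(1), of "\<lambda>d. if t \<in> I d then g t else 0"] d by simp
    next
      case False
      then have "(\<Sum>d\<in>D. if t \<in> I d then g t else 0) = 0"
        by (intro sum.neutral) auto
      then show ?thesis using g(2)[OF t] by simp
    qed
  qed
  finally show ?thesis .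
qed

text \<open>Absolute continuity of the integral, by splitting \<open>h\<close> into a bounded truncation and a
  remainder with small integral.\<close>

lemma absolutely_continuous_onI_integral_bound:
  fixes h :: "real \<Rightarrow> real"
  assumes h: "h integrable_on {a..b}" "\<And>t. t \<in> {a..b} \<Longrightarrow> 0 \<le> h t"
    and f: "\<And>x y. a \<le> x \<Longrightarrow> x \<le> y \<Longrightarrow> y \<le> b \<Longrightarrow> \<bar>f y - f x\<bar> \<le> integral {x..y} h"
  shows "absolutely_continuous_on a b f"
  unfolding absolutely_continuous_on_def
proof (intro allI impI)
  fix \<epsilon> :: real assume "\<epsilon> > 0"
  define T where "T k t = min (h t) (real k)" for k t
  have abs: "h absolutely_integrable_on {a..b}"
    using absolutely_integrable_on_iff_nonneg[of "{a..b}" h] h by blast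
  have T_int: "T k integrable_on {a..b}" for k
    unfolding T_def
    by (intro set_lebesgue_integral_eq_integral(1) absolutely_integrable_min_1 abs) auto
  have "(\<lambda>k. integral {a..b} (T k)) \<longlonglongrightarrow> integral {a..b} h"
  proof (rule dominated_convergence(2)[OF T_int h(1)])
    show "norm (T k t) \<le> h t" if "t \<in> {a..b}" for k t
      using h(2)[OF that] by (simp add: T_def)
    show "(\<lambda>k. T k t) \<longlonglongrightarrow> h t" for t
    proof (rule tendsto_eventually)
      obtain K :: nat where "h t \<le> real K"
        using real_arch_simple by blast
      then show "\<forall>\<^sub>F k in sequentially. T k t = h t"
        unfolding eventually_sequentially T_def by (intro exI[of _ K]) (auto simp: min_def)
    qed
  qed
  then have "\<forall>\<^sub>F k in sequentially. integral {a..b} h - \<epsilon> / 2 < integral {a..b} (T k)"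
    using \<open>\<epsilon> > 0\<close> by (intro order_tendstoD) auto
  then obtain k where k: "integral {a..b} h - \<epsilon> / 2 < integral {a..b} (T k)"
    unfolding eventually_sequentially by blast
  \<comment> \<open>The truncation is at most \<open>k\<close>, so its integral over a family of
    total length below \<delta> is at most \<epsilon> / 2; the summand 1 covers
    \<open>k = 0\<close>.\<close>
  define \<delta> where "\<delta> = \<epsilon> / (2 * (real k + 1))"
  have "(\<Sum>(x, y)\<in>D. \<bar>f y - f x\<bar>) < \<epsilon>"
    if D: "finite D" "\<forall>(x, y)\<in>D. a \<le> x \<and> x \<le> y \<and> y \<le> b"
      "disjoint_family_on (\<lambda>(x, y). {x<..<y}) D" "(\<Sum>(x, y)\<in>D. y - x) < \<delta>"
    for D :: "(real \<times> real) set"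
  proof -
    have "(\<Sum>(x, y)\<in>D. \<bar>f y - f x\<bar>)
        \<le> (\<Sum>(x, y)\<in>D. integral {x..y} (\<lambda>t. h t - T k t) + real k * (y - x))"
    proof (rule sum_mono, clarify)
      fix x y assume "(x, y) \<in> D"
      then have xy: "a \<le> x" "x \<le> y" "y \<le> b" using D(2) by auto
      have int: "h integrable_on {x..y}" "T k integrable_on {x..y}"
        using xy by (auto intro: integrable_on_subinterval[OF h(1)] integrable_on_subinterval[OF T_int])
      have "integral {x..y} (T k) \<le> integral {x..y} (\<lambda>_. real k)"
        by (intro integral_le int) (auto simp: T_def)
      also have "\<dots> = real k * (y - x)"
        using xy by simp
      finally show "\<bar>f y - f x\<bar> \<le> integral {x..y} (\<lambda>t. h t - T k t) + real k * (y - x)"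
        using f[OF xy] Henstock_Kurzweil_Integration.integral_diff[OF int] by simp
    qed
    also have "\<dots> = (\<Sum>(x, y)\<in>D. integral {x..y} (\<lambda>t. h t - T k t)) + real k * (\<Sum>(x, y)\<in>D. y - x)"
      by (simp add: case_prod_unfold sum.distrib sum_distrib_left)
    also have "(\<Sum>(x, y)\<in>D. integral {x..y} (\<lambda>t. h t - T k t)) \<le> integral {a..b} (\<lambda>t. h t - T k t)"
      using D(2) by (intro sum_integral_nonoverlapping_le D integrable_diff h T_int) (auto simp: T_def)
    also have "\<dots> < \<epsilon> / 2"
      using k Henstock_Kurzweil_Integration.integral_diff[OF h(1) T_int[of k]] by simp
    also have "real k * (\<Sum>(x, y)\<in>D. y - x) \<le> (real k + 1) * \<delta>"
      using D by (intro mult_mono sum_nonneg) auto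
    also have "(real k + 1) * \<delta> = \<epsilon> / 2"
      by (simp add: \<delta>_def field_simps add_pos_nonneg)
    finally show ?thesis by simp
  qed
  moreover have "\<delta> > 0"
    using \<open>\<epsilon> > 0\<close> by (simp add: \<delta>_def)
  ultimately show "\<exists>\<delta>>0. \<forall>D::(real \<times> real) set. finite D \<longrightarrow>
      (\<forall>(x, y)\<in>D. a \<le> x \<and> x \<le> y \<and> y \<le> b) \<longrightarrow> disjoint_family_on (\<lambda>(x, y). {x<..<y}) D \<longrightarrow>
      (\<Sum>(x, y)\<in>D. y - x) < \<delta> \<longrightarrow> (\<Sum>(x, y)\<in>D. \<bar>f y - f x\<bar>) < \<epsilon>"
    by blast
qed


section \<open>Variation of constants for y'' + s^2 y = F with integrable F\<close>

lemma abs_cos_diff_le: "\<bar>cos x - cos y\<bar> \<le> \<bar>x - y\<bar>" for x y :: real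
proof -
  have "\<bar>cos x - cos y\<bar> = 2 * \<bar>sin ((x + y) / 2)\<bar> * \<bar>sin ((y - x) / 2)\<bar>"
    by (simp add: cos_diff_cos abs_mult)
  also have "\<dots> \<le> 2 * 1 * \<bar>(y - x) / 2\<bar>"
    by (intro mult_mono abs_sin_x_le_abs_x) auto
  finally show ?thesis by simp
qed

text \<open>The solution of y'' + s^2 y = F with zero data at 0; \<open>volterra_cos\<close> below
  is its derivative.\<close>

definition volterra_sin :: "real \<Rightarrow> (real \<Rightarrow> real) \<Rightarrow> real \<Rightarrow> real" where
  "volterra_sin s F x = integral {0..x} (\<lambda>\<xi>. sin (s * (x - \<xi>)) / s * F \<xi>)"

definition volterra_cos :: "real \<Rightarrow> (real \<Rightarrow> real) \<Rightarrow> real \<Rightarrow> real" where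
  "volterra_cos s F x = integral {0..x} (\<lambda>\<xi>. cos (s * (x - \<xi>)) * F \<xi>)"

context
  fixes s :: real and F :: "real \<Rightarrow> real"
  assumes s: "s > 0" and F: "F absolutely_integrable_on {0..1}"
begin

lemma integrable_kernel:
  assumes "continuous_on {a..b} k" "0 \<le> a" "b \<le> 1"
  shows "(\<lambda>\<xi>. k \<xi> * F \<xi>) integrable_on {a..b}"
  by (intro set_lebesgue_integral_eq_integral(1) absolutely_integrable_continuous_mult
      absolutely_integrable_on_subinterval[OF F]) (use assms in auto)

lemma abs_integrable_F: "0 \<le> a \<Longrightarrow> b \<le> 1 \<Longrightarrow> (\<lambda>\<xi>. \<bar>F \<xi>\<bar>) integrable_on {a..b}"
  using absolutely_integrable_on_subinterval[OF F, of a b] by (simp add: absolutely_integrable_on_def)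

lemma abs_integral_kernel_le:
  assumes "continuous_on {a..b} k" "0 \<le> a" "b \<le> 1" "\<And>\<xi>. \<xi> \<in> {a..b} \<Longrightarrow> \<bar>k \<xi>\<bar> \<le> C"
  shows "\<bar>integral {a..b} (\<lambda>\<xi>. k \<xi> * F \<xi>)\<bar> \<le> C * integral {a..b} (\<lambda>\<xi>. \<bar>F \<xi>\<bar>)"
proof -
  have "norm (integral {a..b} (\<lambda>\<xi>. k \<xi> * F \<xi>)) \<le> integral {a..b} (\<lambda>\<xi>. C * \<bar>F \<xi>\<bar>)"
    using assms
    by (intro Henstock_Kurzweil_Integration.integral_norm_bound_integral integrable_kernel
        integrable_on_mult_right abs_integrable_F) (auto simp: abs_mult intro!: mult_right_mono)
  then show ?thesis by simp
qed

lemma integral_abs_mono: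
  assumes "0 \<le> a" "b \<le> 1"
  shows "integral {a..b} (\<lambda>\<xi>. \<bar>F \<xi>\<bar>) \<le> integral {0..1} (\<lambda>\<xi>. \<bar>F \<xi>\<bar>)"
  using assms by (intro integral_subset_le abs_integrable_F) auto

lemma abs_volterra_sin_le:
  assumes "0 \<le> x" "x \<le> 1"
  shows "\<bar>volterra_sin s F x\<bar> \<le> 1 / s * integral {0..1} (\<lambda>\<xi>. \<bar>F \<xi>\<bar>)"
proof -
  have "\<bar>volterra_sin s F x\<bar> \<le> 1 / s * integral {0..x} (\<lambda>\<xi>. \<bar>F \<xi>\<bar>)"
    unfolding volterra_sin_def
    by (rule abs_integral_kernel_le)
       (use assms s in \<open>auto intro!: continuous_intros simp: divide_simps\<close>)
  also have "\<dots> \<le> 1 / s * integral {0..1} (\<lambda>\<xi>. \<bar>F \<xi>\<bar>)"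
    using s assms by (intro mult_left_mono integral_abs_mono) auto
  finally show ?thesis .
qed

lemma integral_kernel_split:
  assumes "continuous_on {0..1} k" "0 \<le> x" "x \<le> y" "y \<le> 1"
  shows "integral {0..x} (\<lambda>\<xi>. k \<xi> * F \<xi>) + integral {x..y} (\<lambda>\<xi>. k \<xi> * F \<xi>)
    = integral {0..y} (\<lambda>\<xi>. k \<xi> * F \<xi>)"
  using assms
  by (intro Henstock_Kurzweil_Integration.integral_combine integrable_kernel
      continuous_on_subset[OF assms(1)]) auto

text \<open>The addition formula moves \<open>x\<close> out of the integral, so that differentiation
  in \<open>x\<close> concerns only smooth factors and two indefinite integrals.\<close>

lemma integral_sin_kernel:
  assumes "0 \<le> a" "b \<le> 1"
  shows "integral {a..b} (\<lambda>\<xi>. sin (s * (x - \<xi>)) / s * F \<xi>) =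
    (sin (s * x) * integral {a..b} (\<lambda>\<xi>. cos (s * \<xi>) * F \<xi>)
      - cos (s * x) * integral {a..b} (\<lambda>\<xi>. sin (s * \<xi>) * F \<xi>)) / s"
proof -
  have "integral {a..b} (\<lambda>\<xi>. sin (s * (x - \<xi>)) / s * F \<xi>) =
      integral {a..b} (\<lambda>\<xi>. sin (s * x) / s * (cos (s * \<xi>) * F \<xi>) - cos (s * x) / s * (sin (s * \<xi>) * F \<xi>))"
    by (rule integral_cong) (simp add: right_diff_distrib sin_diff diff_divide_distrib algebra_simps)
  also have "\<dots> = sin (s * x) / s * integral {a..b} (\<lambda>\<xi>. cos (s * \<xi>) * F \<xi>)
      - cos (s * x) / s * integral {a..b} (\<lambda>\<xi>. sin (s * \<xi>) * F \<xi>)"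
    using assms
    by (subst Henstock_Kurzweil_Integration.integral_diff)
       (auto simp del: times_divide_eq_left
         intro!: integrable_on_mult_right integrable_kernel continuous_intros)
  finally show ?thesis
    by (simp add: diff_divide_distrib)
qed

lemma integral_cos_kernel:
  assumes "0 \<le> a" "b \<le> 1"
  shows "integral {a..b} (\<lambda>\<xi>. cos (s * (x - \<xi>)) * F \<xi>) =
    cos (s * x) * integral {a..b} (\<lambda>\<xi>. cos (s * \<xi>) * F \<xi>)
      + sin (s * x) * integral {a..b} (\<lambda>\<xi>. sin (s * \<xi>) * F \<xi>)"
proof -
  have "integral {a..b} (\<lambda>\<xi>. cos (s * (x - \<xi>)) * F \<xi>) =
      integral {a..b} (\<lambda>\<xi>. cos (s * x) * (cos (s * \<xi>) * F \<xi>) + sin (s * x) * (sin (s * \<xi>) * F \<xi>))"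
    by (rule integral_cong) (simp add: right_diff_distrib cos_diff algebra_simps)
  also have "\<dots> = cos (s * x) * integral {a..b} (\<lambda>\<xi>. cos (s * \<xi>) * F \<xi>)
      + sin (s * x) * integral {a..b} (\<lambda>\<xi>. sin (s * \<xi>) * F \<xi>)"
    using assms
    by (subst Henstock_Kurzweil_Integration.integral_add)
       (auto intro!: integrable_on_mult_right integrable_kernel continuous_intros)
  finally show ?thesis .
qed

text \<open>\<open>F\<close> is merely integrable, so the fundamental theorem does not apply. Freezing the two
  integrals in the addition formula at \<open>x\<close> leaves the smooth function \<open>A\<close>, and the error is at most
  \<open>\<bar>y - x\<bar>\<close> times the integral of \<open>\<bar>F\<bar>\<close> between \<open>x\<close> and \<open>y\<close>.\<close>

lemma volterra_sin_has_derivative: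
  assumes x: "x \<in> {0..1}"
  shows "(volterra_sin s F has_real_derivative volterra_cos s F x) (at x within {0..1})"
proof -
  define P where "P x = integral {0..x} (\<lambda>\<xi>. cos (s * \<xi>) * F \<xi>)" for x
  define Q where "Q x = integral {0..x} (\<lambda>\<xi>. sin (s * \<xi>) * F \<xi>)" for x
  define H where "H x = integral {0..x} (\<lambda>\<xi>. \<bar>F \<xi>\<bar>)" for x
  define A where "A y = (sin (s * y) * P x - cos (s * y) * Q x) / s" for y
  have vs: "volterra_sin s F y = (sin (s * y) * P y - cos (s * y) * Q y) / s" if "y \<in> {0..1}" for y
    unfolding volterra_sin_def P_def Q_def using that by (intro integral_sin_kernel) auto
  have vc: "volterra_cos s F x = cos (s * x) * P x + sin (s * x) * Q x"
    using x by (simp add: volterra_cos_def P_def Q_def integral_cos_kernel)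
  have E: "\<bar>volterra_sin s F y - A y\<bar> \<le> \<bar>y - x\<bar> * \<bar>H y - H x\<bar>" if y: "y \<in> {0..1}" for y
  proof -
    \<comment> \<open>Covers \<open>y\<close> on either side of \<open>x\<close> at once; the sign
      is lost under the absolute value.\<close>
    define lo hi where "lo = min x y" and "hi = max x y"
    have lohi: "0 \<le> lo" "lo \<le> hi" "hi \<le> 1"
      using x y by (auto simp: lo_def hi_def)
    have "\<bar>volterra_sin s F y - A y\<bar> = \<bar>integral {lo..hi} (\<lambda>\<xi>. sin (s * (y - \<xi>)) / s * F \<xi>)\<bar>"
    proof -
      have "P lo + integral {lo..hi} (\<lambda>\<xi>. cos (s * \<xi>) * F \<xi>) = P hi"
        "Q lo + integral {lo..hi} (\<lambda>\<xi>. sin (s * \<xi>) * F \<xi>) = Q hi"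
        unfolding P_def Q_def by (intro integral_kernel_split lohi continuous_intros)+
      then have PQ: "integral {lo..hi} (\<lambda>\<xi>. cos (s * \<xi>) * F \<xi>) = P hi - P lo"
        "integral {lo..hi} (\<lambda>\<xi>. sin (s * \<xi>) * F \<xi>) = Q hi - Q lo"
        by linarith+
      have "integral {lo..hi} (\<lambda>\<xi>. sin (s * (y - \<xi>)) / s * F \<xi>) =
          (sin (s * y) * (P hi - P lo) - cos (s * y) * (Q hi - Q lo)) / s"
        using integral_sin_kernel[OF lohi(1,3), of y] unfolding PQ .
      moreover have "volterra_sin s F y - A y = (sin (s * y) * (P y - P x) - cos (s * y) * (Q y - Q x)) / s"
        by (simp add: vs[OF y] A_def right_diff_distrib diff_divide_distrib)
      ultimately show ?thesis
      proof (cases "x \<le> y")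
        case False
        have "(sin (s * y) * (P x - P y) - cos (s * y) * (Q x - Q y)) / s
            = - ((sin (s * y) * (P y - P x) - cos (s * y) * (Q y - Q x)) / s)"
          by (simp add: right_diff_distrib diff_divide_distrib)
        with False show ?thesis
          using \<open>volterra_sin s F y - A y = _\<close> \<open>integral {lo..hi} _ = (_ - _) / s\<close>
          by (simp only: lo_def hi_def min_def max_def if_False abs_minus_cancel)
      qed (simp only: lo_def hi_def min_def max_def if_True)
    qed
    also have "\<dots> \<le> \<bar>y - x\<bar> * integral {lo..hi} (\<lambda>\<xi>. \<bar>F \<xi>\<bar>)"
    \<comment> \<open>The kernel vanishes at \<xi> = y and has slope at most 1 in modulus; this is
      the source of the factor \<open>\<bar>y - x\<bar>\<close>.\<close>
    proof (rule abs_integral_kernel_le)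
      fix \<xi> assume "\<xi> \<in> {lo..hi}"
      then have "\<bar>y - \<xi>\<bar> \<le> \<bar>y - x\<bar>"
        by (auto simp: lo_def hi_def min_def max_def split: if_splits)
      moreover have "\<bar>sin (s * (y - \<xi>)) / s\<bar> \<le> \<bar>y - \<xi>\<bar>"
        using abs_sin_x_le_abs_x[of "s * (y - \<xi>)"] s
        by (simp add: abs_mult abs_divide pos_divide_le_eq mult.commute[of "\<bar>y - \<xi>\<bar>"])
      ultimately show "\<bar>sin (s * (y - \<xi>)) / s\<bar> \<le> \<bar>y - x\<bar>" by linarith
    qed (use lohi s in \<open>auto intro!: continuous_intros\<close>)
    also have "integral {lo..hi} (\<lambda>\<xi>. \<bar>F \<xi>\<bar>) = H hi - H lo"
    proof -
      have "H lo + integral {lo..hi} (\<lambda>\<xi>. \<bar>F \<xi>\<bar>) = H hi"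
        unfolding H_def using lohi
        by (intro Henstock_Kurzweil_Integration.integral_combine abs_integrable_F) auto
      then show ?thesis by simp
    qed
    also have "H hi - H lo \<le> \<bar>H y - H x\<bar>"
      by (auto simp: lo_def hi_def min_def max_def)
    finally show ?thesis
      by (simp add: mult_left_mono)
  qed
  have "continuous_on {0..1} H"
    unfolding H_def by (intro indefinite_integral_continuous_1 abs_integrable_F) auto
  then have H: "((\<lambda>y. \<bar>H y - H x\<bar>) \<longlongrightarrow> 0) (at x within {0..1})"
    using x by (simp add: tendsto_rabs_zero_iff LIM_zero_iff continuous_on_def)
  have "((\<lambda>y. volterra_sin s F y - A y) has_real_derivative 0) (at x within {0..1})"
    unfolding has_field_derivative_iff
  proof (rule Lim_null_comparison[OF _ H])
    have Ax: "volterra_sin s F x = A x"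
      using E[OF x] by simp
    show "\<forall>\<^sub>F y in at x within {0..1}. norm ((volterra_sin s F y - A y - (volterra_sin s F x - A x)) / (y - x)) \<le> \<bar>H y - H x\<bar>"
      unfolding eventually_at_filter
    proof (intro always_eventually allI impI)
      fix y assume "y \<noteq> x" "y \<in> {0..1}"
      then show "norm ((volterra_sin s F y - A y - (volterra_sin s F x - A x)) / (y - x)) \<le> \<bar>H y - H x\<bar>"
        using E[of y] Ax by (simp add: divide_simps abs_divide mult.commute)
    qed
  qed
  moreover have "(A has_real_derivative volterra_cos s F x) (at x within {0..1})"
    unfolding A_def vc using s by (auto intro!: derivative_eq_intros simp: field_simps)
  ultimately have "((\<lambda>y. (volterra_sin s F y - A y) + A y) has_real_derivative 0 + volterra_cos s F x) (at x within {0..1})"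
    by (rule DERIV_add)
  then show ?thesis by simp
qed

text \<open>The first summand comes from the added range of integration, the second from the
  Lipschitz change of the kernel on the old range. The bound is written as an integral over
  \<open>[x, y]\<close> because that is the form in which absolute continuity is deduced.\<close>

lemma abs_volterra_cos_diff_le:
  assumes "0 \<le> x" "x \<le> y" "y \<le> 1"
  shows "\<bar>volterra_cos s F y - volterra_cos s F x\<bar> \<le>
    integral {x..y} (\<lambda>\<xi>. \<bar>F \<xi>\<bar> + s * integral {0..1} (\<lambda>\<xi>. \<bar>F \<xi>\<bar>))"
proof -
  have split: "integral {0..x} (\<lambda>\<xi>. cos (s * (y - \<xi>)) * F \<xi>) + integral {x..y} (\<lambda>\<xi>. cos (s * (y - \<xi>)) * F \<xi>)
      = volterra_cos s F y"
    unfolding volterra_cos_def by (intro integral_kernel_split assms continuous_intros)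
  have "integral {0..x} (\<lambda>\<xi>. cos (s * (y - \<xi>)) * F \<xi>) - volterra_cos s F x
      = integral {0..x} (\<lambda>\<xi>. (cos (s * (y - \<xi>)) - cos (s * (x - \<xi>))) * F \<xi>)"
    unfolding volterra_cos_def left_diff_distrib
    using assms by (intro Henstock_Kurzweil_Integration.integral_diff[symmetric] integrable_kernel continuous_intros) auto
  also have "\<bar>\<dots>\<bar> \<le> s * (y - x) * integral {0..x} (\<lambda>\<xi>. \<bar>F \<xi>\<bar>)"
  proof (rule abs_integral_kernel_le)
    fix \<xi>
    have "\<bar>cos (s * (y - \<xi>)) - cos (s * (x - \<xi>))\<bar> \<le> \<bar>s * (y - \<xi>) - s * (x - \<xi>)\<bar>"
      by (rule abs_cos_diff_le)
    also have "s * (y - \<xi>) - s * (x - \<xi>) = s * (y - x)"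
      by (simp add: algebra_simps)
    finally show "\<bar>cos (s * (y - \<xi>)) - cos (s * (x - \<xi>))\<bar> \<le> s * (y - x)"
      using s assms by (simp add: abs_mult)
  qed (use assms in \<open>auto intro!: continuous_intros\<close>)
  also have "\<dots> \<le> s * (y - x) * integral {0..1} (\<lambda>\<xi>. \<bar>F \<xi>\<bar>)"
    using s assms by (intro mult_left_mono integral_abs_mono) auto
  finally have 1: "\<bar>integral {0..x} (\<lambda>\<xi>. cos (s * (y - \<xi>)) * F \<xi>) - volterra_cos s F x\<bar>
      \<le> s * (y - x) * integral {0..1} (\<lambda>\<xi>. \<bar>F \<xi>\<bar>)" .
  have 2: "\<bar>integral {x..y} (\<lambda>\<xi>. cos (s * (y - \<xi>)) * F \<xi>)\<bar> \<le> 1 * integral {x..y} (\<lambda>\<xi>. \<bar>F \<xi>\<bar>)"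
    by (rule abs_integral_kernel_le) (use assms in \<open>auto intro!: continuous_intros\<close>)
  have "integral {x..y} (\<lambda>\<xi>. \<bar>F \<xi>\<bar> + s * integral {0..1} (\<lambda>\<xi>. \<bar>F \<xi>\<bar>))
      = integral {x..y} (\<lambda>\<xi>. \<bar>F \<xi>\<bar>) + s * (y - x) * integral {0..1} (\<lambda>\<xi>. \<bar>F \<xi>\<bar>)"
    using assms by (subst Henstock_Kurzweil_Integration.integral_add) (auto intro!: abs_integrable_F)
  with 1 2 split show ?thesis by linarith
qed

text \<open>By the product rule on the separated form, the derivatives of the two indefinite
  integrals contribute F times cos^2 + sin^2, and those of the trigonometric factors contribute -s^2
  times \<open>volterra_sin\<close>.\<close>

lemma AE_volterra_cos_has_derivative:
  obtains N where "negligible N" "\<And>x. x \<in> {0<..<1} - N \<Longrightarrow>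
    (volterra_cos s F has_real_derivative F x - s\<^sup>2 * volterra_sin s F x) (at x)"
proof -
  define P where "P = (\<lambda>x. integral {0..x} (\<lambda>\<xi>. cos (s * \<xi>) * F \<xi>))"
  have int_P: "(\<lambda>\<xi>. cos (s * \<xi>) * F \<xi>) absolutely_integrable_on {0..1}"
    by (intro absolutely_integrable_continuous_mult F continuous_intros)
  define Q where "Q = (\<lambda>x. integral {0..x} (\<lambda>\<xi>. sin (s * \<xi>) * F \<xi>))"
  have int_Q: "(\<lambda>\<xi>. sin (s * \<xi>) * F \<xi>) absolutely_integrable_on {0..1}"
    by (intro absolutely_integrable_continuous_mult F continuous_intros)
  obtain N1 where N1: "negligible N1" "\<And>x. x \<in> {0<..<1} - N1 \<Longrightarrow> (P has_real_derivative cos (s * x) * F x) (at x)"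
    unfolding P_def
    by (rule AE_has_derivative_integral[OF int_P]) blast
  obtain N2 where N2: "negligible N2" "\<And>x. x \<in> {0<..<1} - N2 \<Longrightarrow> (Q has_real_derivative sin (s * x) * F x) (at x)"
    unfolding Q_def
    by (rule AE_has_derivative_integral[OF int_Q]) blast
  have "(volterra_cos s F has_real_derivative F x - s\<^sup>2 * volterra_sin s F x) (at x)"
    if x: "x \<in> {0<..<1} - (N1 \<union> N2)" for x
  proof -
    have vs: "volterra_sin s F x = (sin (s * x) * P x - cos (s * x) * Q x) / s"
      unfolding volterra_sin_def P_def Q_def using x by (intro integral_sin_kernel) auto
    have F_eq: "(sin (s * x))\<^sup>2 * F x + (cos (s * x))\<^sup>2 * F x = F x"
      by (simp flip: distrib_right)
    have "((\<lambda>x. cos (s * x) * P x + sin (s * x) * Q x) has_real_derivative F x - s\<^sup>2 * volterra_sin s F x) (at x)"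
      using N1(2)[of x] N2(2)[of x] x s F_eq
      by (auto intro!: derivative_eq_intros simp: vs power2_eq_square field_simps)
    then show ?thesis
    proof (rule has_field_derivative_transform_within_open[of _ _ _ "{0<..<1}"])
      show "cos (s * y) * P y + sin (s * y) * Q y = volterra_cos s F y" if "y \<in> {0<..<1}" for y
        using that by (simp add: volterra_cos_def P_def Q_def integral_cos_kernel)
    qed (use x in auto)
  qed
  with that[of "N1 \<union> N2"] N1(1) N2(1) show thesis
    by (simp add: negligible_Un)
qed

end

section \<open>The unperturbed eigenvalue\<close>

text \<open>With \<open>sqrt l = pi * n + t\<close> the equation becomes \<open>h t = 0\<close>, where \<open>h 0 \<le> 0 \<le> h pi\<close> and, for large \<open>n\<close>,
  \<open>h\<close> increases on the first third of \<open>[0, pi]\<close>, is positive on the second and decreases on the last.\<close>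

lemma ex1_eigenvalue:
  fixes \<alpha> \<beta> :: real
  assumes \<alpha>: "0 < \<alpha>" "\<alpha> < 1" and \<beta>: "0 \<le> \<beta>" and n: "\<beta> + 1 \<le> real n"
  shows "\<exists>!l. l \<in> {pi\<^sup>2 * (real n)\<^sup>2 ..< pi\<^sup>2 * (real n + 1)\<^sup>2} \<and>
     sqrt l * sin (sqrt l) = - \<beta> * sin (sqrt l * \<alpha>) * sin (sqrt l * (1 - \<alpha>))"
proof -
  define e :: real where "e = (- 1) ^ n"
  have e: "e * e = 1" "\<bar>e\<bar> = 1"
    by (simp_all add: e_def power_mult_distrib[symmetric] power_abs)
  define r where "r t = pi * real n + t" for t
  have sin_r: "sin (r t) = e * sin t" and cos_r: "cos (r t) = e * cos t" for t
    using sin_npi[of n] cos_npi[of n] by (simp_all add: r_def e_def sin_add cos_add mult.commute)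
  \<comment> \<open>The difference of the two sides, multiplied by the sign \<open>e\<close>, so
    that the leading term is nonnegative on [0, pi] whatever the parity of \<open>n\<close>.\<close>
  define h where "h t = r t * sin t + \<beta> * e * (sin (r t * \<alpha>) * sin (r t * (1 - \<alpha>)))" for t
  define D where "D t = \<beta> * e * (\<alpha> * cos (r t * \<alpha>) * sin (r t * (1 - \<alpha>))
    + (1 - \<alpha>) * sin (r t * \<alpha>) * cos (r t * (1 - \<alpha>)))" for t
  define h' where "h' t = sin t + r t * cos t + D t" for t
  have deriv: "(h has_real_derivative h' t) (at t)" for t
    unfolding h_def h'_def D_def r_def by (auto intro!: derivative_eq_intros simp: algebra_simps)
  have root_iff: "r t * sin (r t) = - \<beta> * sin (r t * \<alpha>) * sin (r t * (1 - \<alpha>)) \<longleftrightarrow> h t = 0" for t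
  proof -
    have "e * h t = r t * sin (r t) + (e * e) * (\<beta> * sin (r t * \<alpha>) * sin (r t * (1 - \<alpha>)))"
      by (simp add: h_def sin_r algebra_simps)
    then have eh: "e * h t = r t * sin (r t) + \<beta> * sin (r t * \<alpha>) * sin (r t * (1 - \<alpha>))"
      using e by simp
    have "e \<noteq> 0" using e by auto
    then have "h t = 0 \<longleftrightarrow> r t * sin (r t) + \<beta> * sin (r t * \<alpha>) * sin (r t * (1 - \<alpha>)) = 0"
      by (simp flip: eh)
    then show ?thesis
      by (simp add: eq_neg_iff_add_eq_0)
  qed
  \<comment> \<open>On each third of [0, pi] the relevant one of \<bar>cos t\<bar> and sin t is at
    least 1 / 2, so the leading term is at least 3 (\<beta> + 1) / 2. This exceeds \<beta>, and also
    \<beta> + 1, as required where sin t has the unfavourable sign.\<close>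
  have pi_n: "pi * real n \<ge> 3 * (\<beta> + 1)"
    using pi_gt3 n \<beta> by (intro mult_mono) auto
  have trig_prod: "\<bar>x\<bar> \<le> 1 \<Longrightarrow> \<bar>y\<bar> \<le> 1 \<Longrightarrow> \<bar>\<beta> * e * (x * y)\<bar> \<le> \<beta>" for x y
    using mult_mono[of "\<bar>x\<bar>" 1 "\<bar>y\<bar>" 1] \<beta> e mult_left_mono[of "\<bar>x\<bar> * \<bar>y\<bar>" 1 \<beta>] by (simp add: abs_mult)
  have trig_deriv: "\<bar>D t\<bar> \<le> \<beta>" for t
  proof -
    have "\<bar>x * y\<bar> \<le> 1" if "\<bar>x\<bar> \<le> 1" "\<bar>y\<bar> \<le> 1" for x y :: real
      using mult_mono[of "\<bar>x\<bar>" 1 "\<bar>y\<bar>" 1] that by (simp add: abs_mult)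
    then have "\<bar>\<alpha> * (cos (r t * \<alpha>) * sin (r t * (1 - \<alpha>)))\<bar> \<le> \<alpha> * 1"
      "\<bar>(1 - \<alpha>) * (sin (r t * \<alpha>) * cos (r t * (1 - \<alpha>)))\<bar> \<le> (1 - \<alpha>) * 1"
      unfolding abs_mult[of \<alpha>] abs_mult[of "1 - \<alpha>"] using \<alpha> by (intro mult_mono; simp)+
    then have "\<bar>\<alpha> * cos (r t * \<alpha>) * sin (r t * (1 - \<alpha>)) + (1 - \<alpha>) * sin (r t * \<alpha>) * cos (r t * (1 - \<alpha>))\<bar> \<le> 1"
      by (simp add: mult.assoc)
    then show ?thesis
      using trig_prod[of "\<alpha> * cos (r t * \<alpha>) * sin (r t * (1 - \<alpha>)) + (1 - \<alpha>) * sin (r t * \<alpha>) * cos (r t * (1 - \<alpha>))" 1]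
      by (simp add: D_def)
  qed
  have inc: "h' t > 0" if "0 \<le> t" "t \<le> pi / 3" for t
  proof -
    have "cos t \<ge> 1 / 2"
      using cos_monotone_0_pi_le[of t "pi / 3"] that by (simp add: cos_60)
    then have "r t * cos t \<ge> 3 * (\<beta> + 1) * (1 / 2)"
      using pi_n that \<beta> by (intro mult_mono) (auto simp: r_def)
    moreover have "sin t \<ge> 0"
      using that by (intro sin_ge_zero) auto
    ultimately show ?thesis
      using abs_le_D1[OF trig_deriv[of t]] abs_le_D2[OF trig_deriv[of t]] \<beta> unfolding h'_def
      by (simp add: distrib_left)
  qed
  have dec: "h' t < 0" if "2 * pi / 3 \<le> t" "t \<le> pi" for t
  proof -
    have "cos t \<le> - (1 / 2)"
      using cos_monotone_0_pi_le[of "2 * pi / 3" t] that by (simp add: cos_120)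
    then have "r t * (- cos t) \<ge> 3 * (\<beta> + 1) * (1 / 2)"
      using pi_n that \<beta> by (intro mult_mono) (auto simp: r_def)
    then show ?thesis
      using abs_le_D1[OF trig_deriv[of t]] abs_le_D2[OF trig_deriv[of t]] \<beta> unfolding h'_def
      by (simp add: distrib_left )
        (use sin_le_one[of t] in linarith)
  qed
  have mid: "h t > 0" if "pi / 3 \<le> t" "t \<le> 2 * pi / 3" for t
  proof -
    have "\<bar>cos t\<bar> \<le> 1 / 2"
      using cos_monotone_0_pi_le[of "pi / 3" t] cos_monotone_0_pi_le[of t "2 * pi / 3"] that
      by (simp add: cos_60 cos_120 abs_le_iff)
    then have "(cos t)\<^sup>2 \<le> (1 / 2)\<^sup>2"
      using abs_le_square_iff[of "cos t" "1 / 2"] by simp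
    then have "(sin t)\<^sup>2 \<ge> (1 / 2)\<^sup>2"
      using sin_cos_squared_add[of t] by (simp add: power2_eq_square)
    moreover have "sin t \<ge> 0"
      using that by (intro sin_ge_zero) auto
    ultimately have "sin t \<ge> 1 / 2"
      by (rule power2_le_imp_le)
    then have "r t * sin t \<ge> 3 * (\<beta> + 1) * (1 / 2)"
      using pi_n that \<beta> by (intro mult_mono) (auto simp: r_def intro: order_trans[OF _ that(1)])
    then show ?thesis
      using trig_prod[of "sin (r t * \<alpha>)" "sin (r t * (1 - \<alpha>))"] \<beta> unfolding h_def by simp
  qed
  \<comment> \<open>At both ends of the range the product of sines becomes a signed square; this
    settles the signs of \<open>h 0\<close> and \<open>h pi\<close>.\<close>
  have end_sin: "sin (x * (1 - \<alpha>)) = - cos x * sin (x * \<alpha>)" if "sin x = 0" for x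
    using that by (simp add: right_diff_distrib sin_diff)
  have h0: "h 0 \<le> 0"
  proof -
    have "h 0 = - (\<beta> * (e * e) * (sin (r 0 * \<alpha>))\<^sup>2)"
      using sin_r[of 0] cos_r[of 0] end_sin[of "r 0"] by (simp add: h_def power2_eq_square)
    then show ?thesis using e \<beta> by simp
  qed
  have hpi: "h pi \<ge> 0"
  proof -
    have "h pi = \<beta> * (e * e) * (sin (r pi * \<alpha>))\<^sup>2"
      using sin_r[of pi] cos_r[of pi] end_sin[of "r pi"] by (simp add: h_def power2_eq_square)
    then show ?thesis using e \<beta> by simp
  qed
  \<comment> \<open>On the last third \<open>h\<close> decreases strictly to
    \<open>h pi \<ge> 0\<close>, so it is positive before pi. A root at pi itself is possible, which
    is why the interval is half-open.\<close>
  have root_lt: "t < pi / 3" if "0 \<le> t" "t < pi" "h t = 0" for t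
  proof (rule ccontr)
    assume "\<not> t < pi / 3"
    then have t: "t > 2 * pi / 3"
      using mid[of t] that by (cases "t \<le> 2 * pi / 3") auto
    have "h t > h pi"
      by (rule DERIV_neg_imp_decreasing[OF that(2)]) (use deriv dec t in force)
    with hpi that show False by simp
  qed
  have "\<exists>t\<ge>0. t \<le> pi / 3 \<and> h t = 0"
    using h0 mid[of "pi / 3"] deriv by (intro IVT) (auto intro: DERIV_isCont)
  then obtain t where t': "0 \<le> t" "t \<le> pi / 3" "h t = 0"
    by blast
  have t: "0 \<le> t" "t < pi" "h t = 0"
    using t' pi_gt_zero by linarith+
  have uniq: "t' = t" if "0 \<le> t'" "t' < pi" "h t' = 0" for t'
  proof -
    have strict: "h x < h y" if "0 \<le> x" "x < y" "y < pi / 3" for x y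
      by (rule DERIV_pos_imp_increasing[OF that(2)]) (use deriv inc that in force)
    show ?thesis
      using strict[of t t'] strict[of t' t] root_lt[OF that] root_lt[OF t] t that
      by (cases t t' rule: linorder_cases) auto
  qed
  have npos: "0 \<le> pi * real n" by simp
  show ?thesis
  proof (rule ex1I[of _ "(r t)\<^sup>2"])
    have "sqrt ((r t)\<^sup>2) = r t"
      using t npos by (simp add: r_def)
    moreover have "(pi * real n)\<^sup>2 \<le> (r t)\<^sup>2"
      using t npos by (intro power_mono) (auto simp: r_def)
    moreover have "(r t)\<^sup>2 < (pi * (real n + 1))\<^sup>2"
      using t npos by (intro power_strict_mono) (auto simp: r_def algebra_simps)
    ultimately show "(r t)\<^sup>2 \<in> {pi\<^sup>2 * (real n)\<^sup>2 ..< pi\<^sup>2 * (real n + 1)\<^sup>2} \<and>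
     sqrt ((r t)\<^sup>2) * sin (sqrt ((r t)\<^sup>2)) =
      - \<beta> * sin (sqrt ((r t)\<^sup>2) * \<alpha>) * sin (sqrt ((r t)\<^sup>2) * (1 - \<alpha>))"
      using root_iff[of t] t(3) by (simp add: power_mult_distrib)
  next
    fix l assume l: "l \<in> {pi\<^sup>2 * (real n)\<^sup>2 ..< pi\<^sup>2 * (real n + 1)\<^sup>2} \<and>
      sqrt l * sin (sqrt l) = - \<beta> * sin (sqrt l * \<alpha>) * sin (sqrt l * (1 - \<alpha>))"
    define t' where "t' = sqrt l - pi * real n"
    have "pi * real n \<le> sqrt l"
      using l by (intro real_le_rsqrt) (simp add: power_mult_distrib)
    moreover have "sqrt l < pi * (real n + 1)"
      using l by (intro real_less_lsqrt) (auto simp: power_mult_distrib)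
    ultimately have "0 \<le> t'" "t' < pi" "r t' = sqrt l"
      by (auto simp: t'_def r_def algebra_simps)
    moreover from this have "h t' = 0"
      using root_iff[of t'] l by simp
    ultimately have "sqrt l = r t"
      using uniq by metis
    moreover have "0 \<le> l"
      using l by (auto intro: order_trans[rotated])
    ultimately show "l = (r t)\<^sup>2"
      by (metis real_sqrt_pow2)
  qed
qed

lemma eigenvalue_facts:
  fixes \<alpha> \<beta> :: real
  assumes "0 < \<alpha>" "\<alpha> < 1" "0 \<le> \<beta>" "\<beta> + 1 \<le> real n"
  defines "s \<equiv> freq \<alpha> \<beta> n"
  shows "pi * real n \<le> s" and "eig0 \<alpha> \<beta> n = s\<^sup>2"
    and "s * sin s = - \<beta> * sin (s * \<alpha>) * sin (s * (1 - \<alpha>))"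
proof -
  have *: "eig0 \<alpha> \<beta> n \<in> {pi\<^sup>2 * (real n)\<^sup>2 ..< pi\<^sup>2 * (real n + 1)\<^sup>2} \<and>
     sqrt (eig0 \<alpha> \<beta> n) * sin (sqrt (eig0 \<alpha> \<beta> n)) =
       - \<beta> * sin (sqrt (eig0 \<alpha> \<beta> n) * \<alpha>) * sin (sqrt (eig0 \<alpha> \<beta> n) * (1 - \<alpha>))"
    unfolding eig0_def by (rule theI'[OF ex1_eigenvalue[OF assms(1-4)]])
  then show "s * sin s = - \<beta> * sin (s * \<alpha>) * sin (s * (1 - \<alpha>))"
    by (simp add: s_def freq_def)
  have "0 \<le> eig0 \<alpha> \<beta> n"
    using * by (auto intro: order_trans[rotated])
  then show "eig0 \<alpha> \<beta> n = s\<^sup>2"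
    by (simp add: s_def freq_def)
  show "pi * real n \<le> s"
    unfolding s_def freq_def using * by (intro real_le_rsqrt) (simp add: power_mult_distrib)
qed

section \<open>The linear problem with a delta potential\<close>

lemma integral_lincomb3:
  fixes f g h :: "real \<Rightarrow> real"
  assumes "f integrable_on S" "g integrable_on S" "h integrable_on S"
  shows "integral S (\<lambda>x. a * f x + b * g x + c * h x) = a * integral S f + b * integral S g + c * integral S h"
  by (simp add: Henstock_Kurzweil_Integration.integral_add integrable_add integrable_on_mult_right assms)

text \<open>The first bound on \<open>n\<close> guarantees existence and uniqueness of the
  eigenvalue; the second gives \<open>1 \<le> s * \<alpha>\<close>, from which \<open>M\<close> is
  bounded below independently of \<open>n\<close>.\<close>

locale fd_problem =
  fixes \<alpha> \<beta> :: real and n :: nat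
  assumes alpha: "0 < \<alpha>" "\<alpha> < 1" and beta: "0 \<le> \<beta>"
    and n_ge: "\<beta> + 1 \<le> real n" "1 \<le> real n * \<alpha>"
begin

definition s :: real where "s = freq \<alpha> \<beta> n"

lemma eig0_eq: "eig0 \<alpha> \<beta> n = s\<^sup>2"
  and s_eigen: "s * sin s = - \<beta> * sin (s * \<alpha>) * sin (s * (1 - \<alpha>))"
  and s_ge_n: "real n \<le> s"
proof -
  note facts = eigenvalue_facts[OF alpha beta n_ge(1), folded s_def]
  show "eig0 \<alpha> \<beta> n = s\<^sup>2" "s * sin s = - \<beta> * sin (s * \<alpha>) * sin (s * (1 - \<alpha>))"
    by (fact facts)+
  have "1 * real n \<le> pi * real n"
    using pi_gt3 by (intro mult_right_mono) auto
  with facts(1) show "real n \<le> s" by linarith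
qed

lemma s_ge_1: "1 \<le> s" and s_pos [simp]: "0 < s" and s_alpha: "1 \<le> s * \<alpha>"
proof -
  show "1 \<le> s" using s_ge_n n_ge(1) beta by linarith
  then show "0 < s" by linarith
  show "1 \<le> s * \<alpha>"
    using n_ge(2) mult_right_mono[OF s_ge_n, of \<alpha>] alpha by linarith
qed

lemma s_simps [simp]: "s \<noteq> 0" "0 \<le> s" "\<bar>s\<bar> = s"
  using s_pos by linarith+

abbreviation "c\<^sub>0 \<equiv> c0 \<alpha> \<beta> n"

abbreviation "ct \<equiv> ctilde \<alpha> \<beta> n"

abbreviation "\<phi> \<equiv> u0 \<alpha> \<beta> n"

text \<open>These are the matching conditions at \<alpha>: continuity and the jump of the
  derivative. In the generic branch of \<open>c0\<close> the eigenvalue equation yields the second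
  one; in the other branch it yields sin s = 0, and both follow from the addition formulas.\<close>

lemma c0_sin: "c\<^sub>0 * sin (s * (1 - \<alpha>)) = sin (s * \<alpha>) / s"
  and c0_cos: "c\<^sub>0 * cos (s * (1 - \<alpha>)) = - (cos (s * \<alpha>) + \<beta> / s * sin (s * \<alpha>)) / s"
proof -
  let ?S = "sin (s * (1 - \<alpha>))" and ?C = "cos (s * (1 - \<alpha>))"
  have s0: "s \<noteq> 0" using s_pos by linarith
  have sin_s: "sin s = sin (s * \<alpha>) * ?C + cos (s * \<alpha>) * ?S"
    using sin_add[of "s * \<alpha>" "s * (1 - \<alpha>)"] by (simp add: algebra_simps)
  have "c\<^sub>0 * ?S = sin (s * \<alpha>) / s \<and> c\<^sub>0 * ?C = - (cos (s * \<alpha>) + \<beta> / s * sin (s * \<alpha>)) / s"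
  proof (cases "?S = 0")
    case False
    then have c0: "c\<^sub>0 = sin (s * \<alpha>) / (s * ?S)"
      by (simp add: c0_def Let_def s_def)
    have "s * (sin (s * \<alpha>) * ?C) = - (s * cos (s * \<alpha>) + \<beta> * sin (s * \<alpha>)) * ?S"
      using s_eigen unfolding sin_s by (simp add: algebra_simps)
    then show ?thesis
      using False s0 unfolding c0 by (simp add: field_simps)
  next
    case True
    then have c0: "c\<^sub>0 = - cos s / s"
      by (simp add: c0_def Let_def s_def)
    have "sin s = 0"
      using s_eigen True s0 by simp
    moreover have "sin (s * \<alpha>) = sin s * ?C - cos s * ?S" "cos (s * \<alpha>) = cos s * ?C + sin s * ?S"
      using sin_diff[of s "s * (1 - \<alpha>)"] cos_diff[of s "s * (1 - \<alpha>)"] by (simp_all add: algebra_simps)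
    ultimately show ?thesis
      using True s0 unfolding c0 by simp
  qed
  then show "c\<^sub>0 * ?S = sin (s * \<alpha>) / s"
    "c\<^sub>0 * ?C = - (cos (s * \<alpha>) + \<beta> / s * sin (s * \<alpha>)) / s"
    by auto
qed

text \<open>The two matching conditions squared and added.\<close>

lemma ctilde_eq: "ct = (s * c\<^sub>0)\<^sup>2"
proof -
  have "(c\<^sub>0 * s)\<^sup>2 * ((sin (s * (1 - \<alpha>)))\<^sup>2 + (cos (s * (1 - \<alpha>)))\<^sup>2)
      = (s * (c\<^sub>0 * sin (s * (1 - \<alpha>))))\<^sup>2 + (s * (c\<^sub>0 * cos (s * (1 - \<alpha>))))\<^sup>2"
    by (simp only: power_mult_distrib distrib_left mult_ac)
  also have "\<dots> = (sin (s * \<alpha>))\<^sup>2 + (cos (s * \<alpha>) + \<beta> / s * sin (s * \<alpha>))\<^sup>2"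
    unfolding c0_sin c0_cos
    by (simp only: times_divide_eq_right nonzero_mult_div_cancel_left[OF s_simps(1)] power2_minus)
  finally show ?thesis
    by (simp add: ctilde_def Let_def s_def mult.commute)
qed

lemma ctilde_pos: "0 < ct"
proof (cases "sin (s * \<alpha>) = 0")
  case True
  then have "ct = (cos (s * \<alpha>))\<^sup>2 + (sin (s * \<alpha>))\<^sup>2"
    by (simp add: ctilde_def Let_def s_def)
  then show ?thesis by simp
next
  case False
  then show ?thesis
    by (simp add: ctilde_def Let_def s_def add_pos_nonneg)
qed

lemma c0_nonzero: "c\<^sub>0 \<noteq> 0"
  using ctilde_pos ctilde_eq by auto

lemma ctilde_le: "ct \<le> 1 + (1 + \<beta>)\<^sup>2"
proof -
  have "\<beta> / s \<le> \<beta>"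
    using s_ge_1 beta by (simp add: divide_le_eq mult_le_cancel_left1)
  then have "\<bar>\<beta> / s * sin (s * \<alpha>)\<bar> \<le> \<beta> * 1"
    unfolding abs_mult using beta by (intro mult_mono) auto
  then have "\<bar>cos (s * \<alpha>) + \<beta> / s * sin (s * \<alpha>)\<bar> \<le> 1 + \<beta>"
    using abs_cos_le_one[of "s * \<alpha>"] by linarith
  then have "(cos (s * \<alpha>) + \<beta> / s * sin (s * \<alpha>))\<^sup>2 \<le> (1 + \<beta>)\<^sup>2"
    using abs_le_square_iff[of "cos (s * \<alpha>) + \<beta> / s * sin (s * \<alpha>)" "1 + \<beta>"] beta by simp
  moreover have "(sin (s * \<alpha>))\<^sup>2 \<le> 1"
    by (simp add: abs_square_le_1)
  ultimately show ?thesis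
    by (simp add: ctilde_def Let_def s_def)
qed

text \<open>The free solution started at 0 plus the response to the jump. The \<open>max\<close>
  gives one formula on both sides, which shows continuity and has the same shape as
  \<open>sol\<close>.\<close>

lemma u0_eq: "\<phi> x = sin (s * x) / s + \<beta> / s * sin (s * max 0 (x - \<alpha>)) * (sin (s * \<alpha>) / s)"
proof (cases "x \<le> \<alpha>")
  case False
  have arg: "s * (1 - x) = s * (1 - \<alpha>) - s * (x - \<alpha>)"
    by (simp add: algebra_simps)
  have "\<phi> x = c\<^sub>0 * sin (s * (1 - x))"
    using False by (simp add: u0_def Let_def s_def[symmetric])
  then have "\<phi> x = (c\<^sub>0 * sin (s * (1 - \<alpha>))) * cos (s * (x - \<alpha>)) - (c\<^sub>0 * cos (s * (1 - \<alpha>))) * sin (s * (x - \<alpha>))"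
    unfolding arg sin_diff by (simp only: right_diff_distrib mult.assoc)
  also have "\<dots> = (sin (s * \<alpha>) * cos (s * (x - \<alpha>)) + cos (s * \<alpha>) * sin (s * (x - \<alpha>))) / s
      + \<beta> / s * sin (s * (x - \<alpha>)) * (sin (s * \<alpha>) / s)"
    unfolding c0_sin c0_cos using s_pos by (simp add: field_simps)
  also have "sin (s * \<alpha>) * cos (s * (x - \<alpha>)) + cos (s * \<alpha>) * sin (s * (x - \<alpha>)) = sin (s * x)"
    using sin_add[of "s * \<alpha>" "s * (x - \<alpha>)"] by (simp add: algebra_simps)
  finally show ?thesis
    using False by simp
qed (simp add: u0_def Let_def s_def)

text \<open>The same function written from the right end point. In this form the compatibility of the two
  equations for the number \<open>c\<close> in the corrections is orthogonality of the right-hand side to \<open>\<phi>\<close>.\<close>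

lemma u0_eq': "\<phi> x = c\<^sub>0 * (sin (s * (1 - x)) + \<beta> / s * sin (s * (1 - \<alpha>)) * sin (s * max 0 (\<alpha> - x)))"
proof (cases "x \<le> \<alpha>")
  case True
  have arg: "s * (1 - x) = s * (1 - \<alpha>) + s * (\<alpha> - x)"
    by (simp add: algebra_simps)
  have "c\<^sub>0 * (sin (s * (1 - x)) + \<beta> / s * sin (s * (1 - \<alpha>)) * sin (s * (\<alpha> - x)))
      = (c\<^sub>0 * sin (s * (1 - \<alpha>))) * cos (s * (\<alpha> - x)) + (c\<^sub>0 * cos (s * (1 - \<alpha>))) * sin (s * (\<alpha> - x))
        + \<beta> / s * (c\<^sub>0 * sin (s * (1 - \<alpha>))) * sin (s * (\<alpha> - x))"
    unfolding arg sin_add by (simp only: distrib_left mult_ac)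
  also have "\<dots> = (sin (s * \<alpha>) * cos (s * (\<alpha> - x)) - cos (s * \<alpha>) * sin (s * (\<alpha> - x))) / s"
    unfolding c0_sin c0_cos using s_pos by (simp add: field_simps)
  also have "\<dots> = sin (s * x) / s"
    using sin_diff[of "s * \<alpha>" "s * (\<alpha> - x)"] by (simp add: algebra_simps)
  finally show ?thesis
    using True by (simp add: u0_def Let_def s_def)
qed (simp add: u0_def Let_def s_def)

lemma continuous_on_u0: "continuous_on S \<phi>"
  unfolding u0_eq[abs_def] by (intro continuous_intros) auto

lemma abs_u0_le: "\<bar>\<phi> x\<bar> \<le> max 1 (sqrt ct) / s"
proof (cases "x \<le> \<alpha>")
  case True
  then have "\<bar>\<phi> x\<bar> \<le> 1 / s"
    using s_pos by (simp add: u0_def Let_def s_def[symmetric] divide_right_mono)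
  also have "\<dots> \<le> max 1 (sqrt ct) / s"
    using s_pos by (intro divide_right_mono) auto
  finally show ?thesis .
next
  case False
  then have "\<bar>\<phi> x\<bar> \<le> \<bar>c\<^sub>0\<bar> * 1"
    unfolding u0_def Let_def s_def[symmetric] by (simp add: abs_mult mult_left_le)
  also have "\<bar>c\<^sub>0\<bar> * 1 = sqrt ct / s"
    using s_pos unfolding ctilde_eq by (simp add: abs_mult)
  also have "\<dots> \<le> max 1 (sqrt ct) / s"
    using s_pos by (intro divide_right_mono) auto
  finally show ?thesis .
qed

definition A0 :: real where "A0 = sup_norm \<phi>"

lemma abs_u0_le_A0: "x \<in> {0..1} \<Longrightarrow> \<bar>\<phi> x\<bar> \<le> A0"
  unfolding A0_def sup_norm_def
  by (rule cSUP_upper) (use abs_u0_le in \<open>auto intro!: bdd_aboveI\<close>)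

lemma A0_le: "A0 \<le> max 1 (sqrt ct) / s"
  unfolding A0_def sup_norm_def by (rule cSUP_least) (use abs_u0_le in auto)

abbreviation "M \<equiv> Mconst \<alpha> \<beta> n"

lemma integrable_u0_square: "(\<lambda>x. (\<phi> x)\<^sup>2) integrable_on {0..1}"
  by (intro integrable_continuous_interval continuous_intros continuous_on_u0)

lemma M_eq: "M = s\<^sup>2 * integral {0..1} (\<lambda>x. (\<phi> x)\<^sup>2)"
  by (simp add: Mconst_def eig0_eq)

text \<open>Only \<open>[0, \<alpha>]\<close> is used, where s u^(0) is sin (s x). The oscillating
  part of the integral of its square is at most \<alpha> / 4 because sin (2 s \<alpha>) \<le> 1
  \<le> s \<alpha>.\<close>

lemma M_ge: "\<alpha> / 4 \<le> M"
proof -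
  let ?G = "\<lambda>x. x / 2 - sin (2 * (s * x)) / (4 * s)"
  have "((\<lambda>x. (sin (s * x))\<^sup>2) has_integral (?G \<alpha> - ?G 0)) {0..\<alpha>}"
  proof (rule fundamental_theorem_of_calculus)
    show "(?G has_vector_derivative (sin (s * x))\<^sup>2) (at x within {0..\<alpha>})" for x
    proof -
      have sq: "(sin (s * x))\<^sup>2 = 1 / 2 - cos (2 * (s * x)) / 2"
        by (simp add: cos_double_sin diff_divide_distrib)
      show ?thesis
        unfolding has_real_derivative_iff_has_vector_derivative[symmetric] sq
        by (auto intro!: derivative_eq_intros)
    qed
  qed (use alpha in auto)
  moreover have "integral {0..\<alpha>} (\<lambda>x. s\<^sup>2 * (\<phi> x)\<^sup>2) = integral {0..\<alpha>} (\<lambda>x. (sin (s * x))\<^sup>2)"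
    using s_pos by (intro integral_cong)
      (simp add: u0_def Let_def s_def[symmetric] power_divide)
  ultimately have "s\<^sup>2 * integral {0..\<alpha>} (\<lambda>x. (\<phi> x)\<^sup>2) = \<alpha> / 2 - sin (2 * (s * \<alpha>)) / (4 * s)"
    by (simp add: integral_unique)
  also have "\<dots> \<ge> \<alpha> / 2 - \<alpha> / 4"
  proof -
    have "sin (2 * (s * \<alpha>)) \<le> s * \<alpha>"
      using s_alpha sin_le_one[of "2 * (s * \<alpha>)"] by linarith
    then show ?thesis
      using s_pos by (simp add: divide_le_eq mult.commute[of \<alpha>])
  qed
  finally have "\<alpha> / 4 \<le> s\<^sup>2 * integral {0..\<alpha>} (\<lambda>x. (\<phi> x)\<^sup>2)"
    by simp
  also have "\<dots> \<le> M"
    unfolding M_eq using alpha integrable_u0_square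
    by (intro mult_left_mono integral_subset_le integrable_continuous_interval continuous_intros continuous_on_u0) auto
  finally show ?thesis .
qed

lemma M_pos: "0 < M"
  using M_ge alpha by linarith

lemma A0_pos: "0 < A0"
proof (rule ccontr)
  assume "\<not> 0 < A0"
  then have "\<phi> x = 0" if "x \<in> {0..1}" for x
    using abs_u0_le_A0[OF that] by linarith
  then have "integral {0..1} (\<lambda>x. (\<phi> x)\<^sup>2) = integral {0..1} (\<lambda>x. 0)"
    using integral_cong[of "{0..1}" "\<lambda>x. (\<phi> x)\<^sup>2" "\<lambda>x. 0"] by simp
  then show False
    using M_pos M_eq by simp
qed

text \<open>The solution of \<open>y'' + s\<^sup>2 * y = F\<close> with \<open>y 0 = y' 0 = 0\<close> and the jump condition at \<open>\<alpha>\<close>.\<close>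

definition sol :: "(real \<Rightarrow> real) \<Rightarrow> real \<Rightarrow> real" where
  "sol F x = volterra_sin s F x + \<beta> / s * sin (s * max 0 (x - \<alpha>)) * volterra_sin s F \<alpha>"

lemma integrable_mult_u0: "F absolutely_integrable_on {0..1} \<Longrightarrow> (\<lambda>x. F x * \<phi> x) integrable_on {0..1}"
  using absolutely_integrable_continuous_mult[OF continuous_on_u0, where g = F and a = 0 and b = 1]
  by (simp add: absolutely_integrable_on_def mult.commute)

lemma integral_abs_nonneg: "0 \<le> integral {0..1} (\<lambda>\<xi>. \<bar>F \<xi>\<bar> :: real)"
  by (cases "(\<lambda>\<xi>. \<bar>F \<xi>\<bar>) integrable_on {0..1}")
    (auto intro: integral_nonneg simp: not_integrable_integral)

lemma abs_sol_le:
  assumes F: "F absolutely_integrable_on {0..1}" and x: "x \<in> {0..1}"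
  shows "\<bar>sol F x\<bar> \<le> (1 + \<beta> / s) / s * integral {0..1} (\<lambda>\<xi>. \<bar>F \<xi>\<bar>)"
proof -
  let ?I = "integral {0..1} (\<lambda>\<xi>. \<bar>F \<xi>\<bar>)"
  have v: "\<bar>volterra_sin s F x\<bar> \<le> 1 / s * ?I" "\<bar>volterra_sin s F \<alpha>\<bar> \<le> 1 / s * ?I"
    by (rule abs_volterra_sin_le[OF s_pos F]; use x alpha in simp)+
  have "\<bar>\<beta> / s * sin (s * max 0 (x - \<alpha>)) * volterra_sin s F \<alpha>\<bar> \<le> \<beta> / s * 1 * (1 / s * ?I)"
    unfolding abs_mult using beta s_pos v(2) by (intro mult_mono) auto
  moreover have "(1 + \<beta> / s) / s * ?I = 1 / s * ?I + \<beta> / s * 1 * (1 / s * ?I)"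
    by (simp add: add_divide_distrib distrib_right)
  ultimately show ?thesis
    using v(1) abs_triangle_ineq[of "volterra_sin s F x" "\<beta> / s * sin (s * max 0 (x - \<alpha>)) * volterra_sin s F \<alpha>"]
    unfolding sol_def by linarith
qed

lemma continuous_on_sol:
  assumes F: "F absolutely_integrable_on {0..1}"
  shows "continuous_on {0..1} (sol F)"
proof -
  have "continuous_on {0..1} (volterra_sin s F)"
    using volterra_sin_has_derivative[OF s_pos F] by (rule DERIV_continuous_on)
  then show ?thesis
    unfolding sol_def[abs_def] by (intro continuous_intros) auto
qed

lemma volterra_sin_add:
  assumes "F absolutely_integrable_on {0..1}" "G absolutely_integrable_on {0..1}" "x \<le> 1"
  shows "volterra_sin s (\<lambda>\<xi>. F \<xi> + G \<xi>) x = volterra_sin s F x + volterra_sin s G x"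
  unfolding volterra_sin_def distrib_left
  by (intro Henstock_Kurzweil_Integration.integral_add integrable_kernel[OF s_pos])
     (use assms in \<open>auto intro!: continuous_intros\<close>)

lemma sol_add:
  assumes "F absolutely_integrable_on {0..1}" "G absolutely_integrable_on {0..1}" "x \<le> 1"
  shows "sol (\<lambda>\<xi>. F \<xi> + G \<xi>) x = sol F x + sol G x"
  using alpha by (simp add: sol_def volterra_sin_add[OF assms] volterra_sin_add[OF assms(1,2)] algebra_simps add_divide_distrib)

lemma sol_sum:
  fixes m :: nat
  assumes "\<And>j. j < m \<Longrightarrow> F j absolutely_integrable_on {0..1}" "x \<le> 1"
  shows "sol (\<lambda>\<xi>. \<Sum>j<m. F j \<xi>) x = (\<Sum>j<m. sol (F j) x)"
  using assms(1)
proof (induction m)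
  case 0
  then show ?case by (simp add: sol_def volterra_sin_def)
next
  case (Suc m)
  have "(\<lambda>\<xi>. \<Sum>j<m. F j \<xi>) absolutely_integrable_on {0..1}"
    by (rule absolutely_integrable_sum) (use Suc.prems in auto)
  from sol_add[OF this _ assms(2)] Suc show ?case
    by simp
qed

lemma corr_c_eq:
  assumes F: "F absolutely_integrable_on {0..1}" and orth: "integral {0..1} (\<lambda>x. F x * \<phi> x) = 0"
  defines "X \<equiv> integral {0..1} (\<lambda>\<xi>. sin (s * (\<alpha> - \<xi>)) / s * F \<xi>)"
    and "Y \<equiv> - integral {0..1} (\<lambda>\<xi>. cos (s * (\<alpha> - \<xi>)) / s * F \<xi>) - \<beta> / s * volterra_sin s F \<alpha>"
  shows "corr_c \<alpha> \<beta> n F * sin (s * (1 - \<alpha>)) = X" "corr_c \<alpha> \<beta> n F * cos (s * (1 - \<alpha>)) = Y"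
proof -
  let ?S = "sin (s * (1 - \<alpha>))" and ?C = "cos (s * (1 - \<alpha>))"
  note int = integrable_kernel[OF s_pos F]
  have Y: "Y = - integral {0..1} (\<lambda>\<xi>. cos (s * (\<alpha> - \<xi>)) / s * F \<xi>)
       - \<beta> * integral {0..\<alpha>} (\<lambda>\<xi>. sin (s * (\<alpha> - \<xi>)) / eig0 \<alpha> \<beta> n * F \<xi>)"
  proof -
    have "integral {0..\<alpha>} (\<lambda>\<xi>. sin (s * (\<alpha> - \<xi>)) / eig0 \<alpha> \<beta> n * F \<xi>)
        = integral {0..\<alpha>} (\<lambda>\<xi>. 1 / s * (sin (s * (\<alpha> - \<xi>)) / s * F \<xi>))"
      by (rule integral_cong) (simp add: eig0_eq power2_eq_square)
    also have "\<dots> = 1 / s * volterra_sin s F \<alpha>"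
      unfolding volterra_sin_def by (rule Henstock_Kurzweil_Integration.integral_mult_right)
    finally show ?thesis by (simp add: Y_def)
  qed
  \<comment> \<open>Extends the integral over \<open>[0, \<alpha>]\<close> to \<open>[0, 1]\<close>
    with a kernel vanishing beyond \<alpha>, so that it merges with the other two.\<close>
  have tail: "integral {0..1} (\<lambda>\<xi>. sin (s * max 0 (\<alpha> - \<xi>)) / s * F \<xi>) = volterra_sin s F \<alpha>"
  proof -
    have "integral {0..\<alpha>} (\<lambda>\<xi>. sin (s * max 0 (\<alpha> - \<xi>)) / s * F \<xi>)
        + integral {\<alpha>..1} (\<lambda>\<xi>. sin (s * max 0 (\<alpha> - \<xi>)) / s * F \<xi>)
        = integral {0..1} (\<lambda>\<xi>. sin (s * max 0 (\<alpha> - \<xi>)) / s * F \<xi>)"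
      using alpha by (intro integral_kernel_split[OF s_pos F] continuous_intros) auto
    moreover have "integral {\<alpha>..1} (\<lambda>\<xi>. sin (s * max 0 (\<alpha> - \<xi>)) / s * F \<xi>) = integral {\<alpha>..1} (\<lambda>\<xi>. 0)"
      by (rule integral_cong) simp
    moreover have "integral {0..\<alpha>} (\<lambda>\<xi>. sin (s * max 0 (\<alpha> - \<xi>)) / s * F \<xi>) = volterra_sin s F \<alpha>"
      unfolding volterra_sin_def by (rule integral_cong) simp
    ultimately show ?thesis by simp
  qed
  have compat: "X * ?C = Y * ?S"
  proof -
    have "X * ?C - Y * ?S = ?C * X + ?S * integral {0..1} (\<lambda>\<xi>. cos (s * (\<alpha> - \<xi>)) / s * F \<xi>)
        + \<beta> / s * ?S * volterra_sin s F \<alpha>"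
      by (simp add: Y_def algebra_simps)
    also have "\<dots> = integral {0..1} (\<lambda>\<xi>. ?C * (sin (s * (\<alpha> - \<xi>)) / s * F \<xi>)
        + ?S * (cos (s * (\<alpha> - \<xi>)) / s * F \<xi>) + \<beta> / s * ?S * (sin (s * max 0 (\<alpha> - \<xi>)) / s * F \<xi>))"
      unfolding X_def tail[symmetric]
      by (rule integral_lincomb3[symmetric]; intro int continuous_intros; simp)
    also have "\<dots> = integral {0..1} (\<lambda>\<xi>. 1 / (s * c\<^sub>0) * (F \<xi> * \<phi> \<xi>))"
    proof (rule integral_cong)
      fix \<xi>
      have arg: "s * (1 - \<xi>) = s * (1 - \<alpha>) + s * (\<alpha> - \<xi>)"
        by (simp add: algebra_simps)
      have "?C * (sin (s * (\<alpha> - \<xi>)) / s * F \<xi>) + ?S * (cos (s * (\<alpha> - \<xi>)) / s * F \<xi>)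
          + \<beta> / s * ?S * (sin (s * max 0 (\<alpha> - \<xi>)) / s * F \<xi>)
          = F \<xi> / s * (sin (s * (1 - \<xi>)) + \<beta> / s * ?S * sin (s * max 0 (\<alpha> - \<xi>)))"
        unfolding arg sin_add by (simp add: distrib_left add_divide_distrib mult_ac)
      then show "?C * (sin (s * (\<alpha> - \<xi>)) / s * F \<xi>) + ?S * (cos (s * (\<alpha> - \<xi>)) / s * F \<xi>)
          + \<beta> / s * ?S * (sin (s * max 0 (\<alpha> - \<xi>)) / s * F \<xi>) = 1 / (s * c\<^sub>0) * (F \<xi> * \<phi> \<xi>)"
        unfolding u0_eq'[of \<xi>] using c0_nonzero by simp
    qed
    also have "\<dots> = 0"
      using orth by simp
    finally show ?thesis by simp
  qed
  have sq: "?S * ?S + ?C * ?C = 1"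
    by (rule trans[OF add.commute sin_cos_squared_add3])
  \<comment> \<open>The candidate arises by multiplying the two equations by \<open>?S\<close> and
    \<open>?C\<close> and adding; the same computation gives uniqueness.\<close>
  have solves: "(X * ?S + Y * ?C) * ?S = X" "(X * ?S + Y * ?C) * ?C = Y"
  proof -
    have "(X * ?S + Y * ?C) * ?S = X * (?S * ?S) + ?C * (Y * ?S)"
      by (simp add: algebra_simps)
    also have "\<dots> = X * (?S * ?S + ?C * ?C)"
      unfolding compat[symmetric] by (simp only: distrib_left mult_ac)
    finally show "(X * ?S + Y * ?C) * ?S = X"
      by (simp add: sq)
    have "(X * ?S + Y * ?C) * ?C = ?S * (X * ?C) + Y * (?C * ?C)"
      by (simp add: algebra_simps)
    also have "\<dots> = Y * (?S * ?S + ?C * ?C)"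
      unfolding compat by (simp only: distrib_left mult_ac)
    finally show "(X * ?S + Y * ?C) * ?C = Y"
      by (simp add: sq)
  qed
  have "corr_c \<alpha> \<beta> n F = (THE c. c * ?S = X \<and> c * ?C = Y)"
    unfolding corr_c_def Let_def s_def[symmetric] X_def Y ..
  also have "\<dots> = X * ?S + Y * ?C"
  proof (rule the_equality)
    show "(X * ?S + Y * ?C) * ?S = X \<and> (X * ?S + Y * ?C) * ?C = Y"
      using solves by blast
    show "c = X * ?S + Y * ?C" if "c * ?S = X \<and> c * ?C = Y" for c
    proof -
      have "X * ?S + Y * ?C = c * (?S * ?S + ?C * ?C)"
        unfolding that[THEN conjunct1, symmetric] that[THEN conjunct2, symmetric]
        by (simp only: distrib_left mult_ac)
      then show ?thesis by (simp add: sq)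
    qed
  qed
  finally have "corr_c \<alpha> \<beta> n F = X * ?S + Y * ?C" .
  then show "corr_c \<alpha> \<beta> n F * ?S = X" "corr_c \<alpha> \<beta> n F * ?C = Y"
    using solves by simp_all
qed

text \<open>Right of \<alpha>, expanding sin (s (1 - x)) about \<alpha> and inserting the equations
  for c gives the integral over all of [0, 1] plus the response to the jump. Subtracting the
  integral over [x, 1] leaves the initial value form, which needs no bound on c.\<close>

lemma corr_u_eq_sol:
  assumes F: "F absolutely_integrable_on {0..1}" and orth: "integral {0..1} (\<lambda>x. F x * \<phi> x) = 0"
    and x: "x \<in> {0..1}"
  shows "corr_u \<alpha> \<beta> n F x = sol F x"
proof (cases "x \<le> \<alpha>")
  case True
  then show ?thesis
    by (simp add: corr_u_def Let_def s_def[symmetric] sol_def volterra_sin_def)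
next
  case False
  let ?v = "s * (x - \<alpha>)"
  note int = integrable_kernel[OF s_pos F]
  have arg: "s * (1 - x) = s * (1 - \<alpha>) - ?v"
    by (simp add: algebra_simps)
  have "corr_c \<alpha> \<beta> n F * sin (s * (1 - x)) =
      (corr_c \<alpha> \<beta> n F * sin (s * (1 - \<alpha>))) * cos ?v - (corr_c \<alpha> \<beta> n F * cos (s * (1 - \<alpha>))) * sin ?v"
    unfolding arg sin_diff by (simp only: right_diff_distrib mult_ac)
  also have "\<dots> = cos ?v * integral {0..1} (\<lambda>\<xi>. sin (s * (\<alpha> - \<xi>)) / s * F \<xi>)
      + sin ?v * integral {0..1} (\<lambda>\<xi>. cos (s * (\<alpha> - \<xi>)) / s * F \<xi>)
      + \<beta> / s * sin ?v * volterra_sin s F \<alpha>"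
  proof -
    have "X * c - (- I - b * V) * z = c * X + z * I + b * z * V" for X I V b c z :: real
      by (simp add: algebra_simps)
    then show ?thesis
      unfolding corr_c_eq[OF F orth] .
  qed
  also have "cos ?v * integral {0..1} (\<lambda>\<xi>. sin (s * (\<alpha> - \<xi>)) / s * F \<xi>)
      + sin ?v * integral {0..1} (\<lambda>\<xi>. cos (s * (\<alpha> - \<xi>)) / s * F \<xi>)
      = integral {0..1} (\<lambda>\<xi>. cos ?v * (sin (s * (\<alpha> - \<xi>)) / s * F \<xi>) + sin ?v * (cos (s * (\<alpha> - \<xi>)) / s * F \<xi>))"
  proof -
    have "(\<lambda>\<xi>. sin (s * (\<alpha> - \<xi>)) / s * F \<xi>) integrable_on {0..1}"
      "(\<lambda>\<xi>. cos (s * (\<alpha> - \<xi>)) / s * F \<xi>) integrable_on {0..1}"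
      by (intro int continuous_intros; simp)+
    from integral_lincomb3[OF this integrable_0, of "cos ?v" "sin ?v" 0] show ?thesis
      by (simp only: mult_zero_left add_0_right)
  qed
  also have "\<dots> = integral {0..1} (\<lambda>\<xi>. sin (s * (x - \<xi>)) / s * F \<xi>)"
  proof (rule integral_cong)
    fix \<xi>
    have arg: "s * (x - \<xi>) = s * (\<alpha> - \<xi>) + ?v"
      by (simp add: algebra_simps)
    show "cos ?v * (sin (s * (\<alpha> - \<xi>)) / s * F \<xi>) + sin ?v * (cos (s * (\<alpha> - \<xi>)) / s * F \<xi>) = sin (s * (x - \<xi>)) / s * F \<xi>"
      unfolding arg sin_add by (simp add: add_divide_distrib distrib_right distrib_left mult_ac)
  qed
  also have "\<dots> = volterra_sin s F x + integral {x..1} (\<lambda>\<xi>. sin (s * (x - \<xi>)) / s * F \<xi>)"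
    unfolding volterra_sin_def using x
    by (intro integral_kernel_split[OF s_pos F, symmetric] continuous_intros) auto
  finally show ?thesis
    using False by (simp add: corr_u_def Let_def s_def[symmetric] sol_def)
qed

text \<open>Read off the formula anchored at 1; in the form \<open>sol\<close> this condition is
  hidden in the orthogonality.\<close>

lemma corr_u_1: "corr_u \<alpha> \<beta> n F 1 = 0"
  using alpha by (simp add: corr_u_def Let_def)

lemma u0_1: "\<phi> 1 = 0"
  using alpha by (simp add: u0_def Let_def)

text \<open>\<open>G\<close> is the right-hand side after s^2 u has been added to both sides, so u''
  = G - s^2 u almost everywhere is the equation with eigenvalue \<open>lam\<close>.\<close>

lemma solves_problemI:
  assumes G: "G absolutely_integrable_on {0..1}"
    and u: "\<And>x. x \<in> {0..1} \<Longrightarrow> u x = \<phi> x + sol G x" and u1: "u 1 = 0"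
    and G_eq: "\<And>x. x \<in> {0..1} \<Longrightarrow> G x = (s\<^sup>2 - lam) * u x + q x * u x + N (u x)"
  shows "solves_problem \<alpha> \<beta> q N lam u"
proof -
  \<comment> \<open>The part of \<open>u\<close> without kink; it equals \<open>u\<close> up to
    \<alpha>. The rest has slope \<open>\<beta> * y \<alpha>\<close> just right of \<alpha>, which
    is the required jump.\<close>
  define y where "y x = sin (s * x) / s + volterra_sin s G x" for x
  define dl where "dl x = cos (s * x) + volterra_cos s G x" for x
  define dr where "dr x = dl x + \<beta> * y \<alpha> * cos (s * (x - \<alpha>))" for x
  have u_y: "u x = y x + \<beta> / s * sin (s * max 0 (x - \<alpha>)) * y \<alpha>" if "x \<in> {0..1}" for x
    unfolding u[OF that] u0_eq[of x] sol_def y_def by (simp add: distrib_left add_divide_distrib)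
  have u_left: "u x = y x" if "x \<in> {0..\<alpha>}" for x
    using that alpha by (simp add: u_y)
  have u_right: "u x = y x + \<beta> / s * sin (s * (x - \<alpha>)) * y \<alpha>" if "x \<in> {\<alpha>..1}" for x
    using that alpha by (simp add: u_y)
  have y_deriv: "(y has_real_derivative dl x) (at x within {0..1})" if "x \<in> {0..1}" for x
    unfolding y_def[abs_def] dl_def
    by (auto intro!: derivative_eq_intros volterra_sin_has_derivative[OF s_pos G that])
  have left: "(u has_real_derivative dl x) (at x within {0..\<alpha>})" if "x \<in> {0..\<alpha>}" for x
  proof (rule has_field_derivative_transform_within[OF _ zero_less_one that])
    show "(y has_real_derivative dl x) (at x within {0..\<alpha>})"
      using that alpha by (intro DERIV_subset[OF y_deriv]) auto
  qed (simp add: u_left)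
  have right: "(u has_real_derivative dr x) (at x within {\<alpha>..1})" if "x \<in> {\<alpha>..1}" for x
  proof (rule has_field_derivative_transform_within[OF _ zero_less_one that])
    have "(y has_real_derivative dl x) (at x within {\<alpha>..1})"
      using that alpha by (intro DERIV_subset[OF y_deriv]) auto
    then show "((\<lambda>x. y x + \<beta> / s * sin (s * (x - \<alpha>)) * y \<alpha>) has_real_derivative dr x) (at x within {\<alpha>..1})"
      unfolding dr_def by (auto intro!: derivative_eq_intros)
  qed (simp add: u_right)
  let ?I = "integral {0..1} (\<lambda>\<xi>. \<bar>G \<xi>\<bar>)"
  \<comment> \<open>Both one-sided derivatives differ from \<open>volterra_cos s G\<close> by a
    Lipschitz function, with constant \<open>K\<close>.\<close>
  have AC: "absolutely_continuous_on a b f"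
    if ab: "0 \<le> a" "b \<le> 1" and K: "0 \<le> K"
      and f: "\<And>x x'. x \<le> x' \<Longrightarrow> \<bar>f x' - f x - (volterra_cos s G x' - volterra_cos s G x)\<bar> \<le> K * (x' - x)"
    for a b K f
  proof (rule absolutely_continuous_onI_integral_bound)
    show "(\<lambda>\<xi>. (\<bar>G \<xi>\<bar> + s * ?I) + K) integrable_on {a..b}"
      using ab by (intro integrable_add abs_integrable_F[OF s_pos G]) auto
    show "0 \<le> (\<bar>G t\<bar> + s * ?I) + K" for t
      using K integral_abs_nonneg[of G] by simp
    fix x x' assume x: "a \<le> x" "x \<le> x'" "x' \<le> b"
    have "integral {x..x'} (\<lambda>\<xi>. (\<bar>G \<xi>\<bar> + s * ?I) + K) = integral {x..x'} (\<lambda>\<xi>. \<bar>G \<xi>\<bar> + s * ?I) + K * (x' - x)"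
      using ab x by (subst Henstock_Kurzweil_Integration.integral_add) (auto intro!: integrable_add abs_integrable_F[OF s_pos G])
    moreover have "\<bar>volterra_cos s G x' - volterra_cos s G x\<bar> \<le> integral {x..x'} (\<lambda>\<xi>. \<bar>G \<xi>\<bar> + s * ?I)"
      using ab x by (intro abs_volterra_cos_diff_le[OF s_pos G]) auto
    ultimately show "\<bar>f x' - f x\<bar> \<le> integral {x..x'} (\<lambda>\<xi>. (\<bar>G \<xi>\<bar> + s * ?I) + K)"
      using f[OF x(2)] by linarith
  qed
  have cos_lip: "\<bar>cos (s * x' - b) - cos (s * x - b)\<bar> \<le> s * (x' - x)" if "x \<le> x'" for x x' b
  proof -
    have "\<bar>cos (s * x' - b) - cos (s * x - b)\<bar> \<le> \<bar>s * x' - b - (s * x - b)\<bar>"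
      by (rule abs_cos_diff_le)
    also have "\<dots> = s * (x' - x)"
      using that by (simp add: right_diff_distrib[symmetric] abs_mult)
    finally show ?thesis .
  qed
  have AC_l: "absolutely_continuous_on 0 \<alpha> dl"
    by (rule AC[of _ _ s]) (use alpha cos_lip[of _ _ 0] in \<open>auto simp: dl_def\<close>)
  have AC_r: "absolutely_continuous_on \<alpha> 1 dr"
  proof (rule AC[of _ _ "s + \<beta> * \<bar>y \<alpha>\<bar> * s"])
    fix x x' :: real assume x: "x \<le> x'"
    have "\<bar>\<beta> * y \<alpha> * (cos (s * (x' - \<alpha>)) - cos (s * (x - \<alpha>)))\<bar> \<le> \<beta> * \<bar>y \<alpha>\<bar> * (s * (x' - x))"
      unfolding abs_mult using beta cos_lip[OF x, of "s * \<alpha>"]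
      by (intro mult_mono) (auto simp: right_diff_distrib)
    moreover have "dr x' - dr x - (volterra_cos s G x' - volterra_cos s G x)
        = (cos (s * x') - cos (s * x)) + \<beta> * y \<alpha> * (cos (s * (x' - \<alpha>)) - cos (s * (x - \<alpha>)))"
      by (simp add: dr_def dl_def right_diff_distrib)
    moreover have "(s + \<beta> * \<bar>y \<alpha>\<bar> * s) * (x' - x) = s * (x' - x) + \<beta> * \<bar>y \<alpha>\<bar> * (s * (x' - x))"
      by (simp add: algebra_simps)
    ultimately show "\<bar>dr x' - dr x - (volterra_cos s G x' - volterra_cos s G x)\<bar> \<le> (s + \<beta> * \<bar>y \<alpha>\<bar> * s) * (x' - x)"
      using cos_lip[OF x, of 0] by simp
  qed (use alpha beta in auto)
  have cont: "continuous_on {0..1} u"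
    using continuous_on_cong[of "{0..1}" "{0..1}" u "\<lambda>x. \<phi> x + sol G x"] u
    by (simp add: continuous_on_add continuous_on_u0 continuous_on_sol[OF G])
  obtain Z where Z: "negligible Z" "\<And>x. x \<in> {0<..<1} - Z \<Longrightarrow>
      (volterra_cos s G has_real_derivative G x - s\<^sup>2 * volterra_sin s G x) (at x)"
    by (rule AE_volterra_cos_has_derivative[OF s_pos G]) blast
  have ode: "deriv u field_differentiable at x \<and> deriv (deriv u) x - q x * u x + lam * u x - N (u x) = 0"
    if x: "x \<in> {0<..<1} - {\<alpha>}" "x \<notin> Z" for x
  proof -
    have "\<exists>d U. open U \<and> x \<in> U \<and> (\<forall>z\<in>U. (u has_real_derivative d z) (at z)) \<and>
        (d has_real_derivative G x - s\<^sup>2 * u x) (at x)"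
    proof (cases "x < \<alpha>")
      case True
      have "(u has_real_derivative dl z) (at z)" if "z \<in> {0<..<\<alpha>}" for z
        using left[of z] that by (simp add: at_within_Icc_at)
      moreover have "(dl has_real_derivative G x - s\<^sup>2 * u x) (at x)"
        using Z(2)[of x] x True alpha unfolding dl_def[abs_def]
        by (auto intro!: derivative_eq_intros simp: u_left y_def power2_eq_square algebra_simps)
      ultimately show ?thesis
        using True x by (intro exI[of _ dl] exI[of _ "{0<..<\<alpha>}"]) auto
    next
      case False
      have "(u has_real_derivative dr z) (at z)" if "z \<in> {\<alpha><..<1}" for z
        using right[of z] that by (simp add: at_within_Icc_at)
      moreover have "(dr has_real_derivative G x - s\<^sup>2 * u x) (at x)"
        using Z(2)[of x] x False alpha unfolding dr_def[abs_def] dl_def[abs_def]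
        by (auto intro!: derivative_eq_intros simp: u_right y_def[of x] power2_eq_square field_simps)
      ultimately show ?thesis
        using False x by (intro exI[of _ dr] exI[of _ "{\<alpha><..<1}"]) auto
    qed
    then obtain d U where dU: "open U" "x \<in> U" "\<And>z. z \<in> U \<Longrightarrow> (u has_real_derivative d z) (at z)"
      "(d has_real_derivative G x - s\<^sup>2 * u x) (at x)"
      by blast
    have "(deriv u has_real_derivative G x - s\<^sup>2 * u x) (at x)"
      by (rule has_field_derivative_transform_within_open[OF dU(4,1,2)])
         (simp add: DERIV_imp_deriv[OF dU(3)])
    then have "deriv u field_differentiable at x" "deriv (deriv u) x = G x - s\<^sup>2 * u x"
      by (auto simp: field_differentiable_def DERIV_imp_deriv)
    then show ?thesis
      using G_eq[of x] x by (simp add: algebra_simps)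
  qed
  have "AE x in lebesgue. x \<notin> Z"
    using Z(1) by (intro AE_not_in) (simp add: negligible_iff_null_sets)
  then have "AE x in lebesgue. x \<in> {0<..<1} - {\<alpha>} \<longrightarrow>
      deriv u field_differentiable at x \<and> deriv (deriv u) x - q x * u x + lam * u x - N (u x) = 0"
    by eventually_elim (use ode in blast)
  moreover have "u 0 = 0"
    using alpha u_left[of 0] by (simp add: y_def volterra_sin_def)
  moreover have "dl 0 = 1"
    by (simp add: dl_def volterra_cos_def)
  moreover have "dr \<alpha> - dl \<alpha> = \<beta> * u \<alpha>"
    using alpha u_left[of \<alpha>] by (simp add: dr_def)
  ultimately show ?thesis
    unfolding solves_problem_def using cont u1 left right AC_l AC_r by blast
qed

end

section \<open>The majorant series\<close>

text \<open>Rewrites the series that start at p = 1 as power series indexed from 0 with constant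
  term 0.\<close>

definition drop_const :: "(nat \<Rightarrow> real) \<Rightarrow> nat \<Rightarrow> real" where
  "drop_const a p = (if p = 0 then 0 else a p)"

lemma drop_const_simps [simp]: "drop_const a 0 = 0" "drop_const a (Suc p) = a (Suc p)"
  by (simp_all add: drop_const_def)

locale fd_method = fd_problem +
  fixes q N :: "real \<Rightarrow> real" and a :: "nat \<Rightarrow> real"
  assumes q: "q absolutely_integrable_on {0..1}"
    and N_sums: "\<And>u. (\<lambda>p. a (Suc p) * u ^ Suc p) sums N u"
begin

abbreviation "b \<equiv> drop_const a"

lemma b_sums: "(\<lambda>p. b p * u ^ p) sums N u"
proof -
  have "(\<lambda>p. b (Suc p) * u ^ Suc p) sums N u"
    using N_sums by simp
  then show ?thesis
    by (subst (asm) sums_Suc_iff) simp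
qed

lemma entire_b: "entire_coeffs b"
  by (rule entire_coeffsI) (rule sums_summable[OF b_sums])

lemma N_eq: "N u = pow_series b u"
  using b_sums by (simp add: pow_series_def sums_iff)

text \<open>The power series coefficients of \<open>Ntilde1\<close> at 0. They dominate the Taylor
  coefficients of \<open>N\<close> at every centre \<open>\<phi> x\<close> with \<open>x\<close> in
  \<open>[0, 1]\<close>.\<close>

definition g :: "nat \<Rightarrow> real" where "g = taylor_coeff (\<lambda>p. \<bar>b p\<bar>) A0"

lemma entire_g: "entire_coeffs g"
  unfolding g_def by (rule entire_taylor_coeff) (simp add: entire_b)

lemma g_nonneg [simp]: "0 \<le> g i"
  unfolding g_def by (rule taylor_coeff_nonneg) (use A0_pos entire_b in auto)

lemma Ntilde_eq: "Ntilde a u = pow_series (\<lambda>p. \<bar>b p\<bar>) u"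
proof -
  have "(\<lambda>p. \<bar>b p\<bar> * u ^ p) sums pow_series (\<lambda>p. \<bar>b p\<bar>) u"
    by (rule entire_coeffs_sums) (simp add: entire_b)
  then have "(\<lambda>p. \<bar>b (Suc p)\<bar> * u ^ Suc p) sums pow_series (\<lambda>p. \<bar>b p\<bar>) u"
    by (subst sums_Suc_iff) simp
  then show ?thesis
    unfolding Ntilde_def by (simp add: sums_iff)
qed

lemma Ntilde1_eq: "Ntilde1 \<alpha> \<beta> a n v = pow_series (\<lambda>p. \<bar>b p\<bar>) (A0 + v)"
  by (simp add: Ntilde1_def Ntilde_eq A0_def)

lemma deriv_Ntilde1: "deriv (Ntilde1 \<alpha> \<beta> a n) 0 = g 1"
  unfolding Ntilde1_eq[abs_def] g_def
  by (rule deriv_pow_series_shift) (simp add: entire_b)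

lemma adomian_Ntilde1: "v 0 = 0 \<Longrightarrow> adomian (Ntilde1 \<alpha> \<beta> a n) k v = comp_coeff g v k"
  unfolding g_def by (rule adomian_eq_comp_coeff) (simp_all add: entire_b Ntilde1_eq)

abbreviation "v\<^sub>0 \<equiv> vbar0 \<alpha> \<beta> n"

abbreviation "V \<equiv> vbar \<alpha> \<beta> q a n"

abbreviation "L \<equiv> L1_norm q"

lemma L_nonneg: "0 \<le> L"
  using integral_abs_nonneg[of q] by (simp add: L1_norm_def)

text \<open>The part of the recursion for the majorant coefficients that is not quadratic, for index \<open>k + 1\<close>;
  it absorbs the exceptional first coefficient.\<close>

definition src :: "nat \<Rightarrow> real" where
  "src k = (if k = 0 then (L + g 1) * v\<^sub>0 else L * V k + comp_coeff g V k)"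

lemma V_Suc: "V (Suc k) = (\<Sum>p\<in>{1..k}. V (Suc k - p) * V p) + (1 + v\<^sub>0) * src k"
proof (cases k)
  case 0
  then show ?thesis
    by (simp add: src_def deriv_Ntilde1 distrib_right)
next
  case (Suc k')
  then show ?thesis
    by (simp add: src_def adomian_Ntilde1)
qed

lemma b_bounds: "1 \<le> bconst \<alpha> \<beta> n" "s / M \<le> bconst \<alpha> \<beta> n" "s * sqrt ct / M \<le> bconst \<alpha> \<beta> n"
  by (simp_all add: bconst_def Let_def s_def)

lemma v0_eq: "v\<^sub>0 = bconst \<alpha> \<beta> n * A0"
  by (simp add: vbar0_def A0_def)

lemma A0_le_v0: "A0 \<le> v\<^sub>0"
  unfolding v0_eq using b_bounds(1) A0_pos by (simp add: mult_le_cancel_right1)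

lemma v0_pos: "0 < v\<^sub>0"
  using A0_le_v0 A0_pos by linarith

text \<open>Since \<open>s * A0 \<le> max 1 (sqrt ct)\<close>, the product
  \<open>s / M * (s * A0)\<close> is bounded by one of the last two entries in the maximum
  \<open>bconst\<close>. This controls the prefactor s^2 / M in the formula for
  \<lambda>^(j).\<close>

lemma A0_square_le: "s\<^sup>2 * A0\<^sup>2 / M \<le> v\<^sub>0"
proof -
  have "s * A0 \<le> max 1 (sqrt ct)"
    using A0_le by (simp add: pos_le_divide_eq mult.commute)
  then have "s / M * (s * A0) \<le> s / M * max 1 (sqrt ct)"
    using M_pos by (intro mult_left_mono) auto
  also have "\<dots> \<le> bconst \<alpha> \<beta> n"
    using b_bounds by (auto simp: max_def)
  finally have "s / M * (s * A0) * A0 \<le> v\<^sub>0"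
    unfolding v0_eq using A0_pos by (intro mult_right_mono) auto
  then show ?thesis
    by (simp add: power2_eq_square mult_ac)
qed

lemma V_nonneg: "0 \<le> V k"
proof (induction k rule: less_induct)
  case (less k)
  show ?case
  proof (cases k)
    case (Suc m)
    \<comment> \<open>The induction hypothesis covers only indices up to \<open>m\<close>; the
      truncation is nonnegative everywhere.\<close>
    have "comp_coeff g V m = comp_coeff g (\<lambda>p. if p \<le> m then V p else 0) m"
      by (rule comp_coeff_cong) simp
    also have "\<dots> \<ge> 0"
      using less Suc by (intro comp_coeff_nonneg) auto
    finally have "0 \<le> src m"
      using less Suc L_nonneg v0_pos unfolding src_def by auto
    then show ?thesis
      unfolding Suc V_Suc using v0_pos less Suc
      by (intro add_nonneg_nonneg sum_nonneg mult_nonneg_nonneg) auto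
  qed simp
qed

lemma src_nonneg: "0 \<le> src k"
  unfolding src_def using L_nonneg v0_pos V_nonneg
  by (auto intro!: add_nonneg_nonneg mult_nonneg_nonneg comp_coeff_nonneg)

section \<open>Majorisation of the corrections\<close>

abbreviation "lam \<equiv> fd_lam \<alpha> \<beta> q N n"

abbreviation "u \<equiv> fd_u \<alpha> \<beta> q N n"

definition rhs :: "nat \<Rightarrow> real \<Rightarrow> real" where
  "rhs k x = - (\<Sum>p\<in>{0..k}. lam (Suc k - p) * u p x) + q x * u k x + adomian N k (\<lambda>p. u p x)"

lemma u_Suc: "u (Suc k) = corr_u \<alpha> \<beta> n (rhs k)"
  by (simp add: rhs_def[abs_def])

declare fd_lam.simps(2) [simp del] fd_u.simps(2) [simp del]

lemma adomian_N: "adomian N k (\<lambda>p. u p x) = comp_coeff (taylor_coeff b (\<phi> x)) (\<lambda>p. u p x) k"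
  by (rule adomian_eq_comp_coeff) (simp_all add: entire_b N_eq)

definition \<tau> :: real where "\<tau> = (1 + \<beta> / s) / s"

lemma \<tau>_pos: "0 < \<tau>"
  unfolding \<tau>_def using beta s_pos by (simp add: add_pos_nonneg)

text \<open>This is 1 / b_n, because \<open>v\<^sub>0\<close> is b_n times
  \<open>A0\<close>.\<close>

definition \<mu> :: real where "\<mu> = A0 / v\<^sub>0"

lemma \<mu>: "0 < \<mu>" "\<mu> \<le> 1" "\<mu> * v\<^sub>0 = A0"
  using A0_pos v0_pos A0_le_v0 by (simp_all add: \<mu>_def)

text \<open>Index 0 is separate because \<open>V 0\<close> is the constant coefficient 0 of f; its
  place is taken by \<open>v\<^sub>0\<close>, with \<open>\<mu> * v\<^sub>0 = A0\<close>.\<close>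

definition U :: "nat \<Rightarrow> real" where "U k = (if k = 0 then A0 else \<mu> * \<tau> ^ k * V k)"

text \<open>One power of \<tau> less than in \<open>U\<close>: solving the differential equation
  costs a factor \<tau>, computing the eigenvalue correction does not.\<close>

definition \<Lambda> :: "nat \<Rightarrow> real" where "\<Lambda> k = \<tau> ^ (k - 1) * V k / (1 + v\<^sub>0)"

lemma U_nonneg: "0 \<le> U k"
  using A0_pos \<mu> \<tau>_pos V_nonneg by (simp add: U_def)

lemma \<Lambda>_nonneg: "0 \<le> \<Lambda> k"
  using v0_pos \<tau>_pos V_nonneg by (simp add: \<Lambda>_def)

text \<open>The recursion \<open>V_Suc\<close> divided by \<open>1 + v\<^sub>0\<close>. In the
  quadratic sum the indices add up to \<open>k + 1\<close>, and the missing power of \<tau> in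
  \<Lambda> leaves the common factor \<open>\<tau> ^ k\<close>.\<close>

lemma majorant_step:
  "(\<Sum>p\<in>{1..k}. \<Lambda> (Suc k - p) * U p) + \<mu> * \<tau> ^ k * src k = \<mu> * \<tau> ^ k * V (Suc k) / (1 + v\<^sub>0)"
proof -
  have "(\<Sum>p\<in>{1..k}. \<Lambda> (Suc k - p) * U p) = (\<Sum>p\<in>{1..k}. \<mu> * \<tau> ^ k / (1 + v\<^sub>0) * (V (Suc k - p) * V p))"
  proof (rule sum.cong[OF refl])
    fix p assume p: "p \<in> {1..k}"
    then have "\<tau> ^ k = \<tau> ^ (k - p) * \<tau> ^ p"
      by (simp flip: power_add)
    then show "\<Lambda> (Suc k - p) * U p = \<mu> * \<tau> ^ k / (1 + v\<^sub>0) * (V (Suc k - p) * V p)"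
      using p by (simp add: \<Lambda>_def U_def mult_ac)
  qed
  also have "\<dots> = \<mu> * \<tau> ^ k / (1 + v\<^sub>0) * (\<Sum>p\<in>{1..k}. V (Suc k - p) * V p)"
    by (simp add: sum_distrib_left)
  finally show ?thesis
    unfolding V_Suc using v0_pos by (simp add: field_simps)
qed

text \<open>Let \<open>B\<close> be the quantity of \<open>majorant_step\<close>. It bounds the L_1
  norm of all terms of F other than the one with the new eigenvalue correction, hence
  \<open>A0 * B\<close> bounds their product with \<phi>, which gives the bound on that correction.
  The omitted term then adds at most \<open>v\<^sub>0 * B\<close>, for a total of
  \<open>(1 + v\<^sub>0) * B\<close>. Orthogonality to \<phi> is the equation that defines the
  correction.\<close>

lemma fd_step:
  assumes cont: "\<And>p. p \<le> k \<Longrightarrow> continuous_on {0..1} (u p)"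
    and u_le: "\<And>p x. p \<le> k \<Longrightarrow> x \<in> {0..1} \<Longrightarrow> \<bar>u p x\<bar> \<le> U p"
    and lam_le: "\<And>p. 1 \<le> p \<Longrightarrow> p \<le> k \<Longrightarrow> \<bar>lam p\<bar> \<le> \<Lambda> p"
  shows "\<bar>lam (Suc k)\<bar> \<le> \<Lambda> (Suc k)"
    and "rhs k absolutely_integrable_on {0..1}"
    and "integral {0..1} (\<lambda>x. rhs k x * \<phi> x) = 0"
    and "integral {0..1} (\<lambda>x. \<bar>rhs k x\<bar>) \<le> \<mu> * \<tau> ^ k * V (Suc k)"
    and "x \<in> {0..1} \<Longrightarrow> \<bar>adomian N k (\<lambda>p. u p x)\<bar> \<le> \<mu> * \<tau> ^ k * src k"
proof -
  define E where "E x = adomian N k (\<lambda>p. u p x)" for x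
  \<comment> \<open>The share of the Adomian term in \<open>src\<close>: \<open>g 1 * A0\<close> for
    \<open>k = 0\<close>, and \<open>\<mu> * \<tau> ^ k * comp_coeff g V k\<close>
    otherwise.\<close>
  define e where "e = \<mu> * \<tau> ^ k * src k - L * U k"
  define B where "B = \<mu> * \<tau> ^ k * V (Suc k) / (1 + v\<^sub>0)"
  have contE: "continuous_on {0..1} E"
    unfolding E_def adomian_N
  proof (rule continuous_on_comp_coeff)
    show "continuous_on {0..1} (\<lambda>x. taylor_coeff b (\<phi> x) i)" for i
      by (rule continuous_on_compose2[OF continuous_on_taylor_coeff[OF entire_b, of UNIV] continuous_on_u0]) simp
    show "continuous_on {0..1} (\<lambda>x. u p x)" if "p \<le> k" for p
      using cont[OF that] by simp
  qed
  have E_le: "\<bar>E x\<bar> \<le> e" if x: "x \<in> {0..1}" for x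
  proof -
    have t: "\<bar>taylor_coeff b (\<phi> x) i\<bar> \<le> g i" for i
      unfolding g_def by (rule abs_taylor_coeff_le[OF entire_b abs_u0_le_A0[OF x]])
    show ?thesis
    proof (cases "k = 0")
      case True
      have "\<bar>E x\<bar> \<le> g 0"
        using t[of 0] True by (simp add: E_def adomian_N)
      also have "g 0 \<le> g 1 * A0"
        using pow_series_le_mult_deriv[of "\<lambda>p. \<bar>b p\<bar>" A0] A0_pos entire_b by (simp add: g_def)
      also have "g 1 * A0 = e"
        using True by (simp add: e_def src_def U_def flip: \<mu>(3)) (simp add: algebra_simps)
      finally show ?thesis .
    next
      case False
      have "\<bar>E x\<bar> \<le> \<mu> * \<tau> ^ k * comp_coeff g V k"
        unfolding E_def adomian_N
      proof (rule abs_comp_coeff_le[OF t])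
        show "\<bar>u p x\<bar> \<le> \<mu> * \<tau> ^ p * V p" if "1 \<le> p" "p \<le> k" for p
          using u_le[OF that(2) x] that by (simp add: U_def)
      qed (use False \<mu> \<tau>_pos V_nonneg in auto)
      also have "\<dots> = e"
        using False by (simp add: e_def src_def U_def algebra_simps)
      finally show ?thesis .
    qed
  qed
  have e_nonneg: "0 \<le> e"
    using E_le[of 0] by simp
  show "\<bar>adomian N k (\<lambda>p. u p x)\<bar> \<le> \<mu> * \<tau> ^ k * src k" if "x \<in> {0..1}"
  proof -
    have "e \<le> \<mu> * \<tau> ^ k * src k"
      using L_nonneg U_nonneg[of k] by (simp add: e_def)
    then show ?thesis
      using E_le[OF that] by (simp add: E_def)
  qed
  have B_eq: "B = (\<Sum>p\<in>{1..k}. \<Lambda> (Suc k - p) * U p) + (L * U k + e)"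
    by (simp add: B_def e_def flip: majorant_step)
  have B_nonneg: "0 \<le> B"
    unfolding B_eq using \<Lambda>_nonneg U_nonneg L_nonneg e_nonneg
    by (intro add_nonneg_nonneg sum_nonneg mult_nonneg_nonneg) auto
  have int_up: "(\<lambda>x. u p x * \<phi> x) integrable_on {0..1}" if "p \<le> k" for p
    using cont[OF that] by (intro integrable_continuous_interval continuous_on_mult continuous_on_u0) auto
  have bnd_up: "\<bar>integral {0..1} (\<lambda>x. \<phi> x * u p x)\<bar> \<le> A0 * U p" if "p \<le> k" for p
  proof -
    have "norm (integral {0..1} (\<lambda>x. \<phi> x * u p x)) \<le> integral {0..1} (\<lambda>_::real. A0 * U p)"
      using int_up[OF that] abs_u0_le_A0 u_le[OF that] A0_pos
      by (intro Henstock_Kurzweil_Integration.integral_norm_bound_integral)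
         (auto simp: abs_mult mult.commute intro!: mult_mono)
    then show ?thesis by simp
  qed
  have qu: "(\<lambda>x. q x * u k x) absolutely_integrable_on {0..1}"
    using absolutely_integrable_continuous_mult[OF cont[OF order_refl] q] by (simp add: mult.commute)
  have bnd_q: "\<bar>integral {0..1} (\<lambda>x. q x * u k x * \<phi> x)\<bar> \<le> A0 * (L * U k)"
  proof -
    have "\<bar>integral {0..1} (\<lambda>x. (u k x * \<phi> x) * q x)\<bar> \<le> (U k * A0) * integral {0..1} (\<lambda>x. \<bar>q x\<bar>)"
      by (rule abs_integral_kernel_le[OF s_pos q])
         (use cont abs_u0_le_A0 u_le[of k] U_nonneg in \<open>auto simp: abs_mult intro!: mult_mono continuous_on_mult continuous_on_u0\<close>)
    then show ?thesis
      by (simp add: L1_norm_def mult_ac)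
  qed
  have intE: "(\<lambda>x. E x * \<phi> x) integrable_on {0..1}"
    by (intro integrable_continuous_interval continuous_on_mult contE continuous_on_u0)
  have bnd_E: "\<bar>integral {0..1} (\<lambda>x. E x * \<phi> x)\<bar> \<le> A0 * e"
  proof -
    have "norm (integral {0..1} (\<lambda>x. E x * \<phi> x)) \<le> integral {0..1} (\<lambda>_::real. A0 * e)"
      using intE abs_u0_le_A0 E_le A0_pos e_nonneg
      by (intro Henstock_Kurzweil_Integration.integral_norm_bound_integral)
         (auto simp: abs_mult mult.commute intro!: mult_mono)
    then show ?thesis by simp
  qed
  define J where "J = - (\<Sum>p\<in>{1..k}. lam (Suc k - p) * integral {0..1} (\<lambda>\<xi>. \<phi> \<xi> * u p \<xi>))
      + integral {0..1} (\<lambda>\<xi>. q \<xi> * u k \<xi> * \<phi> \<xi>) + integral {0..1} (\<lambda>\<xi>. E \<xi> * \<phi> \<xi>)"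
  have lam: "lam (Suc k) = s\<^sup>2 / M * J"
    by (simp add: fd_lam.simps(2) J_def E_def eig0_eq)
  have "\<bar>\<Sum>p\<in>{1..k}. lam (Suc k - p) * integral {0..1} (\<lambda>\<xi>. \<phi> \<xi> * u p \<xi>)\<bar>
      \<le> (\<Sum>p\<in>{1..k}. \<Lambda> (Suc k - p) * (A0 * U p))"
    by (intro order.trans[OF sum_abs] sum_mono)
       (auto simp: abs_mult intro!: mult_mono lam_le bnd_up \<Lambda>_nonneg)
  also have "\<dots> = A0 * (\<Sum>p\<in>{1..k}. \<Lambda> (Suc k - p) * U p)"
    by (simp add: sum_distrib_left mult_ac)
  finally have "\<bar>J\<bar> \<le> A0 * (\<Sum>p\<in>{1..k}. \<Lambda> (Suc k - p) * U p) + A0 * (L * U k) + A0 * e"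
    using bnd_q bnd_E unfolding J_def by linarith
  then have J: "\<bar>J\<bar> \<le> A0 * B"
    by (simp add: B_eq distrib_left)
  have "\<bar>lam (Suc k)\<bar> \<le> s\<^sup>2 / M * (A0 * B)"
    unfolding lam abs_mult using J M_pos by (intro mult_mono) auto
  \<comment> \<open>Regrouped for \<open>A0_square_le\<close>; the quotient
    \<open>v\<^sub>0 / A0\<close> then cancels \<mu> in \<open>B\<close>.\<close>
  also have "\<dots> = (s\<^sup>2 * A0\<^sup>2 / M) * (B / A0)"
    using A0_pos by (simp add: power2_eq_square)
  also have "\<dots> \<le> v\<^sub>0 * (B / A0)"
    using A0_square_le B_nonneg A0_pos by (intro mult_right_mono) auto
  also have "\<dots> = \<Lambda> (Suc k)"
    using A0_pos v0_pos by (simp add: B_def \<Lambda>_def \<mu>_def)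
  finally show lam_Suc: "\<bar>lam (Suc k)\<bar> \<le> \<Lambda> (Suc k)" .
  have rhs_eq: "rhs k x = - (lam (Suc k) * \<phi> x) - (\<Sum>p\<in>{1..k}. lam (Suc k - p) * u p x) + q x * u k x + E x" for x
    by (simp add: rhs_def E_def sum.atLeast_Suc_atMost)
  have cont_sum: "continuous_on {0..1} (\<lambda>x. - (lam (Suc k) * \<phi> x) - (\<Sum>p\<in>{1..k}. lam (Suc k - p) * u p x))"
    by (intro continuous_intros continuous_on_u0 cont) auto
  show abs_int: "rhs k absolutely_integrable_on {0..1}"
    unfolding rhs_eq[abs_def]
    by (intro set_integral_add(1) absolutely_integrable_continuous_real cont_sum contE qu)
  have "integral {0..1} (\<lambda>x. rhs k x * \<phi> x) = integral {0..1} (\<lambda>x. - lam (Suc k) * (\<phi> x)\<^sup>2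
      - (\<Sum>p\<in>{1..k}. lam (Suc k - p) * (\<phi> x * u p x)) + q x * u k x * \<phi> x + E x * \<phi> x)"
    by (rule integral_cong) (simp add: rhs_eq algebra_simps sum_distrib_left power2_eq_square)
  also have "\<dots> = - lam (Suc k) * integral {0..1} (\<lambda>x. (\<phi> x)\<^sup>2)
      - (\<Sum>p\<in>{1..k}. lam (Suc k - p) * integral {0..1} (\<lambda>x. \<phi> x * u p x))
      + integral {0..1} (\<lambda>x. q x * u k x * \<phi> x) + integral {0..1} (\<lambda>x. E x * \<phi> x)"
  proof -
    have "((\<lambda>x. - lam (Suc k) * (\<phi> x)\<^sup>2
      - (\<Sum>p\<in>{1..k}. lam (Suc k - p) * (\<phi> x * u p x)) + q x * u k x * \<phi> x + E x * \<phi> x) has_integral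
      - lam (Suc k) * integral {0..1} (\<lambda>x. (\<phi> x)\<^sup>2)
      - (\<Sum>p\<in>{1..k}. lam (Suc k - p) * integral {0..1} (\<lambda>x. \<phi> x * u p x))
      + integral {0..1} (\<lambda>x. q x * u k x * \<phi> x) + integral {0..1} (\<lambda>x. E x * \<phi> x)) {0..1}"
    proof (intro has_integral_add has_integral_diff has_integral_sum has_integral_mult_right integrable_integral)
      show "(\<lambda>x. \<phi> x * u p x) integrable_on {0..1}" if "p \<in> {1..k}" for p
        using int_up[of p] that by (simp add: mult.commute)
    qed (use integrable_u0_square intE integrable_mult_u0[OF qu] in auto)
    then show ?thesis by (rule integral_unique)
  qed
  also have "\<dots> = - lam (Suc k) * integral {0..1} (\<lambda>x. (\<phi> x)\<^sup>2) + J"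
    by (simp add: J_def)
  also have "\<dots> = 0"
  proof -
    have "integral {0..1} (\<lambda>x. (\<phi> x)\<^sup>2) \<noteq> 0"
      using M_pos M_eq by auto
    then show ?thesis
      unfolding lam M_eq by simp
  qed
  finally show "integral {0..1} (\<lambda>x. rhs k x * \<phi> x) = 0" .
  have "integral {0..1} (\<lambda>x. \<bar>rhs k x\<bar>) \<le> integral {0..1} (\<lambda>x. (\<Lambda> (Suc k) * A0 + (\<Sum>p\<in>{1..k}. \<Lambda> (Suc k - p) * U p) + e) + U k * \<bar>q x\<bar>)"
  proof (rule integral_le)
    show "(\<lambda>x. \<bar>rhs k x\<bar>) integrable_on {0..1}"
      using abs_int by (simp add: absolutely_integrable_on_def)
    show "(\<lambda>x. (\<Lambda> (Suc k) * A0 + (\<Sum>p\<in>{1..k}. \<Lambda> (Suc k - p) * U p) + e) + U k * \<bar>q x\<bar>) integrable_on {0..1}"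
      using q by (intro integrable_add integrable_on_mult_right) (auto simp: absolutely_integrable_on_def)
    fix x :: real assume x: "x \<in> {0..1}"
    have "\<bar>lam (Suc k) * \<phi> x\<bar> \<le> \<Lambda> (Suc k) * A0"
      unfolding abs_mult using lam_Suc abs_u0_le_A0[OF x] by (intro mult_mono \<Lambda>_nonneg) auto
    moreover have "\<bar>\<Sum>p\<in>{1..k}. lam (Suc k - p) * u p x\<bar> \<le> (\<Sum>p\<in>{1..k}. \<Lambda> (Suc k - p) * U p)"
      by (intro order.trans[OF sum_abs] sum_mono)
         (use x in \<open>auto simp: abs_mult intro!: mult_mono lam_le u_le \<Lambda>_nonneg\<close>)
    moreover have "\<bar>q x * u k x\<bar> \<le> U k * \<bar>q x\<bar>"
      unfolding abs_mult using u_le[OF order_refl x] by (simp add: mult.commute[of "U k"] mult_left_mono)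
    ultimately show "\<bar>rhs k x\<bar> \<le> (\<Lambda> (Suc k) * A0 + (\<Sum>p\<in>{1..k}. \<Lambda> (Suc k - p) * U p) + e) + U k * \<bar>q x\<bar>"
      using E_le[OF x] unfolding rhs_eq by linarith
  qed
  also have "\<dots> = \<Lambda> (Suc k) * A0 + B"
    using q by (subst Henstock_Kurzweil_Integration.integral_add)
      (auto simp: absolutely_integrable_on_def B_eq L1_norm_def intro!: integrable_on_mult_right)
  also have "\<Lambda> (Suc k) * A0 = v\<^sub>0 * B"
    using v0_pos by (simp add: \<Lambda>_def B_def \<mu>_def)
  also have "v\<^sub>0 * B + B = (1 + v\<^sub>0) * B"
    by (simp add: distrib_right)
  also have "\<dots> = \<mu> * \<tau> ^ k * V (Suc k)"
    using v0_pos by (simp add: B_def)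
  finally show "integral {0..1} (\<lambda>x. \<bar>rhs k x\<bar>) \<le> \<mu> * \<tau> ^ k * V (Suc k)" .
qed

text \<open>Strong induction, since F^(j) involves all earlier corrections. The factor \<tau> from
  \<open>abs_sol_le\<close> raises the exponent from \<open>m\<close> to
  \<open>m + 1\<close>.\<close>

lemma fd_bounds:
  "continuous_on {0..1} (u k) \<and> (\<forall>x\<in>{0..1}. \<bar>u k x\<bar> \<le> U k) \<and> (1 \<le> k \<longrightarrow> \<bar>lam k\<bar> \<le> \<Lambda> k)"
proof (induction k rule: less_induct)
  case (less k)
  show ?case
  proof (cases k)
    case 0
    then show ?thesis
      using continuous_on_u0 abs_u0_le_A0 by (auto simp: U_def)
  next
    case (Suc m)
    have hyps: "\<And>p. p \<le> m \<Longrightarrow> continuous_on {0..1} (u p)"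
      "\<And>p x. p \<le> m \<Longrightarrow> x \<in> {0..1} \<Longrightarrow> \<bar>u p x\<bar> \<le> U p"
      "\<And>p. 1 \<le> p \<Longrightarrow> p \<le> m \<Longrightarrow> \<bar>lam p\<bar> \<le> \<Lambda> p"
      using less Suc by auto
    note step = fd_step[of m, OF hyps]
    have u_sol: "u k x = sol (rhs m) x" if "x \<in> {0..1}" for x
      unfolding Suc u_Suc using step(2,3) that by (rule corr_u_eq_sol)
    have "continuous_on {0..1} (u k)"
      using continuous_on_cong[THEN iffD2, OF refl u_sol continuous_on_sol[OF step(2)]] .
    moreover have "\<bar>u k x\<bar> \<le> U k" if "x \<in> {0..1}" for x
    proof -
      have "\<bar>u k x\<bar> \<le> \<tau> * integral {0..1} (\<lambda>x. \<bar>rhs m x\<bar>)"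
        unfolding u_sol[OF that] \<tau>_def by (rule abs_sol_le[OF step(2) that])
      also have "\<dots> \<le> \<tau> * (\<mu> * \<tau> ^ m * V (Suc m))"
        using \<tau>_pos step(4) by (intro mult_left_mono) auto
      also have "\<dots> = U k"
        by (simp add: U_def Suc)
      finally show ?thesis .
    qed
    ultimately show ?thesis
      using step(1) Suc by simp
  qed
qed

lemma u_continuous: "continuous_on {0..1} (u k)"
  and u_bound: "x \<in> {0..1} \<Longrightarrow> \<bar>u k x\<bar> \<le> U k"
  and lam_bound: "1 \<le> k \<Longrightarrow> \<bar>lam k\<bar> \<le> \<Lambda> k"
  using fd_bounds by blast+

lemma rhs_absolutely_integrable: "rhs k absolutely_integrable_on {0..1}"
  by (rule fd_step(2)) (use u_continuous u_bound lam_bound in blast)+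

lemma rhs_orthogonal: "integral {0..1} (\<lambda>x. rhs k x * \<phi> x) = 0"
  by (rule fd_step(3)) (use u_continuous u_bound lam_bound in blast)+

lemma abs_adomian_le: "x \<in> {0..1} \<Longrightarrow> \<bar>adomian N k (\<lambda>p. u p x)\<bar> \<le> \<mu> * \<tau> ^ k * src k"
  by (rule fd_step(5)) (use u_continuous u_bound lam_bound in blast)+

lemma u_Suc_eq_sol: "x \<in> {0..1} \<Longrightarrow> u (Suc k) x = sol (rhs k) x"
  unfolding u_Suc by (rule corr_u_eq_sol[OF rhs_absolutely_integrable rhs_orthogonal])

end

section \<open>Convergence\<close>

text \<open>The decay is assumed from index 1 on, as the unperturbed eigenpair obeys no such
  bound.\<close>

lemma geometric_tail:
  fixes f :: "nat \<Rightarrow> real"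
  assumes \<rho>: "0 \<le> \<rho>" "\<rho> < 1" and f: "\<And>k. \<bar>f (Suc k)\<bar> \<le> C * \<rho> ^ k"
  shows "summable (\<lambda>k. \<bar>f k\<bar>)"
    and "\<bar>suminf f - (\<Sum>j\<le>m. f j)\<bar> \<le> C * \<rho> ^ m / (1 - \<rho>)"
    and "(\<Sum>k. \<bar>f (Suc k)\<bar>) \<le> C / (1 - \<rho>)"
proof -
  have geo: "(\<lambda>k. C * \<rho> ^ m * \<rho> ^ k) sums (C * \<rho> ^ m * (1 / (1 - \<rho>)))" for m
    using \<rho> by (intro sums_mult geometric_sums) simp
  have summ_Suc: "summable (\<lambda>k. \<bar>f (Suc k)\<bar>)"
    by (rule summable_comparison_test[OF _ sums_summable[OF geo[of 0]]]) (use f in auto)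
  then show summ: "summable (\<lambda>k. \<bar>f k\<bar>)"
    by (subst (asm) summable_Suc_iff)
  have "(\<Sum>k. \<bar>f (Suc k)\<bar>) \<le> (\<Sum>k. C * \<rho> ^ 0 * \<rho> ^ k)"
    using f by (intro suminf_le[OF _ summ_Suc sums_summable[OF geo]]) simp
  also have "\<dots> = C * \<rho> ^ 0 * (1 / (1 - \<rho>))"
    by (rule sums_unique[OF geo, symmetric])
  finally show "(\<Sum>k. \<bar>f (Suc k)\<bar>) \<le> C / (1 - \<rho>)" by simp
  have le: "\<bar>f (k + Suc m)\<bar> \<le> C * \<rho> ^ m * \<rho> ^ k" for k
    using f[of "k + m"] by (simp add: power_add mult_ac)
  have shift: "summable (\<lambda>k. \<bar>f (k + Suc m)\<bar>)"
    using summ by (rule summable_ignore_initial_segment)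
  have "suminf f - (\<Sum>j\<le>m. f j) = (\<Sum>k. f (k + Suc m))"
    using suminf_split_initial_segment[OF summable_rabs_cancel[OF summ], of "Suc m"]
    by (simp add: lessThan_Suc_atMost)
  also have "\<bar>\<dots>\<bar> \<le> (\<Sum>k. \<bar>f (k + Suc m)\<bar>)"
    by (rule summable_rabs[OF shift])
  also have "\<dots> \<le> (\<Sum>k. C * \<rho> ^ m * \<rho> ^ k)"
    by (rule suminf_le[OF le shift sums_summable[OF geo]])
  also have "\<dots> = C * \<rho> ^ m * (1 / (1 - \<rho>))"
    by (rule sums_unique[OF geo, symmetric])
  finally show "\<bar>suminf f - (\<Sum>j\<le>m. f j)\<bar> \<le> C * \<rho> ^ m / (1 - \<rho>)" by simp
qed

text \<open>With \<open>y = sqrt x\<close> the product is the square of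
  \<open>(m + 1) * y ^ m\<close>, and \<open>m * y ^ m\<close> tends to 0.\<close>

lemma square_times_power_bounded:
  fixes x :: real
  assumes "0 \<le> x" "x < 1"
  obtains D where "0 < D" "\<And>m. (real m + 1)\<^sup>2 * x ^ m \<le> D"
proof -
  define y where "y = sqrt x"
  have y: "0 \<le> y" "y < 1" "y\<^sup>2 = x"
    using assms by (simp_all add: y_def)
  have "Bseq (\<lambda>m. real m * y ^ m)"
    using powser_times_n_limit_0[of y] y by (intro convergent_imp_Bseq) (auto simp: convergent_def)
  then obtain B where B: "B > 0" "\<And>m. \<bar>real m * y ^ m\<bar> \<le> B"
    by (auto elim!: BseqE)
  have "(real m + 1)\<^sup>2 * x ^ m \<le> (B + 1)\<^sup>2" for m
  proof -
    have "(real m + 1) * y ^ m \<le> B + 1"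
      using B(2)[of m] power_le_one[of y m] y by (simp add: distrib_right)
    then have "((real m + 1) * y ^ m)\<^sup>2 \<le> (B + 1)\<^sup>2"
      using y by (intro power_mono) auto
    then show ?thesis
      by (simp add: power_mult_distrib y(3)[symmetric] flip: power_mult) (simp add: mult.commute)
  qed
  moreover have "0 < (B + 1)\<^sup>2" using B(1) by simp
  ultimately show thesis using that by blast
qed

text \<open>The index pairs \<open>(Suc k - p, p)\<close> are pairwise distinct and lie in the
  square, whose other terms are nonnegative.\<close>

lemma sum_triangle_le_square:
  fixes T :: "nat \<Rightarrow> real"
  assumes "\<And>i. 0 \<le> T i"
  shows "(\<Sum>k\<le>m. \<Sum>p\<in>{1..k}. T (Suc k - p) * T p) \<le> (\<Sum>i\<le>m. T i)\<^sup>2"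
proof -
  let ?S = "Sigma {..m} (\<lambda>k. {1..k})" and ?h = "\<lambda>(k, p). (Suc k - p, p)"
  have inj: "inj_on ?h ?S"
    by (auto simp: inj_on_def)
  have "(\<Sum>k\<le>m. \<Sum>p\<in>{1..k}. T (Suc k - p) * T p) = (\<Sum>(k, p)\<in>?S. T (Suc k - p) * T p)"
    by (rule sum.Sigma) auto
  also have "\<dots> = (\<Sum>(i, j)\<in>?h ` ?S. T i * T j)"
    by (subst sum.reindex[OF inj]) (simp add: o_def case_prod_unfold)
  also have "\<dots> \<le> (\<Sum>(i, j)\<in>{..m} \<times> {..m}. T i * T j)"
    by (rule sum_mono2) (auto intro!: mult_nonneg_nonneg assms)
  also have "\<dots> = (\<Sum>i\<le>m. T i)\<^sup>2"
    by (simp add: power2_eq_square sum_product sum.cartesian_product)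
  finally show ?thesis .
qed

context fd_method
begin

text \<open>The recursion maps partial sums \<open>S \<le> 1 / 4\<close> at \<open>z\<close> to at most \<open>S\<^sup>2 + 3 / 16 \<le> 1 / 4\<close>.\<close>

lemma conv_radius_V_ge:
  assumes z: "0 \<le> z" and small: "z * (1 + v\<^sub>0) * (L * (1 / 4 + v\<^sub>0) + pow_series g (1 / 4) + g 1 * v\<^sub>0) \<le> 3 / 16"
  shows "ereal z \<le> conv_radius V"
proof -
  define T where "T k = V k * z ^ k" for k
  have T: "0 \<le> T k" for k
    using z V_nonneg by (simp add: T_def)
  have S: "(\<Sum>k\<le>m. T k) \<le> 1 / 4" for m
  proof (induction m)
    case 0
    then show ?case by (simp add: T_def)
  next
    case (Suc m)
    define S where "S = (\<Sum>k\<le>m. T k)"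
    have S: "0 \<le> S" "S \<le> 1 / 4"
      using Suc T by (auto simp: S_def intro: sum_nonneg)
    have src: "(\<Sum>k\<le>m. src k * z ^ k) \<le> (L + g 1) * v\<^sub>0 + L * S + pow_series g S"
    proof -
      \<comment> \<open>At \<open>k = 0\<close> the right side contains the surplus
        \<open>g 0 \<ge> 0\<close>, so that the composition can be summed from index 0.\<close>
      have "src k * z ^ k \<le> (if k = 0 then (L + g 1) * v\<^sub>0 else 0) + L * T k + comp_coeff g V k * z ^ k" for k
        using z by (auto simp: src_def T_def algebra_simps)
      then have "(\<Sum>k\<le>m. src k * z ^ k) \<le> (\<Sum>k\<le>m. (if k = 0 then (L + g 1) * v\<^sub>0 else 0) + L * T k + comp_coeff g V k * z ^ k)"
        by (intro sum_mono)
      also have "\<dots> = (L + g 1) * v\<^sub>0 + L * S + (\<Sum>k\<le>m. comp_coeff g V k * z ^ k)"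
        by (simp add: sum.distrib S_def sum_distrib_left)
      also have "(\<Sum>k\<le>m. comp_coeff g V k * z ^ k) \<le> pow_series g (\<Sum>p=1..m. V p * z ^ p)"
        by (rule sum_comp_coeff_le) (use entire_g V_nonneg z in auto)
      also have "(\<Sum>p=1..m. V p * z ^ p) = S"
        by (simp add: S_def T_def atMost_atLeast0 sum.atLeast_Suc_atMost)
      finally show ?thesis by simp
    qed
    have "(\<Sum>k\<le>Suc m. T k) = (\<Sum>k\<le>m. T (Suc k))"
      by (simp add: sum.atMost_Suc_shift T_def del: sum.atMost_Suc)
    also have "\<dots> = (\<Sum>k\<le>m. (\<Sum>p\<in>{1..k}. T (Suc k - p) * T p) + z * (1 + v\<^sub>0) * (src k * z ^ k))"
    proof (rule sum.cong[OF refl])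
      fix k
      have "(\<Sum>p\<in>{1..k}. T (Suc k - p) * T p) = (\<Sum>p\<in>{1..k}. V (Suc k - p) * V p * z ^ Suc k)"
      proof (rule sum.cong[OF refl])
        fix p assume "p \<in> {1..k}"
        then have "z ^ Suc k = z ^ (Suc k - p) * z ^ p"
          by (simp flip: power_add)
        then show "T (Suc k - p) * T p = V (Suc k - p) * V p * z ^ Suc k"
          by (simp only: T_def mult_ac)
      qed
      then have "(\<Sum>p\<in>{1..k}. T (Suc k - p) * T p) = (\<Sum>p\<in>{1..k}. V (Suc k - p) * V p) * z ^ Suc k"
        by (simp only: sum_distrib_right)
      then show "T (Suc k) = (\<Sum>p\<in>{1..k}. T (Suc k - p) * T p) + z * (1 + v\<^sub>0) * (src k * z ^ k)"
        unfolding T_def[of "Suc k"] V_Suc by (simp only: distrib_left distrib_right mult_1_left power_Suc mult_ac)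
    qed
    also have "\<dots> = (\<Sum>k\<le>m. \<Sum>p\<in>{1..k}. T (Suc k - p) * T p) + z * (1 + v\<^sub>0) * (\<Sum>k\<le>m. src k * z ^ k)"
      by (simp add: sum.distrib sum_distrib_left)
    also have "\<dots> \<le> S\<^sup>2 + z * (1 + v\<^sub>0) * ((L + g 1) * v\<^sub>0 + L * S + pow_series g S)"
      unfolding S_def using z v0_pos src[unfolded S_def] sum_triangle_le_square[of T, OF T]
      by (intro add_mono mult_left_mono) auto
    also have "\<dots> \<le> (1 / 4)\<^sup>2 + z * (1 + v\<^sub>0) * (L * (1 / 4 + v\<^sub>0) + pow_series g (1 / 4) + g 1 * v\<^sub>0)"
    proof -
      have "pow_series g S \<le> pow_series g (1 / 4)"
        by (rule pow_series_mono) (use entire_g S in auto)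
      moreover have "L * S \<le> L * (1 / 4)"
        using S L_nonneg by (intro mult_left_mono)
      ultimately have "(L + g 1) * v\<^sub>0 + L * S + pow_series g S
          \<le> L * (1 / 4 + v\<^sub>0) + pow_series g (1 / 4) + g 1 * v\<^sub>0"
        by (simp add: algebra_simps)
      then show ?thesis
        using S z v0_pos by (intro add_mono[OF power_mono mult_left_mono]) auto
    qed
    also have "\<dots> \<le> 1 / 4"
      using small by (simp add: power2_eq_square)
    finally show ?case .
  qed
  have "sum T {..<m} \<le> sum T {..m}" for m
    using T by (intro sum_mono2) auto
  then have "sum T {..<m} \<le> 1 / 4" for m
    using S order.trans by blast
  with T have "summable T"
    by (rule summableI_nonneg_bounded)
  from conv_radius_geI[OF this[unfolded T_def[abs_def]]] show ?thesis
    using z by simp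
qed

text \<open>\<open>V\<close> dominates its own Cauchy square, so its sum \<open>f\<close> satisfies \<open>f\<^sup>2 \<le> f\<close> and hence \<open>f \<le> 1\<close> on the whole
  positive axis.\<close>

lemma V_eq_0_if_conv_radius_infinite:
  assumes "conv_radius V = \<infinity>"
  shows "V k = 0"
proof (rule ccontr)
  assume Vk: "V k \<noteq> 0"
  then have k: "k > 0" by (cases k) auto
  \<comment> \<open>Chosen so that \<open>V k * z = 2 + V k\<close> exceeds 1, against the bound 1
    for the whole sum.\<close>
  define z where "z = 2 / V k + 1"
  have Vk': "V k > 0" using Vk V_nonneg[of k] by simp
  then have z: "z \<ge> 1" by (simp add: z_def)
  define T where "T k = V k * z ^ k" for k
  have T: "0 \<le> T k" for k
    using z V_nonneg by (simp add: T_def)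
  have summ: "summable T"
    unfolding T_def[abs_def] using assms by (intro summable_in_conv_radius) simp
  then have prod: "(\<lambda>k. \<Sum>i\<le>k. T i * T (k - i)) sums (suminf T * suminf T)"
    using T by (intro Cauchy_product_sums) simp_all
  have "(\<Sum>i\<le>k. T i * T (k - i)) \<le> T k" for k
  proof (cases k)
    case (Suc m)
    \<comment> \<open>The two end terms vanish because \<open>V 0 = 0\<close>; what remains is the
      quadratic part of the recursion.\<close>
    have "(\<Sum>i\<le>k. T i * T (k - i)) = (\<Sum>i\<in>{1..m}. T (Suc m - i) * T i)"
      by (rule sum.mono_neutral_cong_right) (auto simp: Suc T_def not_le le_Suc_eq)
    also have "\<dots> = (\<Sum>i\<in>{1..m}. V (Suc m - i) * V i) * z ^ Suc m"
      unfolding sum_distrib_right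
    proof (rule sum.cong[OF refl])
      fix p assume "p \<in> {1..m}"
      then have "z ^ Suc m = z ^ (Suc m - p) * z ^ p"
        by (simp flip: power_add)
      then show "T (Suc m - p) * T p = V (Suc m - p) * V p * z ^ Suc m"
        by (simp only: T_def mult_ac)
    qed
    also have "\<dots> \<le> V (Suc m) * z ^ Suc m"
      using z v0_pos src_nonneg[of m] unfolding V_Suc by (intro mult_right_mono) auto
    finally show ?thesis
      by (simp add: Suc T_def)
  qed (simp add: T_def)
  from sums_le[OF this prod summable_sums[OF summ]]
  have "suminf T * suminf T \<le> suminf T * 1" by simp
  moreover have "T k \<le> suminf T"
    using sum_le_suminf[OF summ, of "{k}"] T by simp
  moreover have "V k * z \<le> T k"
  proof -
    have "z ^ 1 \<le> z ^ k"
      using z k by (intro power_increasing) auto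
    then show ?thesis
      using Vk' by (simp add: T_def)
  qed
  moreover have "V k * z > 1"
    using Vk' by (simp add: z_def distrib_left)
  ultimately show False
    by (simp add: mult_le_cancel_left)
qed

text \<open>One majorant for order \<open>k + 1\<close>: it bounds \<lambda>^(k+1) and the Adomian
  term of F^(k+1), and \<tau> times it bounds u^(k+1). The factors \<mu> and 1 / (1 + v_0), at most
  1, are given up; only the constant c is affected.\<close>

definition W :: "nat \<Rightarrow> real" where "W k = \<tau> ^ k * V (Suc k)"

lemma src_le_V: "src k \<le> V (Suc k)"
proof -
  have "1 * src k \<le> (1 + v\<^sub>0) * src k"
    using v0_pos src_nonneg by (intro mult_right_mono) auto
  moreover have "0 \<le> (\<Sum>p\<in>{1..k}. V (Suc k - p) * V p)"
    using V_nonneg by (intro sum_nonneg mult_nonneg_nonneg) auto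
  ultimately show ?thesis
    unfolding V_Suc by linarith
qed

lemma W_nonneg: "0 \<le> W k"
  unfolding W_def using \<tau>_pos V_nonneg by simp

lemma u_Suc_bound: "x \<in> {0..1} \<Longrightarrow> \<bar>u (Suc k) x\<bar> \<le> \<tau> * W k"
proof -
  assume "x \<in> {0..1}"
  then have "\<bar>u (Suc k) x\<bar> \<le> \<mu> * (\<tau> * W k)"
    using u_bound[of x "Suc k"] by (simp add: U_def W_def mult_ac)
  also have "\<dots> \<le> \<tau> * W k"
    using \<mu> \<tau>_pos W_nonneg[of k] by (simp add: mult_left_le_one_le)
  finally show ?thesis .
qed

lemma lam_Suc_bound: "\<bar>lam (Suc k)\<bar> \<le> W k"
proof -
  have "\<bar>lam (Suc k)\<bar> \<le> W k / (1 + v\<^sub>0)"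
    using lam_bound[of "Suc k"] by (simp add: \<Lambda>_def W_def)
  also have "\<dots> \<le> W k"
    using v0_pos W_nonneg[of k] by (simp add: divide_le_eq mult_le_cancel_left1)
  finally show ?thesis .
qed

lemma adomian_bound: "x \<in> {0..1} \<Longrightarrow> \<bar>adomian N k (\<lambda>p. u p x)\<bar> \<le> W k"
proof -
  assume "x \<in> {0..1}"
  then have "\<bar>adomian N k (\<lambda>p. u p x)\<bar> \<le> \<mu> * (\<tau> ^ k * src k)"
    unfolding mult.assoc[symmetric] by (rule abs_adomian_le)
  also have "\<dots> \<le> \<tau> ^ k * src k"
    using \<mu> \<tau>_pos src_nonneg[of k] by (simp add: mult_left_le_one_le)
  also have "\<dots> \<le> W k"
    unfolding W_def using src_le_V \<tau>_pos by (intro mult_left_mono) auto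
  finally show ?thesis .
qed

section \<open>Passage to the limit under geometric decay\<close>

lemma volterra_sin_dominated_limit:
  fixes F :: "nat \<Rightarrow> real \<Rightarrow> real"
  assumes F: "\<And>m. F m absolutely_integrable_on {0..1}" and h: "h integrable_on {0..1}"
    and le: "\<And>m x. x \<in> {0..1} \<Longrightarrow> \<bar>F m x\<bar> \<le> h x"
    and lim: "\<And>x. x \<in> {0..1} \<Longrightarrow> (\<lambda>m. F m x) \<longlonglongrightarrow> G x"
    and x: "x \<in> {0..1}"
  shows "(\<lambda>m. volterra_sin s (F m) x) \<longlonglongrightarrow> volterra_sin s G x"
  unfolding volterra_sin_def
proof (rule dominated_convergence(2)[where h = "\<lambda>\<xi>. 1 / s * h \<xi>"])
  show "(\<lambda>\<xi>. sin (s * (x - \<xi>)) / s * F m \<xi>) integrable_on {0..x}" for m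
    using x by (intro integrable_kernel[OF s_pos F] continuous_intros) auto
  show "(\<lambda>\<xi>. 1 / s * h \<xi>) integrable_on {0..x}"
    using x by (intro integrable_on_mult_right integrable_on_subinterval[OF h]) auto
  show "norm (sin (s * (x - \<xi>)) / s * F m \<xi>) \<le> 1 / s * h \<xi>" if "\<xi> \<in> {0..x}" for m \<xi>
  proof -
    have "\<bar>sin (s * (x - \<xi>)) / s\<bar> \<le> 1 / s"
      by (simp add: divide_right_mono)
    moreover have "\<bar>F m \<xi>\<bar> \<le> h \<xi>"
      using that x by (intro le) auto
    ultimately show ?thesis
      unfolding real_norm_def abs_mult by (intro mult_mono) auto
  qed
  show "(\<lambda>m. sin (s * (x - \<xi>)) / s * F m \<xi>) \<longlonglongrightarrow> sin (s * (x - \<xi>)) / s * G \<xi>" if "\<xi> \<in> {0..x}" for \<xi>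
    using that x by (intro tendsto_mult_left lim) auto
qed

definition u_lim :: "real \<Rightarrow> real" where "u_lim x = (\<Sum>j. u j x)"

context
  fixes K \<rho> :: real
  assumes K: "0 \<le> K" and \<rho>: "0 \<le> \<rho>" "\<rho> < 1" and W_le: "\<And>k. W k \<le> K * \<rho> ^ k"
begin

lemma u_geometric: "x \<in> {0..1} \<Longrightarrow> \<bar>u (Suc k) x\<bar> \<le> \<tau> * K * \<rho> ^ k"
  using u_Suc_bound[of x k] mult_left_mono[OF W_le[of k] less_imp_le[OF \<tau>_pos]] by (simp add: mult.assoc)

lemma lam_geometric: "\<bar>lam (Suc k)\<bar> \<le> K * \<rho> ^ k"
  using lam_Suc_bound[of k] W_le[of k] by linarith

lemmas u_tail = geometric_tail[OF \<rho> u_geometric]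
lemmas lam_tail = geometric_tail[OF \<rho> lam_geometric]

lemma u_uniform_limit: "uniform_limit {0..1} (\<lambda>m x. \<Sum>j\<le>m. u j x) u_lim sequentially"
proof (rule uniform_limitI)
  fix e :: real assume "e > 0"
  have "(\<lambda>m. \<tau> * K * \<rho> ^ m / (1 - \<rho>)) \<longlonglongrightarrow> \<tau> * K * 0 / (1 - \<rho>)"
    using \<rho> by (intro tendsto_intros LIMSEQ_realpow_zero) auto
  then have "\<forall>\<^sub>F m in sequentially. \<tau> * K * \<rho> ^ m / (1 - \<rho>) < e"
    using \<open>e > 0\<close> by (intro order_tendstoD) auto
  then show "\<forall>\<^sub>F m in sequentially. \<forall>x\<in>{0..1}. dist (\<Sum>j\<le>m. u j x) (u_lim x) < e"
  proof eventually_elim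
    case (elim m)
    then show ?case
      using u_tail(2)[of _ m] by (force simp: dist_real_def u_lim_def abs_minus_commute)
  qed
qed

lemma continuous_u_lim: "continuous_on {0..1} u_lim"
  by (rule uniform_limit_theorem[OF _ u_uniform_limit])
     (auto intro!: always_eventually continuous_intros u_continuous)

text \<open>The right-hand sides are summed pointwise: a Cauchy product for the eigenvalue terms,
  \<open>comp_coeff_sums\<close> for the Adomian terms. The partial sums are dominated by a constant
  plus a multiple of \<open>\<bar>q x\<bar>\<close>, so the limit passes through the Volterra
  integral although \<open>q\<close> may be unbounded.\<close>

lemma limit_solves: "solves_problem \<alpha> \<beta> q N (\<Sum>j. lam j) u_lim"
proof -
  define l where "l = (\<Sum>j. lam j)"
  define G where "G x = (s\<^sup>2 - l) * u_lim x + q x * u_lim x + N (u_lim x)" for x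
  have contN: "continuous_on UNIV N"
    using continuous_on_taylor_coeff[OF entire_b, of UNIV 0] by (simp add: N_eq[abs_def])
  have abs_G: "G absolutely_integrable_on {0..1}"
  proof -
    have qu: "(\<lambda>x. q x * u_lim x) absolutely_integrable_on {0..1}"
      using absolutely_integrable_continuous_mult[OF continuous_u_lim q] by (simp add: mult.commute)
    have "continuous_on {0..1} (\<lambda>x. (s\<^sup>2 - l) * u_lim x)" "continuous_on {0..1} (\<lambda>x. N (u_lim x))"
      by (intro continuous_intros continuous_u_lim continuous_on_compose2[OF contN]; simp)+
    then show ?thesis
      unfolding G_def[abs_def]
      by (intro set_integral_add(1) qu absolutely_integrable_continuous_real)
  qed
  define Dl where "Dl = (\<Sum>k. \<bar>lam (Suc k)\<bar>)"
  define Du where "Du = A0 + \<tau> * K / (1 - \<rho>)"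
  define De where "De = K / (1 - \<rho>)"
  \<comment> \<open>F^(j) contains \<lambda>^(1), ..., \<lambda>^(j) but not \<lambda>^(0) = s^2,
    hence the coefficient s^2 - l in \<open>G\<close>.\<close>
  have lam_sum: "(\<Sum>k. lam (Suc k)) = l - s\<^sup>2"
    using suminf_split_head[OF summable_rabs_cancel[OF lam_tail(1)]]
    by (simp add: l_def eig0_eq)
  have lam_summ: "summable (\<lambda>k. \<bar>lam (Suc k)\<bar>)"
    using lam_tail(1) by (subst summable_Suc_iff)
  have u_abs: "(\<Sum>k. \<bar>u k x\<bar>) \<le> Du" if x: "x \<in> {0..1}" for x
    using suminf_split_head[OF u_tail(1)[OF x]] u_tail(3)[OF x] abs_u0_le_A0[OF x]
    by (simp add: Du_def)
  have conv: "(\<Sum>p\<in>{0..k}. lam (Suc k - p) * u p x) = (\<Sum>p\<le>k. u p x * lam (Suc (k - p)))" for k x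
    by (rule sum.cong) (auto simp: Suc_diff_le mult.commute)
  have limit: "(\<lambda>m. \<Sum>k<m. rhs k x) \<longlonglongrightarrow> G x"
    and bound: "\<bar>\<Sum>k<m. rhs k x\<bar> \<le> (Du * Dl + De) + Du * \<bar>q x\<bar>" if x: "x \<in> {0..1}" for x m
  proof -
    have "(\<lambda>k. \<Sum>p\<le>k. u p x * lam (Suc (k - p))) sums (u_lim x * (l - s\<^sup>2))"
      unfolding lam_sum[symmetric] u_lim_def
      by (rule Cauchy_product_sums) (use u_tail(1)[OF x] lam_summ in simp_all)
    moreover have u_sums: "(\<lambda>k. u k x) sums u_lim x"
      unfolding u_lim_def by (rule summable_sums[OF summable_rabs_cancel[OF u_tail(1)[OF x]]])
    moreover have "(\<lambda>k. adomian N k (\<lambda>p. u p x)) sums N (u_lim x)"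
    proof -
      have "comp_coeff (taylor_coeff b (\<phi> x)) (\<lambda>p. u p x) sums
          pow_series (taylor_coeff b (\<phi> x)) (\<Sum>p. u (Suc p) x)"
        using u_tail(1)[OF x] by (intro comp_coeff_sums(2) entire_taylor_coeff entire_b) (subst summable_Suc_iff)
      also have "pow_series (taylor_coeff b (\<phi> x)) (\<Sum>p. u (Suc p) x) = N (u_lim x)"
        using suminf_split_head[OF sums_summable[OF u_sums]]
        by (simp add: pow_series_taylor[OF entire_b] N_eq u_lim_def)
      finally show ?thesis
        unfolding adomian_N[abs_def] .
    qed
    ultimately have "(\<lambda>k. - (\<Sum>p\<le>k. u p x * lam (Suc (k - p))) + q x * u k x + adomian N k (\<lambda>p. u p x))
        sums (- (u_lim x * (l - s\<^sup>2)) + q x * u_lim x + N (u_lim x))"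
      by (intro sums_add sums_minus sums_mult)
    then show "(\<lambda>m. \<Sum>k<m. rhs k x) \<longlonglongrightarrow> G x"
      unfolding rhs_def conv sums_def G_def by (simp add: algebra_simps)
    have abs_prod: "(\<lambda>k. \<Sum>p\<le>k. \<bar>u p x\<bar> * \<bar>lam (Suc (k - p))\<bar>) sums ((\<Sum>k. \<bar>u k x\<bar>) * Dl)"
      unfolding Dl_def by (rule Cauchy_product_sums) (use u_tail(1)[OF x] lam_summ in simp_all)
    have "\<bar>\<Sum>k<m. \<Sum>p\<le>k. u p x * lam (Suc (k - p))\<bar> \<le> (\<Sum>k<m. \<Sum>p\<le>k. \<bar>u p x\<bar> * \<bar>lam (Suc (k - p))\<bar>)"
      unfolding abs_mult[symmetric] by (intro order.trans[OF sum_abs] sum_mono sum_abs)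
    also have "\<dots> \<le> (\<Sum>k. \<bar>u k x\<bar>) * Dl"
      unfolding sums_unique[OF abs_prod]
      by (rule sum_le_suminf[OF sums_summable[OF abs_prod]]) (auto intro!: sum_nonneg)
    also have "\<dots> \<le> Du * Dl"
      using u_abs[OF x] lam_summ by (intro mult_right_mono) (auto simp: Dl_def intro!: suminf_nonneg)
    finally have 1: "\<bar>\<Sum>k<m. \<Sum>p\<le>k. u p x * lam (Suc (k - p))\<bar> \<le> Du * Dl" .
    have "\<bar>\<Sum>k<m. u k x\<bar> \<le> (\<Sum>k<m. \<bar>u k x\<bar>)"
      by (rule sum_abs)
    also have "\<dots> \<le> (\<Sum>k. \<bar>u k x\<bar>)"
      by (rule sum_le_suminf[OF u_tail(1)[OF x]]) auto
    also note u_abs[OF x]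
    finally have 2: "\<bar>q x * (\<Sum>k<m. u k x)\<bar> \<le> Du * \<bar>q x\<bar>"
      by (simp add: abs_mult mult.commute[of Du] mult_left_mono)
    have geo: "(\<lambda>k. K * \<rho> ^ k) sums (K * (1 / (1 - \<rho>)))"
      using \<rho> by (intro sums_mult geometric_sums) simp
    have "\<bar>\<Sum>k<m. adomian N k (\<lambda>p. u p x)\<bar> \<le> (\<Sum>k<m. K * \<rho> ^ k)"
      by (intro order.trans[OF sum_abs] sum_mono order.trans[OF adomian_bound[OF x] W_le])
    also have "\<dots> \<le> (\<Sum>k. K * \<rho> ^ k)"
      using K \<rho> by (intro sum_le_suminf[OF sums_summable[OF geo]]) auto
    also have "\<dots> = De"
      using sums_unique[OF geo] by (simp add: De_def)
    finally have 3: "\<bar>\<Sum>k<m. adomian N k (\<lambda>p. u p x)\<bar> \<le> De" .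
    have "(\<Sum>k<m. rhs k x) = - (\<Sum>k<m. \<Sum>p\<le>k. u p x * lam (Suc (k - p))) + q x * (\<Sum>k<m. u k x)
        + (\<Sum>k<m. adomian N k (\<lambda>p. u p x))"
      unfolding rhs_def conv by (simp add: sum.distrib sum_negf sum_subtractf sum_distrib_left)
    with 1 2 3 show "\<bar>\<Sum>k<m. rhs k x\<bar> \<le> (Du * Dl + De) + Du * \<bar>q x\<bar>"
      by linarith
  qed
  have int_h: "(\<lambda>x. (Du * Dl + De) + Du * \<bar>q x\<bar>) integrable_on {0..1}"
    using q by (intro integrable_add integrable_on_mult_right) (auto simp: absolutely_integrable_on_def)
  have abs_sum: "(\<lambda>x. \<Sum>k<m. rhs k x) absolutely_integrable_on {0..1}" for m
    by (rule absolutely_integrable_sum) (auto intro: rhs_absolutely_integrable)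
  have vlim: "(\<lambda>m. volterra_sin s (\<lambda>x. \<Sum>k<m. rhs k x) x) \<longlonglongrightarrow> volterra_sin s G x" if "x \<in> {0..1}" for x
    by (rule volterra_sin_dominated_limit[OF abs_sum int_h bound limit that])
  have u_eq: "u_lim x = \<phi> x + sol G x" if x: "x \<in> {0..1}" for x
  proof -
    have "(\<lambda>m. sol (\<lambda>x. \<Sum>k<m. rhs k x) x) \<longlonglongrightarrow> sol G x"
      unfolding sol_def using x alpha by (intro tendsto_intros vlim) auto
    moreover have "sol (\<lambda>x. \<Sum>k<m. rhs k x) x = (\<Sum>k<m. u (Suc k) x)" for m
      using x by (subst sol_sum) (auto simp: u_Suc_eq_sol intro: rhs_absolutely_integrable)
    ultimately have "(\<lambda>k. u (Suc k) x) sums sol G x"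
      by (simp add: sums_def)
    then show ?thesis
      using suminf_split_head[OF summable_rabs_cancel[OF u_tail(1)[OF x]]]
      by (simp add: u_lim_def sums_iff)
  qed
  have "u j 1 = 0" for j
    by (cases j) (simp_all add: u0_1 u_Suc corr_u_1)
  then have "u_lim 1 = 0"
    by (simp add: u_lim_def)
  with u_eq show ?thesis
    unfolding l_def[symmetric] by (intro solves_problemI[OF abs_G]) (simp_all add: G_def)
qed

end

section \<open>Error bounds in terms of r_n and R\<close>

abbreviation "R \<equiv> Rconv \<alpha> \<beta> q a n"

text \<open>The numerator of \<open>r\<^sub>n\<close>. It exceeds \<open>1 + \<beta> / s\<close>, the factor with which the corrections really grow;
  this gap leaves room for a radius below \<open>R\<close> and for the factor \<open>c / j\<^sup>2\<close>.\<close>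

definition \<kappa> :: real where "\<kappa> = 1 + sqrt (1 + (1 + \<beta> / s)\<^sup>2)"

lemma \<kappa>_gt: "1 + \<beta> / s < \<kappa>"
proof -
  have "1 + \<beta> / s = sqrt ((1 + \<beta> / s)\<^sup>2)"
    using beta by (simp add: add_nonneg_nonneg)
  also have "\<dots> < sqrt (1 + (1 + \<beta> / s)\<^sup>2)"
    by (rule real_sqrt_less_mono) simp
  finally show ?thesis
    by (simp add: \<kappa>_def)
qed

lemma \<kappa>_pos: "0 < \<kappa>"
  by (simp add: \<kappa>_def add_pos_nonneg)

lemma rconst_eq: "rconst \<alpha> \<beta> q a n = ereal \<kappa> / (ereal s * R)"
  by (simp add: rconst_def Let_def s_def \<kappa>_def)

text \<open>As \<rho> < r, the power \<open>\<rho> ^ m\<close> is at most a multiple of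
  \<open>r ^ m / (m + 1)\<^sup>2\<close>, and all remaining factors do not depend on
  \<open>m\<close>. The alternative \<open>K = 0\<close> admits \<open>Rinv = 0\<close>, when both
  errors vanish.\<close>

lemma fd_estimates:
  assumes K: "0 \<le> K" and \<rho>: "0 \<le> \<rho>" "\<rho> < 1" and W_le: "\<And>k. W k \<le> K * \<rho> ^ k"
    and r: "0 \<le> r" "r < 1" and "K = 0 \<or> (\<rho> < r \<and> 0 < Rinv)" and "0 \<le> Rinv"
  shows "\<exists>c>0. \<exists>\<epsilon>>0. \<forall>m.
          (let \<alpha>seq = (\<lambda>j::nat. c / real j powr (1 + \<epsilon>));
               C = \<alpha>seq (m + 1) * M / (1 - r)
           in sup_norm (\<lambda>x. (\<Sum>j. u j x) - (\<Sum>j\<le>m. u j x))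
                \<le> C * Min {1 / M, 1 / s, 1 / (s * sqrt ct)} * r ^ (m + 1) \<and>
              \<bar>(\<Sum>j. lam j) - (\<Sum>j\<le>m. lam j)\<bar>
                \<le> C / (M + Max {1, ct, sqrt ct * M / s}) * Rinv * r ^ m)"
proof -
  define mn where "mn = Min {1 / M, 1 / s, 1 / (s * sqrt ct)}"
  define mx where "mx = M + Max {1, ct, sqrt ct * M / s}"
  have mn: "0 < mn"
    using M_pos ctilde_pos by (simp add: mn_def)
  have "1 \<le> Max {1, ct, sqrt ct * M / s}"
    by (rule Max_ge) auto
  then have mx: "0 < mx"
    using M_pos unfolding mx_def by linarith
  have sup: "sup_norm (\<lambda>x. (\<Sum>j. u j x) - (\<Sum>j\<le>m. u j x)) \<le> \<tau> * K * \<rho> ^ m / (1 - \<rho>)" for m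
    unfolding sup_norm_def using u_tail(2)[OF K \<rho> W_le] by (intro cSUP_least) auto
  have lam: "\<bar>(\<Sum>j. lam j) - (\<Sum>j\<le>m. lam j)\<bar> \<le> K * \<rho> ^ m / (1 - \<rho>)" for m
    by (rule lam_tail(2)[OF K \<rho> W_le])
  have "\<exists>c>0. \<forall>m. \<tau> * K * \<rho> ^ m / (1 - \<rho>) \<le> c / (real m + 1)\<^sup>2 * M / (1 - r) * mn * r ^ (m + 1) \<and>
      K * \<rho> ^ m / (1 - \<rho>) \<le> c / (real m + 1)\<^sup>2 * M / (1 - r) / mx * Rinv * r ^ m"
  proof (cases "K = 0")
    case True
    then show ?thesis
      using M_pos r mn mx \<open>0 \<le> Rinv\<close> by (intro exI[of _ 1]) simp
  next
    case False
    then have \<rho>r: "\<rho> < r" "0 < Rinv" using assms by auto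
    then have r0: "0 < r" using \<rho> by linarith
    obtain D where D: "0 < D" "\<And>m. (real m + 1)\<^sup>2 * (\<rho> / r) ^ m \<le> D"
      by (rule square_times_power_bounded[of "\<rho> / r"]) (use \<rho> \<rho>r in auto)
    have \<rho>_le: "\<rho> ^ m \<le> D * r ^ m / (real m + 1)\<^sup>2" for m
      using D(2)[of m] r0 by (simp add: power_divide field_simps)
    \<comment> \<open>\<open>c1\<close> and \<open>c2\<close> solve the two required estimates,
      taken as equalities, for c; adding 1 to their sum makes the final constant positive.\<close>
    define c1 where "c1 = \<tau> * K / (1 - \<rho>) * D * (1 - r) / (M * mn * r)"
    define c2 where "c2 = K / (1 - \<rho>) * D * (1 - r) * mx / (M * Rinv)"
    have c: "0 \<le> c1" "0 \<le> c2"
      using K \<rho> D r r0 M_pos mn mx \<rho>r \<tau>_pos by (simp_all add: c1_def c2_def)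
    show ?thesis
    proof (intro exI[of _ "c1 + c2 + 1"] conjI allI)
      fix m
      let ?P = "(real m + 1)\<^sup>2"
      have P: "0 < ?P" by simp
      have "\<tau> * K * \<rho> ^ m / (1 - \<rho>) = \<tau> * K / (1 - \<rho>) * \<rho> ^ m"
        by simp
      also have "\<dots> \<le> \<tau> * K / (1 - \<rho>) * (D * r ^ m / ?P)"
        using \<rho>_le[of m] K \<rho> \<tau>_pos by (intro mult_left_mono) auto
      also have "\<dots> = c1 / ?P * M / (1 - r) * mn * r ^ (m + 1)"
        using r r0 M_pos mn \<rho> by (simp add: c1_def)
      also have "\<dots> \<le> (c1 + c2 + 1) / ?P * M / (1 - r) * mn * r ^ (m + 1)"
        using c r r0 M_pos mn by (intro mult_right_mono divide_right_mono) auto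
      finally show "\<tau> * K * \<rho> ^ m / (1 - \<rho>) \<le> (c1 + c2 + 1) / ?P * M / (1 - r) * mn * r ^ (m + 1)" .
      have "K * \<rho> ^ m / (1 - \<rho>) = K / (1 - \<rho>) * \<rho> ^ m"
        by simp
      also have "\<dots> \<le> K / (1 - \<rho>) * (D * r ^ m / ?P)"
        using \<rho>_le[of m] K \<rho> by (intro mult_left_mono) auto
      also have "\<dots> = c2 / ?P * M / (1 - r) / mx * Rinv * r ^ m"
        using r r0 M_pos mx \<rho>r \<rho> by (simp add: c2_def)
      also have "\<dots> \<le> (c1 + c2 + 1) / ?P * M / (1 - r) / mx * Rinv * r ^ m"
        using c r r0 M_pos mx \<rho>r by (intro mult_right_mono divide_right_mono) auto
      finally show "K * \<rho> ^ m / (1 - \<rho>) \<le> (c1 + c2 + 1) / ?P * M / (1 - r) / mx * Rinv * r ^ m" .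
    qed (use c in linarith)
  qed
  then obtain c where c: "0 < c"
    "\<And>m. \<tau> * K * \<rho> ^ m / (1 - \<rho>) \<le> c / (real m + 1)\<^sup>2 * M / (1 - r) * mn * r ^ (m + 1)"
    "\<And>m. K * \<rho> ^ m / (1 - \<rho>) \<le> c / (real m + 1)\<^sup>2 * M / (1 - r) / mx * Rinv * r ^ m"
    by blast
  have powr: "real (m + 1) powr (1 + 1) = (real m + 1)\<^sup>2" for m
    using powr_realpow[of "real (m + 1)" 2] by simp
  show ?thesis
    using c(1) order.trans[OF sup c(2)] order.trans[OF lam c(3)]
    unfolding Let_def mn_def mx_def
    \<comment> \<open>The witness for the exponent is \<epsilon> = 1.\<close>
    by (intro exI[of _ c] conjI exI[of _ 1] allI) (simp_all only: powr zero_less_one)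
qed

lemma W_geometric:
  assumes R: "0 < R" and r1: "rconst \<alpha> \<beta> q a n < 1"
  obtains K \<rho> r Rinv where "rconst \<alpha> \<beta> q a n = ereal r" "1 / R = ereal Rinv"
    "0 \<le> K" "0 \<le> \<rho>" "\<rho> < 1" "\<And>k. W k \<le> K * \<rho> ^ k"
    "0 \<le> r" "r < 1" "K = 0 \<or> (\<rho> < r \<and> 0 < Rinv)" "0 \<le> Rinv"
proof (cases R)
  case PInf
  then have "V k = 0" for k
    by (intro V_eq_0_if_conv_radius_infinite) (simp add: Rconv_def)
  then have "W k \<le> 0 * 0 ^ k" for k
    by (simp add: W_def)
  moreover have "rconst \<alpha> \<beta> q a n = ereal 0" "1 / R = ereal 0"
    using PInf by (simp_all add: rconst_eq zero_ereal_def)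
  ultimately show thesis
    using that[of 0 0 0 0] by simp
next
  case MInf
  then show thesis using R by simp
next
  case (real R')
  then have R': "0 < R'" using R by simp
  define r where "r = \<kappa> / (s * R')"
  have r_eq: "rconst \<alpha> \<beta> q a n = ereal r"
    using R' s_simps unfolding rconst_eq real r_def by (simp del: s_simps)
  have r: "0 < r" "r < 1"
    using r1 \<kappa>_pos R' unfolding r_eq by (auto simp: r_def)
  define t where "t = (1 + \<beta> / s) / \<kappa>"
  \<comment> \<open>Any number strictly between \<open>t\<close> and 1 serves: \<theta> < 1 puts
    \<open>\<theta> * R'\<close> inside the disc of convergence, where the terms of f are bounded,
    and \<open>t < \<theta>\<close> keeps the ratio \<rho> = r t / \<theta> below
    \<open>r\<close>.\<close>
  define \<theta> where "\<theta> = (1 + t) / 2"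
  have "0 < t" "t < 1"
    unfolding t_def using \<kappa>_gt \<kappa>_pos beta by (simp_all add: add_pos_nonneg)
  then have \<theta>: "0 < \<theta>" "\<theta> < 1" "t < \<theta>"
    by (simp_all add: \<theta>_def)
  define \<rho> where "\<rho> = \<tau> / (\<theta> * R')"
  have "\<rho> = r * t / \<theta>"
    using \<kappa>_pos by (simp add: \<rho>_def r_def \<tau>_def t_def)
  also have "\<dots> < r * \<theta> / \<theta>"
    using \<theta> r by (intro divide_strict_right_mono mult_strict_left_mono) auto
  finally have \<rho>: "\<rho> < r"
    using \<theta> by simp
  have \<rho>0: "0 < \<rho>"
    using \<tau>_pos \<theta> R' by (simp add: \<rho>_def)
  have "ereal (norm (\<theta> * R')) < conv_radius V"
    using \<theta> R' real by (simp add: Rconv_def)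
  then have "summable (\<lambda>k. V k * (\<theta> * R') ^ k)"
    by (rule summable_in_conv_radius)
  then have "Bseq (\<lambda>k. V k * (\<theta> * R') ^ k)"
    by (intro convergent_imp_Bseq) (auto simp: convergent_def dest: summable_LIMSEQ_zero)
  then obtain B where B: "0 < B" "\<And>k. \<bar>V k * (\<theta> * R') ^ k\<bar> \<le> B"
    by (auto elim!: BseqE)
  have "W k \<le> B / (\<theta> * R') * \<rho> ^ k" for k
  proof -
    have "V (Suc k) \<le> B / (\<theta> * R') ^ Suc k"
      using B(2)[of "Suc k"] \<theta> R' by (simp add: pos_le_divide_eq)
    then have "W k \<le> \<tau> ^ k * (B / (\<theta> * R') ^ Suc k)"
      unfolding W_def using \<tau>_pos by (intro mult_left_mono) auto
    also have "\<dots> = B / (\<theta> * R') * \<rho> ^ k"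
      by (simp add: \<rho>_def power_divide)
    finally show ?thesis .
  qed
  moreover have "1 / R = ereal (1 / R')"
    using R' unfolding real by (simp add: one_ereal_def)
  ultimately show thesis
    using that[of r "1 / R'" "B / (\<theta> * R')" \<rho>] r_eq r \<rho> \<rho>0 B(1) \<theta> R' by simp
qed

lemma fd_converges:
  assumes "0 < R" and "rconst \<alpha> \<beta> q a n < 1"
  shows "summable lam"
    and "uniform_limit {0..1} (\<lambda>m x. \<Sum>j\<le>m. u j x) (\<lambda>x. \<Sum>j. u j x) sequentially"
    and "solves_problem \<alpha> \<beta> q N (\<Sum>j. lam j) (\<lambda>x. \<Sum>j. u j x)"
    and "\<exists>c>0. \<exists>\<epsilon>>0. \<forall>m.
          (let \<alpha>seq = (\<lambda>j::nat. c / real j powr (1 + \<epsilon>));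
               C = \<alpha>seq (m + 1) * M / (1 - real_of_ereal (rconst \<alpha> \<beta> q a n))
           in sup_norm (\<lambda>x. (\<Sum>j. u j x) - (\<Sum>j\<le>m. u j x))
                \<le> C * Min {1 / M, 1 / s, 1 / (s * sqrt ct)} * real_of_ereal (rconst \<alpha> \<beta> q a n) ^ (m + 1) \<and>
              \<bar>(\<Sum>j. lam j) - (\<Sum>j\<le>m. lam j)\<bar>
                \<le> C / (M + Max {1, ct, sqrt ct * M / s}) * real_of_ereal (1 / R) * real_of_ereal (rconst \<alpha> \<beta> q a n) ^ m)"
proof -
  obtain K \<rho> r Rinv where *: "rconst \<alpha> \<beta> q a n = ereal r" "1 / R = ereal Rinv"
    "0 \<le> K" "0 \<le> \<rho>" "\<rho> < 1" "\<And>k. W k \<le> K * \<rho> ^ k"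
    "0 \<le> r" "r < 1" "K = 0 \<or> (\<rho> < r \<and> 0 < Rinv)" "0 \<le> Rinv"
    by (rule W_geometric[OF assms]) blast
  show "summable lam"
    by (rule summable_rabs_cancel[OF lam_tail(1)[OF *(3-6)]])
  show "uniform_limit {0..1} (\<lambda>m x. \<Sum>j\<le>m. u j x) (\<lambda>x. \<Sum>j. u j x) sequentially"
    using u_uniform_limit[OF *(3-6)] by (simp add: u_lim_def[abs_def])
  show "solves_problem \<alpha> \<beta> q N (\<Sum>j. lam j) (\<lambda>x. \<Sum>j. u j x)"
    using limit_solves[OF *(3-6)] by (simp add: u_lim_def[abs_def])
  show "\<exists>c>0. \<exists>\<epsilon>>0. \<forall>m.
          (let \<alpha>seq = (\<lambda>j::nat. c / real j powr (1 + \<epsilon>));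
               C = \<alpha>seq (m + 1) * M / (1 - real_of_ereal (rconst \<alpha> \<beta> q a n))
           in sup_norm (\<lambda>x. (\<Sum>j. u j x) - (\<Sum>j\<le>m. u j x))
                \<le> C * Min {1 / M, 1 / s, 1 / (s * sqrt ct)} * real_of_ereal (rconst \<alpha> \<beta> q a n) ^ (m + 1) \<and>
              \<bar>(\<Sum>j. lam j) - (\<Sum>j\<le>m. lam j)\<bar>
                \<le> C / (M + Max {1, ct, sqrt ct * M / s}) * real_of_ereal (1 / R) * real_of_ereal (rconst \<alpha> \<beta> q a n) ^ m)"
    unfolding *(1,2) real_of_ereal.simps by (rule fd_estimates[OF *(3-10)])
qed

text \<open>With \<open>M \<ge> \<alpha> / 4\<close> and \<open>ct\<close> bounded, b_n grows at
  most linearly in \<open>s\<close>, while \<open>A0\<close> decays like 1 / s; so their product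
  \<open>v\<^sub>0\<close> stays bounded in \<open>n\<close>.\<close>

lemma A0_le_uniform: "A0 \<le> (1 + sqrt (1 + (1 + \<beta>)\<^sup>2)) / s"
  and v0_le_uniform: "v\<^sub>0 \<le> (1 + sqrt (1 + (1 + \<beta>)\<^sup>2)) + 4 * (1 + sqrt (1 + (1 + \<beta>)\<^sup>2))\<^sup>2 / \<alpha>"
  and \<kappa>_le_uniform: "\<kappa> \<le> 1 + sqrt (1 + (1 + \<beta>)\<^sup>2)"
proof -
  define C where "C = 1 + sqrt (1 + (1 + \<beta>)\<^sup>2)"
  have C: "1 \<le> C" "sqrt ct \<le> C"
    using ctilde_le by (simp_all add: C_def add_increasing)
  show A0: "A0 \<le> C / s"
    using A0_le C divide_right_mono[of "max 1 (sqrt ct)" C s] by (simp add: max_def split: if_splits)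
  have "s * x / M \<le> s * (4 * C / \<alpha>)" if "0 \<le> x" "x \<le> C" for x
  proof -
    have "x / M \<le> C / (\<alpha> / 4)"
      using that M_ge alpha C by (intro frac_le) auto
    then show ?thesis
      using mult_left_mono[of "x / M" "C / (\<alpha> / 4)" s] by (simp add: mult.commute)
  qed
  from this[of 1] this[of "sqrt ct"] C ctilde_pos
  have "bconst \<alpha> \<beta> n \<le> 1 + s * (4 * C / \<alpha>)"
    using alpha by (simp add: bconst_def Let_def s_def[symmetric] add_increasing)
  then have "v\<^sub>0 \<le> (1 + s * (4 * C / \<alpha>)) * (C / s)"
    unfolding v0_eq using A0 A0_pos b_bounds(1) C alpha by (intro mult_mono) auto
  also have "\<dots> = C / s + 4 * C\<^sup>2 / \<alpha>"
    using alpha by (simp add: field_simps power2_eq_square)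
  also have "C / s \<le> C"
    using s_ge_1 C by (simp add: divide_le_eq mult_le_cancel_left1)
  finally show "v\<^sub>0 \<le> C + 4 * C\<^sup>2 / \<alpha>" by simp
  have "\<beta> / s \<le> \<beta>"
    using s_ge_1 beta by (simp add: divide_le_eq mult_le_cancel_left1 del: s_simps)
  then have "(1 + \<beta> / s)\<^sup>2 \<le> (1 + \<beta>)\<^sup>2"
    using beta by (intro power_mono) (auto simp: add_nonneg_nonneg)
  then show "\<kappa> \<le> C"
    by (simp add: \<kappa>_def C_def)
qed

end

text \<open>\<open>C\<close> and \<open>v\<close> bound the sup norm of u^(0) and
  \<open>vbar0\<close> for all admissible \<open>n\<close>. By monotonicity \<open>P\<close>,
  \<open>G\<close> and \<open>Q\<close> then bound every quantity in the smallness condition of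
  \<open>conv_radius_V_ge\<close>, so \<open>z\<close> can be fixed before \<open>n\<close>.\<close>

lemma fd_radius_lower_bound:
  fixes \<alpha> \<beta> :: real and q N :: "real \<Rightarrow> real" and a :: "nat \<Rightarrow> real"
  assumes "\<And>u. (\<lambda>p. a (Suc p) * u ^ Suc p) sums N u"
  obtains z where "0 < z" "\<And>n. fd_method \<alpha> \<beta> n q N a \<Longrightarrow> ereal z \<le> Rconv \<alpha> \<beta> q a n"
proof -
  define C where "C = 1 + sqrt (1 + (1 + \<beta>)\<^sup>2)"
  define v where "v = C + 4 * C\<^sup>2 / \<alpha>"
  define L where "L = L1_norm q"
  let ?b = "\<lambda>p. \<bar>drop_const a p\<bar>"
  define P where "P = pow_series ?b (C + 1 / 4)"
  define G where "G = taylor_coeff ?b C 1"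
  \<comment> \<open>The absolute value gives \<open>z > 0\<close> before any \<open>n\<close> is
    known to satisfy the locale assumptions, hence without the sign of \<alpha>.\<close>
  define Q where "Q = \<bar>(1 + v) * (L * (1 / 4 + v) + P + G * v)\<bar>"
  define z where "z = (3 / 16) / (Q + 1)"
  have Q: "0 \<le> Q" by (simp add: Q_def)
  have z: "0 < z" using Q by (simp add: z_def add_nonneg_pos)
  have "ereal z \<le> Rconv \<alpha> \<beta> q a n" if "fd_method \<alpha> \<beta> n q N a" for n
  proof -
    interpret fd_method \<alpha> \<beta> n q N a by fact
    have C: "0 \<le> C" by (simp add: C_def)
    have "C / s \<le> C"
      using s_ge_1 C by (simp add: divide_le_eq mult_le_cancel_left1 del: s_simps)
    then have A0: "A0 \<le> C"
      using A0_le_uniform by (simp add: C_def)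
    have v: "v\<^sub>0 \<le> v"
      using v0_le_uniform by (simp add: v_def C_def)
    have P: "pow_series g (1 / 4) \<le> P"
      unfolding g_def P_def using A0 A0_pos entire_b
      by (subst pow_series_taylor) (auto intro!: pow_series_mono)
    have G: "g 1 \<le> G"
      using abs_taylor_coeff_le[of ?b A0 C 1] A0 A0_pos entire_b by (simp add: g_def G_def)
    have P0: "0 \<le> pow_series g (1 / 4)"
      by (rule pow_series_nonneg[OF entire_g]) auto
    have "(1 + v\<^sub>0) * (L1_norm q * (1 / 4 + v\<^sub>0) + pow_series g (1 / 4) + g 1 * v\<^sub>0)
        \<le> (1 + v) * (L * (1 / 4 + v) + P + G * v)"
      unfolding L_def using v P G P0 v0_pos L_nonneg
      by (intro mult_mono add_mono add_nonneg_nonneg mult_nonneg_nonneg) (auto intro: order.trans[OF g_nonneg G])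
    also have "\<dots> \<le> Q + 1"
      by (simp add: Q_def)
    finally have "z * ((1 + v\<^sub>0) * (L1_norm q * (1 / 4 + v\<^sub>0) + pow_series g (1 / 4) + g 1 * v\<^sub>0)) \<le> z * (Q + 1)"
      using z by (intro mult_left_mono) auto
    also have "z * (Q + 1) = 3 / 16"
      using Q by (intro iffD1[OF nonzero_eq_divide_eq z_def]) simp
    finally show ?thesis
      unfolding Rconv_def using z by (intro conv_radius_V_ge) (simp_all add: mult.assoc)
  qed
  with z show thesis using that by blast
qed

theorem theorem4p2:
  fixes \<alpha> \<beta> :: real and q N :: "real \<Rightarrow> real" and a :: "nat \<Rightarrow> real"
  assumes "0 < \<alpha>" and "\<alpha> < 1" and "0 \<le> \<beta>"
    and "q absolutely_integrable_on {0<..<1}"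
    and "\<And>k x. (deriv ^^ k) N field_differentiable at x"
    and "\<And>u. (\<lambda>p. a (Suc p) * u ^ Suc p) sums N u"
  shows "\<exists>n0\<ge>1. \<forall>n\<ge>n0.
    (let s = freq \<alpha> \<beta> n;
         ct = ctilde \<alpha> \<beta> n;
         M = Mconst \<alpha> \<beta> n;
         r = real_of_ereal (rconst \<alpha> \<beta> q a n);
         Rinv = real_of_ereal (1 / Rconv \<alpha> \<beta> q a n);
         lamj = fd_lam \<alpha> \<beta> q N n;
         uj = fd_u \<alpha> \<beta> q N n;
         lam = (\<Sum>j. lamj j);
         u = (\<lambda>x. \<Sum>j. uj j x)
     in rconst \<alpha> \<beta> q a n < 1 \<and>
        summable lamj \<and>
        uniform_limit {0..1} (\<lambda>m x. \<Sum>j\<le>m. uj j x) u sequentially \<and>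
        solves_problem \<alpha> \<beta> q N lam u \<and>
        (\<exists>c>0. \<exists>\<epsilon>>0. \<forall>m.
          (let \<alpha>seq = (\<lambda>j::nat. c / real j powr (1 + \<epsilon>));
               C = \<alpha>seq (m + 1) * M / (1 - r)
           in sup_norm (\<lambda>x. u x - (\<Sum>j\<le>m. uj j x))
                \<le> C * Min {1 / M, 1 / s, 1 / (s * sqrt ct)} * r ^ (m + 1) \<and>
              \<bar>lam - (\<Sum>j\<le>m. lamj j)\<bar>
                \<le> C / (M + Max {1, ct, sqrt ct * M / s}) * Rinv * r ^ m)))"
proof -
  obtain z where z: "0 < z" "\<And>n. fd_method \<alpha> \<beta> n q N a \<Longrightarrow> ereal z \<le> Rconv \<alpha> \<beta> q a n"
    using fd_radius_lower_bound[OF assms(6)] by metis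
  define C where "C = 1 + sqrt (1 + (1 + \<beta>)\<^sup>2)"
  \<comment> \<open>The summands serve the eigenvalue, \<open>1 \<le> n * \<alpha>\<close>, and
    \<kappa> < s R in turn; \<open>Suc n0\<close> makes the last inequality strict.\<close>
  obtain n0 :: nat where n0: "(\<beta> + 1) + 1 / \<alpha> + C / z \<le> real n0"
    using real_arch_simple by blast
  have C: "0 \<le> C" by (simp add: C_def)
  have pos: "0 \<le> 1 / \<alpha>" "0 \<le> C / z"
    using assms z C by auto
  show ?thesis
  proof (intro exI[of _ "Suc n0"] conjI allI impI)
    fix n assume "Suc n0 \<le> n"
    then have n: "real n0 + 1 \<le> real n" by linarith
    have "1 / \<alpha> \<le> real n" "\<beta> + 1 \<le> real n" and nz: "C / z < real n"
      using n n0 pos assms(3) by linarith+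
    then have "fd_method \<alpha> \<beta> n q N a"
      using assms by unfold_locales (auto simp: divide_le_eq absolutely_integrable_on_Icc_iff_Ioo)
    then interpret fd_method \<alpha> \<beta> n q N a .
    have R: "ereal z \<le> R"
      by (rule z(2)) unfold_locales
    then have R0: "0 < R"
      using z(1) by (meson ereal_less(2) less_le_trans)
    have "rconst \<alpha> \<beta> q a n < 1"
    proof (cases R)
      case (real R')
      then have R': "z \<le> R'" using R by simp
      have "\<kappa> \<le> C"
        using \<kappa>_le_uniform by (simp add: C_def)
      also have "C < real n * z"
        using nz z(1) by (simp add: divide_less_eq)
      also have "\<dots> \<le> s * R'"
        using s_ge_n R' z(1) by (intro mult_mono) auto
      finally have "\<kappa> / (s * R') < 1"
        using R' z(1) by (simp add: divide_less_eq)
      moreover have "rconst \<alpha> \<beta> q a n = ereal (\<kappa> / (s * R'))"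
        using R' z(1) unfolding rconst_eq real by simp
      ultimately show ?thesis by simp
    qed (use R0 in \<open>simp_all add: rconst_eq\<close>)
    with fd_converges[OF R0 this] show "let s = freq \<alpha> \<beta> n;
         ct = ctilde \<alpha> \<beta> n;
         M = Mconst \<alpha> \<beta> n;
         r = real_of_ereal (rconst \<alpha> \<beta> q a n);
         Rinv = real_of_ereal (1 / Rconv \<alpha> \<beta> q a n);
         lamj = fd_lam \<alpha> \<beta> q N n;
         uj = fd_u \<alpha> \<beta> q N n;
         lam = (\<Sum>j. lamj j);
         u = (\<lambda>x. \<Sum>j. uj j x)
     in rconst \<alpha> \<beta> q a n < 1 \<and>
        summable lamj \<and>
        uniform_limit {0..1} (\<lambda>m x. \<Sum>j\<le>m. uj j x) u sequentially \<and>
        solves_problem \<alpha> \<beta> q N lam u \<and>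
        (\<exists>c>0. \<exists>\<epsilon>>0. \<forall>m.
          (let \<alpha>seq = (\<lambda>j::nat. c / real j powr (1 + \<epsilon>));
               C = \<alpha>seq (m + 1) * M / (1 - r)
           in sup_norm (\<lambda>x. u x - (\<Sum>j\<le>m. uj j x))
                \<le> C * Min {1 / M, 1 / s, 1 / (s * sqrt ct)} * r ^ (m + 1) \<and>
              \<bar>lam - (\<Sum>j\<le>m. lamj j)\<bar>
                \<le> C / (M + Max {1, ct, sqrt ct * M / s}) * Rinv * r ^ m))"
      unfolding Let_def s_def by blast
  qed simp
qed

end
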